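(* For each $d\in\mathbb{N}$ let $p_d,q_d\in\mathcal{P}_d([0,\infty))$, and suppose $\mu_{p_d}\to\mu$ and $\mu_{q_d}\to\nu$ weakly, where $\mu,\nu$ are Borel probability measures on $[0,\infty)$. Then $\mu_{p_d\boxtimes_d q_d}\to\mu\boxtimes\nu$ weakly. Moreover, if $d_K(\mu_{p_d},\mu)\to0$ and $d_K(\mu_{q_d},\nu)\to0$, then $d_K(\mu_{p_d\boxtimes_d q_d},\mu\boxtimes\nu)\to0$.
   Context: $\mathcal{P}_d(K)$: monic degree-$d$ polynomials with all roots in $K$. For $p$ with roots $\lambda_i$, $p(x)=\sum_{k=0}^d(-1)^k\binom{d}{k}\tilde e_k(p)x^{d-k}$ with $\tilde e_k(p)=\binom{d}{k}^{-1}e_k(\lambda_1,\dots,\lambda_d)$; $p\boxtimes_d q$ is defined by $\tilde e_k(p\boxtimes_d q)=\tilde e_k(p)\tilde e_k(q)$. $\mu_p=\frac1d\sum_i\delta_{\lambda_i}$. $\boxtimes$ is the free multiplicative convolution of probability measures. Kolmogorov distance $d_K(\mu,\nu)=\sup_x|\mathcal{F}_\mu(x)-\mathcal{F}_\nu(x)|$ where $\mathcal{F}_\mu(x)=\mu((-\infty,x])$. *)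

theory Defs
  imports "HOL-Probability.Probability" "HOL-Computational_Algebra.Polynomial"
begin

definition polys_roots_in :: "nat \<Rightarrow> real set \<Rightarrow> real poly set" where
  "polys_roots_in d K = {p. degree p = d \<and> lead_coeff p = 1 \<and>
      size (proots p) = d \<and> set_mset (proots p) \<subseteq> K}"

definition esym :: "nat \<Rightarrow> real list \<Rightarrow> real" where
  "esym k xs = (\<Sum>I\<in>{I. I \<subseteq> {0..<length xs} \<and> card I = k}. \<Prod>i\<in>I. xs ! i)"

definition etilde :: "nat \<Rightarrow> real poly \<Rightarrow> nat \<Rightarrow> real" where
  "etilde d p k = esym k (sorted_list_of_multiset (proots p)) / real (d choose k)"

definition fin_free_mult :: "nat \<Rightarrow> real poly \<Rightarrow> real poly \<Rightarrow> real poly" where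
  "fin_free_mult d p q =
     (\<Sum>k\<le>d. monom ((-1)^k * real (d choose k) * etilde d p k * etilde d q k) (d - k))"

definition root_measure :: "real poly \<Rightarrow> real measure" where
  "root_measure p = distr (measure_pmf (pmf_of_multiset (proots p))) borel (\<lambda>x. x)"

definition psi_tr :: "real measure \<Rightarrow> real \<Rightarrow> real" where
  "psi_tr \<mu> x = (\<integral>t. x * t / (1 - x * t) \<partial>\<mu>)"

definition chi_tr :: "real measure \<Rightarrow> real \<Rightarrow> real" where
  "chi_tr \<mu> z = (THE x. x < 0 \<and> psi_tr \<mu> x = z)"

definition S_tr :: "real measure \<Rightarrow> real \<Rightarrow> real" where
  "S_tr \<mu> z = (1 + z) / z * chi_tr \<mu> z"

(* mu \<boxtimes> nu for Borel probability measures on [0,oo) (Bercovici-Voiculescu):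
   delta_0 if one factor is delta_0, otherwise the unique probability measure rho on [0,oo)
   whose S-transform equals S_mu * S_nu on the common domain (max(mu{0},nu{0})-1, 0). *)
definition free_mult_conv :: "real measure \<Rightarrow> real measure \<Rightarrow> real measure" where
  "free_mult_conv \<mu> \<nu> =
    (if \<mu> = return borel 0 \<or> \<nu> = return borel 0 then return borel 0
     else THE \<rho>. real_distribution \<rho> \<and> measure \<rho> {..<0} = 0 \<and>
       (\<forall>z\<in>{max (measure \<mu> {0}) (measure \<nu> {0}) - 1 <..< 0}.
          (\<exists>!x. x < 0 \<and> psi_tr \<rho> x = z) \<and> S_tr \<rho> z = S_tr \<mu> z * S_tr \<nu> z))"

definition kolmogorov_dist :: "real measure \<Rightarrow> real measure \<Rightarrow> real" where
  "kolmogorov_dist \<mu> \<nu> = (SUP x. \<bar>cdf \<mu> x - cdf \<nu> x\<bar>)"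

end

theory Submission
  imports Defs "HOL-Complex_Analysis.Complex_Analysis" "HOL-Computational_Algebra.Fundamental_Theorem_Algebra"
begin

text \<open>
  For a polynomial with roots \<open>\<lambda>\<^sub>i \<ge> 0\<close> the numbers \<open>e\<^sub>k s\<^sup>k / \<Prod>(1 + s \<lambda>\<^sub>i)\<close> are the law of a sum of independent
  Bernoulli variables with mean \<open>\<Sum> s \<lambda>\<^sub>i / (1 + s \<lambda>\<^sub>i) = - d \<psi>(-s)\<close>.  The law is log-concave, so its mode is close to its mean, and
  \<open>e\<^sub>k\<^sub>-\<^sub>1 / e\<^sub>k \<rightarrow> - \<chi>(-t)\<close> when \<open>k / d \<rightarrow> t\<close>.  These ratios multiply under \<open>\<boxtimes>\<^sub>d\<close>, so every limit point of the root
  distributions has the S-transform \<open>S\<^sub>\<mu> S\<^sub>\<nu>\<close>, which determines it; real-rootedness of \<open>p \<boxtimes>\<^sub>d q\<close> is Szego's composition theorem.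

  For the Kolmogorov distance it remains to see that no atom of \<open>\<mu> \<boxtimes> \<nu>\<close> is lost.  Roots \<open>a\<close>, \<open>b\<close> of
  multiplicities \<open>m\<close>, \<open>n\<close> give a root \<open>a b\<close> of multiplicity at least \<open>m + n - d\<close>.  Conversely, an atom \<open>c > 0\<close> of
  \<open>\<mu> \<boxtimes> \<nu>\<close> has mass \<open>\<mu>{a} + \<nu>{b} - 1\<close> for some \<open>a b = c\<close>: interlacing yields for every \<open>l > 0\<close> a probability
  measure with transform \<open>1 / (1 + l \<Omega>(y))\<close>, where \<open>\<Omega>\<close> is the subordination function of \<open>\<mu> \<boxtimes> \<nu>\<close> with respect to \<open>\<mu>\<close>, and
  the masses are read off from the behaviour of \<open>\<Omega>\<close> at \<open>-1/c\<close>.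
\<close>

subsection \<open>Elementary symmetric functions\<close>

text \<open>Weak limits can be identified on the negative axis alone, since a transform given near 0
  there already determines the measure. Existence of the free convolution is a by-product: tightness
  produces a measure with the prescribed S-transform. Atoms are harder. The mass at \<open>c\<close>
  is read off at \<open>-1/c\<close>, a boundary point of the slit plane, where nothing is known
  beforehand about the subordination function. The remedy is the whole family of kernels, one for
  each \<open>l > 0\<close>: each is the transform of a probability measure, so
  \<open>u / (1 + l * \<Omega>)\<close> stays bounded by 2 along the approach and converges to an
  atom of that measure. These measures exist already at finite degree. If one root of
  \<open>p\<close> is \<open>l\<close>, deleting it changes the k-th symmetric function by the
  factor \<open>1 / (1 + l * x)\<close>, where \<open>x\<close> is the ratio of the neighbouring
  symmetric functions of the remaining roots, and \<open>x\<close> is almost constant where the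
  Bernoulli law concentrates. Positivity of the finite weights concerns values in the upper
  half-plane, so the composition theorem is required for complex polynomials, not only for
  real-rooted ones.\<close>

lemma esym_0 [simp]: "esym 0 xs = 1"
proof -
  have "{I. I \<subseteq> {0..<length xs} \<and> card I = 0} = {{}}"
    by (auto simp: card_eq_0_iff dest: finite_subset)
  thus ?thesis by (simp add: esym_def)
qed

text \<open>Appending at the end keeps the old indices, so the index sets split according to whether
  they contain \<open>length xs\<close>. The recursion at the head of the list is obtained later
  from the generating polynomial.\<close>

lemma esym_snoc: "esym (Suc k) (xs @ [x]) = esym (Suc k) xs + x * esym k xs"
proof -
  define n where "n = length xs"
  define A where "A = {I. I \<subseteq> {0..<n} \<and> card I = Suc k}"
  define B where "B = {I. I \<subseteq> {0..<n} \<and> card I = k}"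
  have fin: "finite I" if "I \<subseteq> {0..<m}" for I and m :: nat using that finite_subset by blast
  have fAB: "finite A" "finite B"
    by (auto simp: A_def B_def intro: finite_subset[of _ "Pow {0..<n}"])
  have eq: "{I. I \<subseteq> {0..<length (xs @ [x])} \<and> card I = Suc k} = A \<union> insert n ` B"
  proof (intro equalityI subsetI)
    fix I assume "I \<in> {I. I \<subseteq> {0..<length (xs @ [x])} \<and> card I = Suc k}"
    hence I: "I \<subseteq> {0..<Suc n}" "card I = Suc k" by (auto simp: n_def)
    show "I \<in> A \<union> insert n ` B"
    proof (cases "n \<in> I")
      case True
      have "I - {n} \<in> B" using I True fin[OF I(1)] unfolding B_def by (auto simp: less_Suc_eq)
      moreover have "I = insert n (I - {n})" using True by auto
      ultimately show ?thesis by blast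
    next
      case False
      have "I \<subseteq> {0..<n}"
      proof
        fix i assume "i \<in> I" with I(1) False show "i \<in> {0..<n}" by (cases "i = n") (auto simp: less_Suc_eq)
      qed
      thus ?thesis using I by (auto simp: A_def)
    qed
  next
    fix I assume "I \<in> A \<union> insert n ` B"
    thus "I \<in> {I. I \<subseteq> {0..<length (xs @ [x])} \<and> card I = Suc k}"
    proof
      assume "I \<in> A" thus ?thesis by (auto simp: A_def n_def less_Suc_eq)
    next
      assume "I \<in> insert n ` B"
      then obtain J where J: "I = insert n J" "J \<subseteq> {0..<n}" "card J = k" by (auto simp: B_def)
      hence "n \<notin> J" "finite J" using fin by auto
      thus ?thesis using J by (auto simp: n_def less_Suc_eq)
    qed
  qed
  have inj: "inj_on (insert n) B"
  proof (rule inj_onI)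
    fix I J assume "I \<in> B" "J \<in> B" and eq: "insert n I = insert n J"
    hence "n \<notin> I" "n \<notin> J" by (auto simp: B_def)
    thus "I = J" using eq by (simp add: insert_ident)
  qed
  have disj: "A \<inter> insert n ` B = {}" by (auto simp: A_def)
  have 1: "(\<Sum>I\<in>A. \<Prod>i\<in>I. (xs @ [x]) ! i) = esym (Suc k) xs"
    unfolding esym_def A_def[symmetric] n_def[symmetric]
    by (intro sum.cong prod.cong refl) (auto simp: A_def n_def nth_append)
  have 2: "(\<Sum>I\<in>B. \<Prod>i\<in>insert n I. (xs @ [x]) ! i) = x * esym k xs"
    unfolding esym_def B_def[symmetric] n_def[symmetric] sum_distrib_left
  proof (rule sum.cong[OF refl])
    fix I assume I: "I \<in> B"
    hence "n \<notin> I" "finite I" using fin by (auto simp: B_def)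
    moreover have "(\<Prod>i\<in>I. (xs @ [x]) ! i) = (\<Prod>i\<in>I. xs ! i)"
      using I by (intro prod.cong) (auto simp: B_def n_def nth_append)
    ultimately show "(\<Prod>i\<in>insert n I. (xs @ [x]) ! i) = x * (\<Prod>i\<in>I. xs ! i)"
      by (simp add: n_def)
  qed
  show ?thesis
    unfolding esym_def[of "Suc k" "xs @ [x]"] eq
    using 1 2 by (subst sum.union_disjoint) (auto simp: fAB disj sum.reindex[OF inj])
qed

text \<open>The generating polynomial makes the index-based definition visibly symmetric;
  permutation invariance and the recursion for \<open>x # xs\<close> follow from it.\<close>

lemma esym_eq_coeff: "esym k xs = coeff (\<Prod>x\<leftarrow>xs. [:1, x:]) k"
proof (induction xs arbitrary: k rule: rev_induct)
  case Nil
  show ?case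
  proof (cases k)
    case (Suc l)
    have "{I. I \<subseteq> {0..<length []} \<and> card I = Suc l} = {}" by auto
    thus ?thesis using Suc by (simp add: esym_def)
  qed simp
next
  case (snoc x xs)
  show ?case
  proof (cases k)
    case 0
    have "coeff (\<Prod>x\<leftarrow>xs @ [x]. [:1, x:]) 0 = 1"
      by (simp add: poly_0_coeff_0[symmetric] poly_prod_list) (induction xs, auto)
    thus ?thesis using 0 by simp
  next
    case (Suc l)
    have "(\<Prod>x\<leftarrow>xs @ [x]. [:1, x:]) = [:1, x:] * (\<Prod>x\<leftarrow>xs. [:1, x:])" by (simp add: mult.commute)
    thus ?thesis using Suc snoc by (simp add: esym_snoc)
  qed
qed

lemma esym_mset_cong: "mset xs = mset ys \<Longrightarrow> esym k xs = esym k ys"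
  unfolding esym_eq_coeff by (metis prod_mset_prod_list mset_map)

lemma esym_Nil_Suc [simp]: "esym (Suc k) [] = 0"
  by (simp add: esym_eq_coeff)

lemma esym_Cons: "esym (Suc k) (x # xs) = esym (Suc k) xs + x * esym k xs"
  by (simp add: esym_eq_coeff)

lemma esym_gt_length: "k > length xs \<Longrightarrow> esym k xs = 0"
proof (induction xs arbitrary: k)
  case Nil thus ?case by (cases k) auto
next
  case (Cons x xs) thus ?case by (cases k) (auto simp: esym_Cons)
qed

lemma esym_nonneg: "set xs \<subseteq> {0..} \<Longrightarrow> esym k xs \<ge> 0"
proof (induction xs arbitrary: k)
  case Nil thus ?case by (cases k) auto
next
  case (Cons x xs) thus ?case by (cases k) (auto simp: esym_Cons)
qed

section \<open>Vieta's formulas\<close>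

lemma degree_linear_factors:
  "degree (\<Prod>x\<leftarrow>xs. [:- x, 1:]) = length (xs :: 'a :: idom list)"
proof (induction xs)
  case (Cons x xs)
  have "(\<Prod>x\<leftarrow>xs. [:- x, 1:]) \<noteq> 0" by (auto simp: prod_list_zero_iff)
  thus ?case using Cons by (simp add: degree_mult_eq del: mult_pCons_left)
qed simp

lemma vieta_coeff:
  "j \<le> length xs \<Longrightarrow> coeff (\<Prod>x\<leftarrow>xs. [:- x, 1:]) j = (-1) ^ (length xs - j) * esym (length xs - j) xs"
proof (induction xs arbitrary: j)
  case Nil thus ?case by simp
next
  case (Cons x xs)
  define n where "n = length xs"
  define P where "P = (\<Prod>x\<leftarrow>xs. [:- x, 1:])"
  have IH: "coeff P i = (-1) ^ (n - i) * esym (n - i) xs" if "i \<le> n" for i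
    using Cons.IH[of i] that by (simp add: P_def n_def)
  have deg: "degree P = n" unfolding P_def n_def by (rule degree_linear_factors)
  have eq: "(\<Prod>x\<leftarrow>x # xs. [:- x, 1:]) = smult (-x) P + pCons 0 P" by (simp add: P_def)
  have co: "coeff (\<Prod>x\<leftarrow>x # xs. [:- x, 1:]) j = - x * coeff P j + coeff (pCons 0 P) j"
    unfolding eq by simp
  have len: "length (x # xs) = Suc n" by (simp add: n_def)
  show ?case
  proof (cases j)
    case 0
    have "esym (Suc n) xs = 0" by (simp add: esym_gt_length n_def)
    thus ?thesis using 0 IH[of 0] unfolding co len by (simp add: esym_Cons)
  next
    case (Suc i)
    with Cons.prems have i: "i \<le> n" by (simp add: n_def)
    show ?thesis
    proof (cases "i = n")
      case True
      have "coeff P (Suc n) = 0" using deg by (simp add: coeff_eq_0)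
      thus ?thesis using True Suc IH[of n] unfolding co len by simp
    next
      case False
      then obtain m where m: "n - i = Suc m" "n - Suc i = m" using i by (metis Suc_diff_Suc le_neq_implies_less)
      show ?thesis using Suc IH[of i] IH[of "Suc i"] i False m
        unfolding co len by (simp add: esym_Cons algebra_simps)
    qed
  qed
qed

text \<open>If the k-th symmetric function of nonnegative entries vanishes, fewer than
  \<open>k\<close> entries are positive. Hence the sequence has no internal zeros, and its ratios
  can be compared across vanishing terms.\<close>

lemma esym_eq_0_Suc: "set xs \<subseteq> {0..} \<Longrightarrow> esym k xs = 0 \<Longrightarrow> esym (Suc k) xs = 0"
proof (induction xs arbitrary: k)
  case Nil thus ?case by simp
next
  case (Cons x xs)
  show ?case
  proof (cases k)
    case 0 thus ?thesis using Cons by simp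
  next
    case (Suc l)
    have nn: "esym k xs \<ge> 0" "esym l xs \<ge> 0" "x \<ge> 0" using Cons.prems esym_nonneg by auto
    have "esym k xs + x * esym l xs = 0" using Cons.prems(2) Suc by (simp add: esym_Cons)
    hence "esym k xs = 0" "x * esym l xs = 0" using nn by (simp_all add: add_nonneg_eq_0_iff)
    thus ?thesis using Cons.IH[of k] Cons.prems by (simp add: esym_Cons)
  qed
qed

lemma esym_eq_0_mono:
  assumes "set xs \<subseteq> {0..}" "esym k xs = 0" "k \<le> j" shows "esym j xs = 0"
  using assms(3,2) by (induction rule: dec_induct) (use assms(1) esym_eq_0_Suc in auto)

text \<open>The two-index form is needed to carry log-concavity through the induction.\<close>

lemma esym_log_concave:
  assumes "set xs \<subseteq> {0..}" "i \<le> m"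
  shows "esym i xs * esym (Suc m) xs \<le> esym (Suc i) xs * esym m xs"
  using assms
proof (induction xs arbitrary: i m)
  case Nil thus ?case by (cases m; cases i) auto
next
  case (Cons x xs)
  define e where "e k = esym k xs" for k
  have x: "x \<ge> 0" and e0: "e k \<ge> 0" for k using Cons.prems esym_nonneg by (auto simp: e_def)
  have IH: "i \<le> m \<Longrightarrow> e i * e (Suc m) \<le> e (Suc i) * e m" for i m
    using Cons by (auto simp: e_def)
  show ?case
  proof (cases m)
    case 0 thus ?thesis using Cons.prems by (simp)
  next
    case (Suc m')
    show ?thesis
    proof (cases "i = m")
      case True thus ?thesis by (simp add: mult.commute)
    next
      case False
      hence im: "i \<le> m'" using Suc Cons.prems by auto
      show ?thesis
      proof (cases i)
        case 0
        have "e (Suc m) + x * e m \<le> e 1 * e m + x * (e 1 * e m') + x * e m + x * x * e m'"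
          using IH[of 0 m] e0 x by (simp add: e_def add_increasing2)
        thus ?thesis using 0 Suc by (simp add: esym_Cons e_def[symmetric] e_def[of 0, simplified] algebra_simps)
      next
        case i: (Suc i')
        have a: "e i * e (Suc m) \<le> e (Suc i) * e m" using IH[of i m] im Suc by simp
        have b: "e i' * e m \<le> e i * e m'" using IH[of i' m'] im i Suc by simp
        \<comment> \<open>After cancellation the coefficient of \<open>x\<close> compares
          \<open>e i' * e (Suc m)\<close> with \<open>e (Suc i) * e m'\<close>, index pairs two
          steps apart; the hypothesis is applied once per step.\<close>
        have "e i' * e (Suc m) \<le> e (Suc i') * e m" using IH[of i' m] im i Suc by simp
        also have "\<dots> \<le> e (Suc i) * e m'" using IH[of i m'] im i Suc by simp
        finally have c: "x * (e i' * e (Suc m)) \<le> x * (e (Suc i) * e m')" using x by (rule mult_left_mono)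
        have b': "x * x * (e i' * e m) \<le> x * x * (e i * e m')" using b x by (intro mult_left_mono) auto
        have "(e i + x * e i') * (e (Suc m) + x * e m) \<le> (e (Suc i) + x * e i) * (e m + x * e m')"
          using a b' c by (simp add: algebra_simps)
        thus ?thesis using i Suc by (simp add: esym_Cons e_def)
      qed
    qed
  qed
qed

text \<open>By log-concavity the ratio of \<open>esym j xs\<close> to \<open>esym (Suc j) xs\<close>
  increases with \<open>j\<close>, so an upper bound at \<open>k\<close> is inherited by all smaller
  indices.\<close>

lemma esym_ratio_le_down:
  assumes "set xs \<subseteq> {0..}" "esym k xs \<le> c * esym (Suc k) xs" "esym (Suc k) xs > 0" "j \<le> k"
  shows "esym j xs \<le> c * esym (Suc j) xs"
proof -
  have "esym j xs * esym (Suc k) xs \<le> esym (Suc j) xs * esym k xs"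
    using esym_log_concave[OF assms(1), of j k] assms by simp
  also have "\<dots> \<le> esym (Suc j) xs * (c * esym (Suc k) xs)"
    using assms esym_nonneg by (intro mult_left_mono) auto
  finally have "esym (Suc k) xs * esym j xs \<le> esym (Suc k) xs * (c * esym (Suc j) xs)"
    by (simp add: mult_ac)
  thus ?thesis using assms(3) by simp
qed

text \<open>The same monotonicity carries lower bounds upwards. If \<open>esym (Suc k) xs\<close>
  vanishes, so do all later terms, which settles the case where division is impossible.\<close>

lemma esym_ratio_ge_up:
  assumes "set xs \<subseteq> {0..}" "esym k xs \<ge> c * esym (Suc k) xs" "k \<le> j"
  shows "esym j xs \<ge> c * esym (Suc j) xs"
proof (cases "esym (Suc k) xs = 0")
  case True
  hence "esym (Suc j) xs = 0" using esym_eq_0_mono[OF assms(1) True, of "Suc j"] assms(3) by simp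
  thus ?thesis using esym_nonneg assms(1) by simp
next
  case False
  hence pos: "esym (Suc k) xs > 0" using esym_nonneg[OF assms(1), of "Suc k"] by linarith
  have "(c * esym (Suc k) xs) * esym (Suc j) xs \<le> esym k xs * esym (Suc j) xs"
    using assms esym_nonneg by (intro mult_right_mono) auto
  also have "\<dots> \<le> esym (Suc k) xs * esym j xs" using esym_log_concave[OF assms(1,3)] .
  finally have "esym (Suc k) xs * (c * esym (Suc j) xs) \<le> esym (Suc k) xs * esym j xs"
    by (simp add: mult_ac)
  thus ?thesis using pos by simp
qed

text \<open>After division by \<open>\<Prod>(1 + s x)\<close> the numbers \<open>e\<^sub>k s\<^sup>k\<close> become the law of a sum of independent Bernoulli variables, with
  mean \<open>bmean s xs\<close>.\<close>

definition bmean :: "real \<Rightarrow> real list \<Rightarrow> real" where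
  "bmean s xs = (\<Sum>x\<leftarrow>xs. s * x / (1 + s * x))"

lemma bmean_Cons: "bmean s (x # xs) = s * x / (1 + s * x) + bmean s xs"
  by (simp add: bmean_def)

definition btot :: "real \<Rightarrow> real list \<Rightarrow> real" where
  "btot s xs = (\<Prod>x\<leftarrow>xs. 1 + s * x)"

lemma btot_pos: "set xs \<subseteq> {0..} \<Longrightarrow> s \<ge> 0 \<Longrightarrow> btot s xs > 0"
  by (induction xs) (auto simp: btot_def add_pos_nonneg)

text \<open>A new entry \<open>x\<close> adds an independent Bernoulli variable with odds
  \<open>s * x\<close> to 1, which shifts the argument of the test function \<open>\<phi>\<close>.
  Total mass, mean and second moment are the instances used below.\<close>

lemma esym_sum_Cons:
  "(\<Sum>k\<le>Suc (length xs). \<phi> k * (esym k (x # xs) * s ^ k)) =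
   (\<Sum>k\<le>length xs. \<phi> k * (esym k xs * s ^ k)) + s * x * (\<Sum>k\<le>length xs. \<phi> (Suc k) * (esym k xs * s ^ k))"
proof -
  have "(\<Sum>k\<le>Suc (length xs). \<phi> k * (esym k (x # xs) * s ^ k)) =
     \<phi> 0 + (\<Sum>k\<le>length xs. \<phi> (Suc k) * (esym (Suc k) xs * s ^ Suc k)
        + s * x * (\<phi> (Suc k) * (esym k xs * s ^ k)))"
    by (subst sum.atMost_Suc_shift) (simp add: esym_Cons algebra_simps)
  also have "\<dots> = (\<Sum>k\<le>Suc (length xs). \<phi> k * (esym k xs * s ^ k))
      + s * x * (\<Sum>k\<le>length xs. \<phi> (Suc k) * (esym k xs * s ^ k))"
    unfolding sum.atMost_Suc_shift[of "\<lambda>k. \<phi> k * (esym k xs * s ^ k)"]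
    by (simp add: sum.distrib sum_distrib_left)
  finally show ?thesis by (simp add: esym_gt_length)
qed

lemma esym_sum: "(\<Sum>k\<le>length xs. esym k xs * s ^ k) = btot s xs"
proof (induction xs)
  case (Cons x xs)
  show ?case using esym_sum_Cons[of "\<lambda>_. 1" x xs s] Cons by (simp add: btot_def algebra_simps)
qed (simp add: btot_def)

lemma esym_mean:
  assumes "set xs \<subseteq> {0..}" "s \<ge> 0"
  shows "(\<Sum>k\<le>length xs. real k * (esym k xs * s ^ k)) = btot s xs * bmean s xs"
  using assms
proof (induction xs)
  case (Cons x xs)
  have "1 + s * x > 0" using Cons.prems by (simp add: add_pos_nonneg)
  moreover have "btot s (x # xs) = (1 + s * x) * btot s xs" by (simp add: btot_def)
  ultimately have *: "btot s (x # xs) * bmean s (x # xs) = btot s xs * (s * x) + btot s (x # xs) * bmean s xs"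
    by (simp add: bmean_Cons field_simps)
  have "(\<Sum>k\<le>length (x # xs). real k * (esym k (x # xs) * s ^ k)) =
      btot s xs * bmean s xs + s * x * (\<Sum>k\<le>length xs. real k * (esym k xs * s ^ k) + esym k xs * s ^ k)"
    using esym_sum_Cons[of real x xs s] Cons by (simp add: algebra_simps)
  also have "\<dots> = btot s (x # xs) * bmean s (x # xs)"
    unfolding * sum.distrib esym_sum using Cons by (simp add: btot_def algebra_simps)
  finally show ?case .
qed (simp add: bmean_def)

text \<open>The centre \<open>y\<close> is arbitrary because a new Bernoulli variable moves it to
  \<open>y - 1\<close> in part of the sum. The term \<open>length xs\<close> bounds the variance
  crudely, by 1 per variable; only its linear order matters for Chebyshev's inequality.\<close>

lemma esym_variance:
  assumes "set xs \<subseteq> {0..}" "s \<ge> 0"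
  shows "(\<Sum>k\<le>length xs. (real k - y)\<^sup>2 * (esym k xs * s ^ k)) \<le> btot s xs * ((bmean s xs - y)\<^sup>2 + length xs)"
  using assms
proof (induction xs arbitrary: y)
  case (Cons x xs)
  define Z where "Z = btot s xs"
  define m where "m = bmean s xs"
  have sx: "s * x \<ge> 0" "1 + s * x > 0" using Cons.prems by (auto simp: add_pos_nonneg)
  have Z: "Z > 0" using Cons.prems btot_pos by (simp add: Z_def)
  have IH: "(\<Sum>k\<le>length xs. (real k - y)\<^sup>2 * (esym k xs * s ^ k)) \<le> Z * ((m - y)\<^sup>2 + length xs)" for y
    using Cons by (simp add: Z_def m_def)
  define r where "r = s * x / (1 + s * x)"
  have r: "0 \<le> r" "r \<le> 1" "(1 + s * x) * r = s * x" using sx by (auto simp: r_def)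
  have "(\<Sum>k\<le>length (x # xs). (real k - y)\<^sup>2 * (esym k (x # xs) * s ^ k)) =
      (\<Sum>k\<le>length xs. (real k - y)\<^sup>2 * (esym k xs * s ^ k)) +
      s * x * (\<Sum>k\<le>length xs. (real k - (y - 1))\<^sup>2 * (esym k xs * s ^ k))"
    using esym_sum_Cons[of "\<lambda>k. (real k - y)\<^sup>2" x xs s] by (simp add: algebra_simps)
  also have "\<dots> \<le> Z * ((m - y)\<^sup>2 + length xs) + s * x * (Z * ((m - (y - 1))\<^sup>2 + length xs))"
    using IH sx by (intro add_mono mult_left_mono) auto
  also have "\<dots> = Z * ((1 + s * x) * ((m - y)\<^sup>2 + length xs) + s * x * (2 * (m - y) + 1))"
    by (simp add: algebra_simps power2_eq_square)
  also have "\<dots> = Z * (1 + s * x) * ((m - y)\<^sup>2 + length xs + r * (2 * (m - y) + 1))"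
  proof -
    have "s * x * (2 * (m - y) + 1) = (1 + s * x) * (r * (2 * (m - y) + 1))"
      unfolding mult.assoc[symmetric] r(3) ..
    hence "(1 + s * x) * ((m - y)\<^sup>2 + length xs) + s * x * (2 * (m - y) + 1) =
        (1 + s * x) * ((m - y)\<^sup>2 + length xs + r * (2 * (m - y) + 1))"
      by (simp only: distrib_left)
    thus ?thesis by (simp only: mult.assoc)
  qed
  also have "\<dots> \<le> Z * (1 + s * x) * ((r + m - y)\<^sup>2 + length (x # xs))"
  proof (rule mult_left_mono)
    have "r * (1 - r) \<le> 1" using mult_mono[of r 1 "1-r" 1] r by simp
    thus "(m - y)\<^sup>2 + length xs + r * (2 * (m - y) + 1) \<le> (r + m - y)\<^sup>2 + length (x # xs)"
      by (simp add: algebra_simps power2_eq_square)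
  qed (use Z sx in auto)
  finally show ?case by (simp add: bmean_Cons btot_def Z_def m_def r_def mult.commute)
qed (simp add: btot_def bmean_def)

text \<open>The mode of a log-concave law lies close to its mean.  Both estimates come from summation by parts.\<close>

lemma bmean_ge_of_ratio:
  assumes xs: "set xs \<subseteq> {0..}" and s: "s > 0" and th: "0 < \<theta>" "\<theta> < 1"
    and k: "esym k xs < \<theta> * s * esym (Suc k) xs"
  shows "bmean s xs \<ge> real (Suc k) - \<theta> / (1 - \<theta>)"
proof -
  define n where "n = length xs"
  define a where "a j = esym j xs * s ^ j" for j
  define K where "K = Suc k"
  define Z where "Z = btot s xs"
  have Z: "Z > 0" using btot_pos[OF xs] s by (simp add: Z_def)
  have a0: "a j \<ge> 0" for j using esym_nonneg[OF xs] s by (simp add: a_def)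
  have "0 < \<theta> * s * esym (Suc k) xs" using k esym_nonneg[OF xs, of k] by linarith
  hence pos: "esym (Suc k) xs > 0" using th s by (simp add: zero_less_mult_iff) (auto simp: mult_less_0_iff)
  have step: "a j \<le> \<theta> * a (Suc j)" if "j \<le> k" for j
  proof -
    have "esym j xs \<le> \<theta> * s * esym (Suc j) xs"
      using esym_ratio_le_down[OF xs, of k "\<theta> * s" j] k pos that by simp
    hence "esym j xs * s ^ j \<le> \<theta> * s * esym (Suc j) xs * s ^ j" using s by (intro mult_right_mono) auto
    thus ?thesis by (simp add: a_def mult_ac)
  qed
  \<comment> \<open>\<open>T\<close> is the unnormalised expected shortfall below \<open>K\<close>,
    with truncated subtraction as positive part. Geometric growth below \<open>K\<close> gives
    \<open>T \<le> \<theta> * (T + Z)\<close>, and solving for \<open>T\<close> produces the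
    constant \<open>\<theta> / (1 - \<theta>)\<close>.\<close>
  define T where "T = (\<Sum>j\<le>n. real (K - j) * a j)"
  have "T \<le> (\<Sum>j\<le>n. \<theta> * (real (K - j) * a (Suc j)))"
    unfolding T_def
  proof (rule sum_mono)
    fix j show "real (K - j) * a j \<le> \<theta> * (real (K - j) * a (Suc j))"
      by (cases "j \<le> k") (use step[of j] in \<open>auto simp: K_def mult.left_commute intro: mult_left_mono\<close>)
  qed
  also have "\<dots> = \<theta> * (\<Sum>j\<le>n. real (K - j) * a (Suc j))" by (simp add: sum_distrib_left)
  also have "\<dots> \<le> \<theta> * (\<Sum>j\<le>n. (real (K - Suc j) + 1) * a (Suc j))"
    using th a0 by (intro mult_left_mono sum_mono mult_right_mono) auto
  also have "(\<Sum>j\<le>n. (real (K - Suc j) + 1) * a (Suc j)) \<le> (\<Sum>j\<le>Suc n. (real (K - j) + 1) * a j)"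
    unfolding sum.atMost_Suc_shift[of "\<lambda>j. (real (K - j) + 1) * a j"] using a0[of 0] by simp
  also have "\<dots> = T + Z"
    using esym_sum[of xs s] esym_gt_length[of xs "Suc n"]
    by (simp add: T_def Z_def a_def n_def algebra_simps sum.distrib)
  finally have "T \<le> \<theta> * (T + Z)" using th by simp
  hence T: "T \<le> \<theta> / (1 - \<theta>) * Z" using th by (simp add: field_simps)
  have "Z * (real K - bmean s xs) = (\<Sum>j\<le>n. (real K - real j) * a j)"
    using esym_sum[of xs s] esym_mean[OF xs, of s] s
    by (simp add: Z_def n_def a_def left_diff_distrib right_diff_distrib sum_subtractf sum_distrib_left[symmetric])
  also have "\<dots> \<le> T" unfolding T_def using a0 by (intro sum_mono mult_right_mono) auto
  finally have "Z * (real K - bmean s xs) \<le> Z * (\<theta> / (1 - \<theta>))" using T by (simp add: mult.commute)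
  hence "real K - bmean s xs \<le> \<theta> / (1 - \<theta>)" using Z by (simp only: mult_le_cancel_left_pos)
  thus ?thesis by (simp add: K_def)
qed

lemma bmean_le_of_ratio:
  assumes xs: "set xs \<subseteq> {0..}" and s: "s > 0" and th: "0 < \<theta>" "\<theta> < 1"
    and k: "\<theta> * esym k xs \<ge> s * esym (Suc k) xs"
  shows "bmean s xs \<le> real k + \<theta> / (1 - \<theta>)"
proof -
  define n where "n = length xs"
  define a where "a j = esym j xs * s ^ j" for j
  define Z where "Z = btot s xs"
  have Z: "Z > 0" using btot_pos[OF xs] s by (simp add: Z_def)
  have a0: "a j \<ge> 0" for j using esym_nonneg[OF xs] s by (simp add: a_def)
  have step: "a (Suc j) \<le> \<theta> * a j" if "k \<le> j" for j
  proof -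
    have "esym j xs \<ge> s / \<theta> * esym (Suc j) xs"
      using esym_ratio_ge_up[OF xs, of "s / \<theta>" k j] k th that by (simp add: field_simps)
    hence "s * esym (Suc j) xs \<le> \<theta> * esym j xs" using th by (simp add: field_simps)
    hence "s * esym (Suc j) xs * s ^ j \<le> \<theta> * esym j xs * s ^ j" using s by (intro mult_right_mono) auto
    thus ?thesis by (simp add: a_def mult_ac)
  qed
  \<comment> \<open>Now the expected excess above \<open>k\<close>, where the terms decay by the
    factor \<open>\<theta>\<close>.\<close>
  define T where "T = (\<Sum>j\<le>n. real (j - k) * a j)"
  have "T \<le> (\<Sum>j\<le>Suc n. real (j - k) * a j)" using a0 by (simp add: T_def)
  also have "\<dots> = (\<Sum>j\<le>n. real (Suc j - k) * a (Suc j))"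
    by (subst sum.atMost_Suc_shift) simp
  also have "\<dots> \<le> (\<Sum>j\<le>n. \<theta> * (real (Suc j - k) * a j))"
  proof (rule sum_mono)
    fix j show "real (Suc j - k) * a (Suc j) \<le> \<theta> * (real (Suc j - k) * a j)"
      by (cases "k \<le> j") (use step[of j] in \<open>auto simp: mult.left_commute intro: mult_left_mono\<close>)
  qed
  also have "\<dots> \<le> \<theta> * (\<Sum>j\<le>n. (real (j - k) + 1) * a j)"
    unfolding sum_distrib_left using th a0 by (intro mult_left_mono sum_mono mult_right_mono) auto
  also have "\<dots> = \<theta> * (T + Z)"
    using esym_sum[of xs s] by (simp add: T_def Z_def a_def n_def algebra_simps sum.distrib)
  finally have "T \<le> \<theta> * (T + Z)" .
  hence T: "T \<le> \<theta> / (1 - \<theta>) * Z" using th by (simp add: field_simps)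
  have "Z * (bmean s xs - real k) = (\<Sum>j\<le>n. (real j - real k) * a j)"
    using esym_sum[of xs s] esym_mean[OF xs, of s] s
    by (simp add: Z_def n_def a_def left_diff_distrib right_diff_distrib sum_subtractf sum_distrib_left[symmetric])
  also have "\<dots> \<le> T" unfolding T_def using a0 by (intro sum_mono mult_right_mono) auto
  finally have "Z * (bmean s xs - real k) \<le> Z * (\<theta> / (1 - \<theta>))" using T by (simp add: mult.commute)
  hence "bmean s xs - real k \<le> \<theta> / (1 - \<theta>)" using Z by (simp only: mult_le_cancel_left_pos)
  thus ?thesis by simp
qed

lemma map_poly_of_real_mult:
  "map_poly complex_of_real (p * q) = map_poly complex_of_real p * map_poly complex_of_real q"
  by (rule poly_eqI) (simp add: coeff_map_poly coeff_mult)

lemma poly_map_of_real: "poly (map_poly complex_of_real p) (of_real x) = of_real (poly p x)"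
  by (simp add: poly_altdef degree_map_poly coeff_map_poly)

subsection \<open>Szego's composition theorem\<close>

lemma poly_lfactors: "poly (\<Prod>a\<leftarrow>as. [:- a, 1:]) z = (\<Prod>a\<leftarrow>as. z - (a :: 'a :: idom))"
  by (induction as) (simp_all del: mult_pCons_left)

lemma pderiv_linear_factors:
  fixes as :: "complex list"
  assumes "z \<notin> set as"
  shows "poly (pderiv (\<Prod>a\<leftarrow>as. [:- a, 1:])) z = poly (\<Prod>a\<leftarrow>as. [:- a, 1:]) z * (\<Sum>a\<leftarrow>as. 1 / (z - a))"
  using assms
proof (induction as)
  case (Cons a as)
  have "z - a \<noteq> 0" using Cons.prems by auto
  thus ?case using Cons
    by (simp add: pderiv_mult pderiv_pCons field_simps del: mult_pCons_left)
qed simp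

lemma coeff_linear_factors_top:
  fixes as :: "'a :: idom list"
  shows "coeff (\<Prod>a\<leftarrow>as. [:- a, 1:]) (length as) = 1"
    and "length as = Suc n \<Longrightarrow> coeff (\<Prod>a\<leftarrow>as. [:- a, 1:]) n = - sum_list as"
proof -
  show top: "coeff (\<Prod>a\<leftarrow>as. [:- a, 1:]) (length as) = 1" for as :: "'a list"
    by (induction as) (auto simp: degree_linear_factors coeff_eq_0)
  show "length as = Suc n \<Longrightarrow> coeff (\<Prod>a\<leftarrow>as. [:- a, 1:]) n = - sum_list as"
  proof (induction as arbitrary: n)
    case (Cons a as)
    show ?case
    proof (cases n)
      case 0 thus ?thesis using Cons by simp
    next
      case (Suc m)
      thus ?thesis using Cons top[of as] by simp
    qed
  qed simp
qed

lemma complex_poly_lfactorE: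
  fixes f :: "complex poly"
  assumes "f \<noteq> 0"
  obtains as where "f = smult (lead_coeff f) (\<Prod>a\<leftarrow>as. [:- a, 1:])" "length as = degree f"
    "\<And>a. a \<in> set as \<longleftrightarrow> poly f a = 0"
proof -
  obtain as where as: "mset as = proots f" using ex_mset by blast
  have "f = smult (lead_coeff f) (\<Prod>a\<leftarrow>as. [:- a, 1:])"
    using complex_poly_decompose_multiset[of f]
    unfolding as[symmetric] mset_map[symmetric] prod_mset_prod_list by simp
  moreover have "length as = degree f" using as size_proots_complex[of f] by (metis size_mset)
  moreover have "a \<in> set as \<longleftrightarrow> poly f a = 0" for a
    unfolding set_mset_mset[symmetric] as using assms by simp
  ultimately show ?thesis using that by blast
qed

text \<open>Inversion sends the half-plane above height \<open>y\<close> into the disc with centre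
  \<open>-i / (2y)\<close> that touches the real line at 0. A disc is convex, so averages of such
  inverses stay in it.\<close>

lemma inverse_in_disc:
  fixes u :: complex
  assumes "y > 0" "Im u \<ge> y"
  shows "cmod (1 / u + \<i> / (2 * of_real y)) \<le> 1 / (2 * y)"
proof -
  have u0: "u \<noteq> 0" using assms by auto
  have "cmod (2 * of_real y + \<i> * u) \<le> cmod u"
  proof (rule power2_le_imp_le)
    have "(2 * y - Im u)\<^sup>2 + (Re u)\<^sup>2 \<le> (Re u)\<^sup>2 + (Im u)\<^sup>2"
      using assms mult_left_mono[of y "Im u" "4 * y"] by (simp add: power2_eq_square algebra_simps)
    thus "(cmod (2 * of_real y + \<i> * u))\<^sup>2 \<le> (cmod u)\<^sup>2" by (simp add: cmod_power2)
  qed simp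
  moreover have "1 / u + \<i> / (2 * of_real y) = (2 * of_real y + \<i> * u) / (2 * of_real y * u)"
    using u0 assms by (simp add: field_simps)
  ultimately show ?thesis using assms u0 by (simp add: norm_divide norm_mult divide_simps)
qed

text \<open>Laguerre's theorem on polar derivatives: for \<open>\<beta> > 0\<close> the polynomial \<open>g\<close> is \<open>\<beta>\<close> times the polar derivative of \<open>f\<close> with pole \<open>x / \<beta>\<close>,
  and \<open>\<beta> = 0\<close> is the pole at infinity.  The numbers \<open>1 / (z - a)\<close> lie in a disc determined by \<open>Im z\<close>, hence so does their average.\<close>

lemma laguerre_polar:
  fixes f :: "complex poly" and \<beta> :: real
  assumes deg: "degree f = Suc n" and f: "\<And>z. Im z > 0 \<Longrightarrow> poly f z \<noteq> 0"
    and \<beta>: "\<beta> \<ge> 0" and x: "Im x > 0"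
  defines "g \<equiv> smult (of_real \<beta>) (smult (of_nat (Suc n)) f - pCons 0 (pderiv f)) + smult x (pderiv f)"
  shows "degree g = n" and "Im z > 0 \<Longrightarrow> poly g z \<noteq> 0"
    and "coeff g j = of_real \<beta> * (of_nat (Suc n) - of_nat j) * coeff f j + x * of_nat (Suc j) * coeff f (Suc j)"
proof -
  define c where "c = lead_coeff f"
  have c0: "c \<noteq> 0" using deg by (metis c_def degree_0 leading_coeff_0_iff nat.distinct(1))
  obtain as where as: "f = smult c (\<Prod>a\<leftarrow>as. [:- a, 1:])" "length as = Suc n"
    "\<And>a. a \<in> set as \<longleftrightarrow> poly f a = 0"
    using complex_poly_lfactorE[of f] deg c0 by (metis c_def leading_coeff_0_iff)
  have Ima: "Im a \<le> 0" if "a \<in> set as" for a using as(3) that f by force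
  show co: "coeff g j = of_real \<beta> * (of_nat (Suc n) - of_nat j) * coeff f j + x * of_nat (Suc j) * coeff f (Suc j)" for j
    by (cases j) (simp_all add: g_def coeff_pderiv coeff_pCons algebra_simps)
  \<comment> \<open>For \<open>\<beta> > 0\<close> the degree would drop below \<open>n\<close> only
    if the pole \<open>x / \<beta>\<close> were the centroid of the roots; but the roots lie in the
    closed lower half-plane and \<open>x\<close> in the open upper one.\<close>
  have "coeff g n = c * (of_nat (Suc n) * x - of_real \<beta> * sum_list as)"
    using coeff_linear_factors_top[of as] as(2) unfolding co by (simp add: as(1) algebra_simps)
  moreover have "Im (sum_list as) \<le> 0" using Ima
  proof (induction as)
    case (Cons a as)
    hence "Im a \<le> 0" "Im (sum_list as) \<le> 0" by auto
    thus ?case by simp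
  qed simp
  hence "Im (of_nat (Suc n) * x - of_real \<beta> * sum_list as) > 0"
  proof -
    have "\<beta> * Im (sum_list as) \<le> 0" using \<beta> \<open>Im (sum_list as) \<le> 0\<close> by (rule mult_nonneg_nonpos)
    moreover have "real (Suc n) * Im x > 0" using x by simp
    ultimately show ?thesis by (simp del: of_nat_Suc)
  qed
  hence "of_nat (Suc n) * x - of_real \<beta> * sum_list as \<noteq> 0" by (metis less_irrefl zero_complex.simps(2))
  ultimately have "coeff g n \<noteq> 0" using c0 by (simp del: of_nat_Suc)
  moreover have "coeff g j = 0" if "j > n" for j
  proof (cases "j = Suc n")
    case True
    have "coeff f (Suc (Suc n)) = 0" using deg by (simp add: coeff_eq_0)
    thus ?thesis unfolding co True by simp
  next
    case False
    hence "coeff f j = 0" "coeff f (Suc j) = 0" using deg that by (auto simp: coeff_eq_0)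
    thus ?thesis unfolding co by simp
  qed
  ultimately show "degree g = n" by (metis leading_coeff_neq_0 le_degree le_neq_implies_less degree_0 coeff_0)
  show "poly g z \<noteq> 0" if z: "Im z > 0"
  proof
    assume g0: "poly g z = 0"
    define S where "S = (\<Sum>a\<leftarrow>as. 1 / (z - a))"
    define y where "y = Im z"
    have y: "y > 0" using z by (simp add: y_def)
    have zas: "z \<notin> set as" using Ima z by force
    have fz: "poly f z \<noteq> 0" using f z by blast
    have "poly (pderiv f) z = poly f z * S"
      using pderiv_linear_factors[OF zas] by (simp add: as(1) S_def pderiv_smult)
    hence "poly f z * (of_real \<beta> * (of_nat (Suc n)) - (of_real \<beta> * z - x) * S) = 0"
      using g0 by (simp add: g_def algebra_simps)
    hence eq: "of_real \<beta> * (of_nat (Suc n)) = (of_real \<beta> * z - x) * S" using fz by simp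
    have "cmod (S + of_nat (length as) * (\<i> / (2 * of_real y))) \<le> length as * (1 / (2 * y)) \<and> (as \<noteq> [] \<longrightarrow> Im S < 0)"
      unfolding S_def using Ima
    proof (induction as)
      case (Cons a as)
      have Im: "Im (z - a) \<ge> y" using Cons.prems by (simp add: y_def)
      have 1: "cmod (1 / (z - a) + \<i> / (2 * of_real y)) \<le> 1 / (2 * y)" by (rule inverse_in_disc[OF y Im])
      have IH: "cmod ((\<Sum>a\<leftarrow>as. 1 / (z - a)) + of_nat (length as) * (\<i> / (2 * of_real y))) \<le> length as * (1 / (2 * y))"
        "as \<noteq> [] \<longrightarrow> Im (\<Sum>a\<leftarrow>as. 1 / (z - a)) < 0"
        using Cons by auto
      have "z - a \<noteq> 0" using Im y by auto
      hence "Im (1 / (z - a)) < 0" using Im y by (simp add: Im_divide complex_eq_iff divide_less_0_iff sum_power2_gt_zero_iff)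
      hence "Im (\<Sum>a\<leftarrow>a # as. 1 / (z - a)) < 0" using IH(2) by (cases "as = []") auto
      moreover have eq: "(\<Sum>a\<leftarrow>a # as. 1 / (z - a)) + of_nat (length (a # as)) * (\<i> / (2 * of_real y)) =
         ((\<Sum>a\<leftarrow>as. 1 / (z - a)) + of_nat (length as) * (\<i> / (2 * of_real y))) + (1 / (z - a) + \<i> / (2 * of_real y))"
        by (simp add: distrib_right add_ac del: times_divide_eq_right)
      have "cmod ((\<Sum>a\<leftarrow>a # as. 1 / (z - a)) + of_nat (length (a # as)) * (\<i> / (2 * of_real y)))
         \<le> length (a # as) * (1 / (2 * y))"
        unfolding eq
        by (rule order.trans[OF norm_triangle_mono[OF IH(1) 1]]) (simp add: distrib_right del: times_divide_eq_right)
      ultimately show ?case by blast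
    qed simp
    hence disc: "cmod (S + of_nat (Suc n) * (\<i> / (2 * of_real y))) \<le> Suc n * (1 / (2 * y))" and ImS: "Im S < 0"
      using as(2) by auto
    define N where "N = real (Suc n)"
    have N: "N > 0" by (simp add: N_def)
    have "S + of_nat (Suc n) * (\<i> / (2 * of_real y)) = S + of_real (N / (2 * y)) * \<i>"
      by (simp add: N_def)
    hence "cmod (S + of_real (N / (2 * y)) * \<i>) \<le> N / (2 * y)" using disc by (simp add: N_def)
    hence "(cmod (S + of_real (N / (2 * y)) * \<i>))\<^sup>2 \<le> (N / (2 * y))\<^sup>2"
      by (intro power_mono) auto
    moreover have "(cmod (S + of_real t * \<i>))\<^sup>2 = (Re S)\<^sup>2 + (Im S)\<^sup>2 + 2 * t * Im S + t\<^sup>2" for t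
      by (simp add: cmod_power2 power2_sum algebra_simps)
    ultimately have "(cmod S)\<^sup>2 + 2 * (N / (2 * y)) * Im S \<le> 0"
      by (simp add: cmod_power2)
    hence "y * ((cmod S)\<^sup>2 + N / y * Im S) \<le> 0" using y by (simp add: mult_le_0_iff)
    hence S2: "y * (cmod S)\<^sup>2 \<le> - N * Im S" using y by (simp add: distrib_left)
    have Spos: "(cmod S)\<^sup>2 > 0" using ImS by (auto simp: complex_eq_iff)
    \<comment> \<open>Multiplying by \<open>cnj S\<close> and taking imaginary parts expresses
      \<open>Im x * (cmod S)\<^sup>2\<close> as
      \<open>\<beta> * (y * (cmod S)\<^sup>2 + N * Im S)\<close>, which the disc condition
      \<open>S2\<close> makes nonpositive.\<close>
    have "of_real \<beta> * of_nat (Suc n) * cnj S = (of_real \<beta> * z - x) * (S * cnj S)" unfolding eq by (simp only: mult.assoc)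
    also have "S * cnj S = of_real ((cmod S)\<^sup>2)" by (simp only: complex_norm_square)
    finally have "Im (of_real \<beta> * of_nat (Suc n) * cnj S) = Im ((of_real \<beta> * z - x) * of_real ((cmod S)\<^sup>2))" by simp
    hence "- \<beta> * N * Im S = (\<beta> * y - Im x) * (cmod S)\<^sup>2"
      by (simp add: N_def y_def algebra_simps)
    moreover have "\<beta> * (y * (cmod S)\<^sup>2) \<le> \<beta> * (- N * Im S)" using S2 \<beta> by (rule mult_left_mono)
    ultimately have "Im x * (cmod S)\<^sup>2 \<le> 0" by (simp add: algebra_simps)
    thus False using x Spos by (simp add: mult_le_0_iff)
  qed
qed

text \<open>For a monic \<open>f\<close> of degree \<open>length bs\<close> this is the finite free
  multiplicative convolution with the polynomial whose roots are \<open>bs\<close>; the signs are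
  those already carried by the coefficients of \<open>f\<close>. The general field admits complex
  \<open>f\<close>, needed both for real-rootedness and for interlacing.\<close>

definition szego_op :: "real list \<Rightarrow> 'a :: real_field poly \<Rightarrow> 'a poly" where
  "szego_op bs f = (\<Sum>j\<le>length bs. monom (coeff f j * of_real (esym (length bs - j) bs) / of_nat (length bs choose j)) j)"

lemma coeff_szego_op:
  "coeff (szego_op bs f) j = coeff f j * of_real (esym (length bs - j) bs) / of_nat (length bs choose j)"
proof (cases "j \<le> length bs")
  case True
  have "coeff (szego_op bs f) j = (\<Sum>i\<le>length bs. if i = j then coeff f j * of_real (esym (length bs - j) bs) / of_nat (length bs choose j) else 0)"
    unfolding szego_op_def coeff_sum by (intro sum.cong) auto
  thus ?thesis using True by simp
next
  case False
  thus ?thesis by (simp add: szego_op_def coeff_sum)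
qed

lemma szego_op_add: "szego_op bs (f + g) = szego_op bs f + szego_op bs g"
  by (rule poly_eqI) (simp add: coeff_szego_op ring_distribs add_divide_distrib)

lemma szego_op_smult: "szego_op bs (smult c f) = smult c (szego_op bs f)"
  by (rule poly_eqI) (simp add: coeff_szego_op)

lemma szego_op_of_real: "szego_op bs (map_poly complex_of_real f) = map_poly complex_of_real (szego_op bs f)"
  by (rule poly_eqI) (simp add: coeff_szego_op coeff_map_poly)

text \<open>Removing one entry \<open>\<beta>\<close> from the list amounts to replacing
  \<open>f\<close> by its polar derivative with pole \<open>x / \<beta>\<close>, where
  \<open>x\<close> is the very point of evaluation: up to the factor \<open>Suc n\<close> both
  compositions have the same value at \<open>x\<close>. Laguerre's theorem keeps the polar
  derivative free of zeros in the upper half-plane.\<close>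

theorem szego_composition:
  fixes f :: "complex poly"
  assumes "degree f = length bs" "set bs \<subseteq> {0..}" "\<And>z. Im z > 0 \<Longrightarrow> poly f z \<noteq> 0" "Im x > 0"
  shows "poly (szego_op bs f) x \<noteq> 0"
  using assms
proof (induction bs arbitrary: f)
  case Nil
  then obtain a where "f = [:a:]" using degree_eq_zeroE by auto
  thus ?case using Nil.prems(3)[of x] assms(4) by (simp add: szego_op_def monom_0)
next
  case (Cons \<beta> bs)
  define n where "n = length bs"
  define g where "g = smult (of_real \<beta>) (smult (of_nat (Suc n)) f - pCons 0 (pderiv f)) + smult x (pderiv f)"
  have deg: "degree f = Suc n" using Cons.prems by (simp add: n_def)
  have b0: "\<beta> \<ge> 0" using Cons.prems by simp
  have g: "degree g = n" "\<And>z. Im z > 0 \<Longrightarrow> poly g z \<noteq> 0"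
    "\<And>j. coeff g j = of_real \<beta> * (of_nat (Suc n) - of_nat j) * coeff f j + x * of_nat (Suc j) * coeff f (Suc j)"
    unfolding g_def by (rule laguerre_polar[OF deg Cons.prems(3) b0 assms(4)]; assumption)+
  have "poly (szego_op bs g) x \<noteq> 0"
    using Cons.IH[of g] g Cons.prems by (auto simp: n_def)
  define e where "e k = complex_of_real (esym k bs)" for k
  define c where "c j = coeff f j / of_nat (Suc n choose j)" for j
  have e: "e (Suc n) = 0" "e 0 = 1" by (auto simp: e_def esym_gt_length n_def)
  have "poly (szego_op bs g) x = (\<Sum>j\<le>n. coeff g j / of_nat (n choose j) * e (n - j) * x ^ j)"
    by (simp add: szego_op_def poly_sum poly_monom e_def n_def field_simps)
  \<comment> \<open>The two absorption identities convert the normalisation by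
    \<open>n choose j\<close> into those by \<open>Suc n choose j\<close> and
    \<open>Suc n choose Suc j\<close>, so that the coefficients of \<open>f\<close> appear
    normalised in degree \<open>Suc n\<close>.\<close>
  also have "\<dots> = (\<Sum>j\<le>n. of_nat (Suc n) * (of_real \<beta> * c j + x * c (Suc j)) * e (n - j) * x ^ j)"
  proof (intro sum.cong refl)
    fix j assume j: "j \<in> {..n}"
    define B where "B = (of_nat (n choose j) :: complex)"
    have B: "B \<noteq> 0" using j by (simp add: B_def)
    have "(Suc n - j) * (Suc n choose j) = Suc n * (n choose j)"
      using binomial_absorb_comp[of "Suc n" j] by simp
    hence "of_nat ((Suc n - j) * (Suc n choose j)) = (of_nat (Suc n * (n choose j)) :: complex)" by presburger
    hence 1: "(of_nat (Suc n) - of_nat j) * of_nat (Suc n choose j) = of_nat (Suc n) * B"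
      using j unfolding of_nat_mult B_def by (subst of_nat_diff[symmetric]) auto
    have "of_nat (Suc j * (Suc n choose Suc j)) = (of_nat (Suc n * (n choose j)) :: complex)"
      using Suc_times_binomial[of j n] by presburger
    hence 2: "of_nat (Suc j) * of_nat (Suc n choose Suc j) = of_nat (Suc n) * B"
      unfolding of_nat_mult B_def .
    have nz: "(of_nat (Suc n choose j) :: complex) \<noteq> 0" "(of_nat (Suc n choose Suc j) :: complex) \<noteq> 0"
      using j by (auto simp del: binomial_Suc_Suc)
    have 3: "(of_nat (Suc n) - of_nat j) / B = of_nat (Suc n) / of_nat (Suc n choose j)"
      using 1 B nz by (simp add: frac_eq_eq)
    have 4: "of_nat (Suc j) / B = of_nat (Suc n) / of_nat (Suc n choose Suc j)"
      using 2 B nz by (simp add: frac_eq_eq)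
    have "coeff g j / B = of_real \<beta> * coeff f j * ((of_nat (Suc n) - of_nat j) / B) + x * coeff f (Suc j) * (of_nat (Suc j) / B)"
    proof -
      have lin: "(a * b * c' + e' * h * k) / B = a * c' * (b / B) + e' * k * (h / B)" for a b c' e' h k :: complex
        by (simp add: add_divide_distrib mult_ac)
      show ?thesis unfolding g(3) by (rule lin)
    qed
    also have "\<dots> = of_nat (Suc n) * (of_real \<beta> * c j + x * c (Suc j))"
      unfolding 3 4 c_def by (simp add: algebra_simps)
    finally show "coeff g j / of_nat (n choose j) * e (n - j) * x ^ j =
      of_nat (Suc n) * (of_real \<beta> * c j + x * c (Suc j)) * e (n - j) * x ^ j"
      by (simp add: B_def)
  qed
  also have "\<dots> = of_nat (Suc n) * ((\<Sum>j\<le>n. of_real \<beta> * c j * e (n - j) * x ^ j) + (\<Sum>j\<le>n. c (Suc j) * e (n - j) * x ^ Suc j))"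
    unfolding sum.distrib[symmetric] sum_distrib_left by (intro sum.cong) (auto simp: algebra_simps)
  also have "(\<Sum>j\<le>n. c (Suc j) * e (n - j) * x ^ Suc j) = (\<Sum>j\<le>Suc n. c j * e (Suc n - j) * x ^ j)"
    unfolding sum.atMost_Suc_shift[of "\<lambda>j. c j * e (Suc n - j) * x ^ j"] by (simp add: e)
  also have "\<dots> = (\<Sum>j\<le>n. c j * e (Suc n - j) * x ^ j) + c (Suc n) * x ^ Suc n"
    by (simp add: e)
  also have "(\<Sum>j\<le>n. of_real \<beta> * c j * e (n - j) * x ^ j) + ((\<Sum>j\<le>n. c j * e (Suc n - j) * x ^ j) + c (Suc n) * x ^ Suc n)
    = (\<Sum>j\<le>n. c j * of_real (esym (Suc n - j) (\<beta> # bs)) * x ^ j) + c (Suc n) * x ^ Suc n"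
  proof -
    have "(\<Sum>j\<le>n. of_real \<beta> * c j * e (n - j) * x ^ j) + (\<Sum>j\<le>n. c j * e (Suc n - j) * x ^ j) =
       (\<Sum>j\<le>n. c j * of_real (esym (Suc n - j) (\<beta> # bs)) * x ^ j)"
      unfolding sum.distrib[symmetric]
    proof (intro sum.cong refl)
      fix j assume "j \<in> {..n}"
      hence "Suc n - j = Suc (n - j)" by auto
      thus "of_real \<beta> * c j * e (n - j) * x ^ j + c j * e (Suc n - j) * x ^ j =
        c j * of_real (esym (Suc n - j) (\<beta> # bs)) * x ^ j"
        by (simp add: esym_Cons e_def algebra_simps)
    qed
    thus ?thesis by (simp add: add.assoc)
  qed
  also have "\<dots> = poly (szego_op (\<beta> # bs) f) x"
    by (simp add: szego_op_def poly_sum poly_monom n_def[symmetric] c_def mult_ac del: binomial_Suc_Suc)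
  finally show ?case using \<open>poly (szego_op bs g) x \<noteq> 0\<close> by auto
qed

section \<open>Real-rootedness of the composed polynomial\<close>

lemma real_rooted_nonneg:
  fixes r :: "real poly"
  assumes "lead_coeff r = 1" "\<And>z. Im z > 0 \<Longrightarrow> poly (map_poly complex_of_real r) z \<noteq> 0"
    and "\<And>x. x < 0 \<Longrightarrow> poly r x \<noteq> 0"
  shows "\<exists>rs. length rs = degree r \<and> set rs \<subseteq> {0..} \<and> r = (\<Prod>a\<leftarrow>rs. [:- a, 1:])"
  using assms
proof (induction "degree r" arbitrary: r)
  case 0
  then obtain c where "r = [:c:]" using degree_eq_zeroE[of r] by auto
  with 0 have "r = 1" by (simp add: one_pCons)
  thus ?case using 0 by (intro exI[of _ "[]"]) auto
next
  case (Suc n)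
  define R where "R = map_poly complex_of_real r"
  have "degree R = Suc n" using Suc by (simp add: R_def degree_map_poly)
  hence "\<not> constant (poly R)" by (simp add: constant_degree)
  then obtain z where z: "poly R z = 0" using fundamental_theorem_of_algebra by blast
  have "poly R (cnj z) = cnj (poly R z)"
    by (rule poly_cnj_real[symmetric]) (simp add: R_def coeff_map_poly)
  hence "poly R (cnj z) = 0" using z by simp
  hence "\<not> Im (cnj z) > 0" "\<not> Im z > 0" using Suc.prems(2) z by (auto simp: R_def)
  hence zr: "z = complex_of_real (Re z)" by (simp add: complex_eq_iff)
  define a where "a = Re z"
  have "complex_of_real (poly r a) = poly R z" unfolding R_def a_def by (subst (2) zr) (simp add: poly_map_of_real)
  hence ra: "poly r a = 0" using z by simp
  hence a0: "a \<ge> 0" using Suc.prems(3)[of a] by force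
  obtain r' where r': "r = [:- a, 1:] * r'" using ra poly_eq_0_iff_dvd by blast
  have "r \<noteq> 0" using Suc by auto
  hence r'0: "r' \<noteq> 0" using r' by auto
  have deg: "degree r' = n" using Suc(2) r'0 unfolding r' by (simp add: degree_mult_eq del: mult_pCons_left)
  have lc: "lead_coeff r' = 1" using Suc.prems(1) r' by (simp add: lead_coeff_mult del: mult_pCons_left)
  have "map_poly complex_of_real r = map_poly complex_of_real [:- a, 1:] * map_poly complex_of_real r'"
    unfolding r' by (rule map_poly_of_real_mult)
  hence "poly (map_poly complex_of_real r') z \<noteq> 0" if "Im z > 0" for z
    using Suc.prems(2)[OF that] by auto
  moreover have "poly r' x \<noteq> 0" if "x < 0" for x using Suc.prems(3)[OF that] r' by auto
  ultimately obtain rs where rs: "length rs = n" "set rs \<subseteq> {0..}" "r' = (\<Prod>a\<leftarrow>rs. [:- a, 1:])"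
    using Suc.hyps(1)[of r'] deg lc by auto
  thus ?case using Suc(2) a0 r' by (intro exI[of _ "a # rs"]) auto
qed

lemma szego_op_real_rooted:
  assumes xs: "set xs \<subseteq> {0..}" and bs: "set bs \<subseteq> {0..}" and len: "length bs = length xs"
  obtains rs where "length rs = length xs" "set rs \<subseteq> {0..}"
    "szego_op bs (\<Prod>a\<leftarrow>xs. [:- a, 1:]) = (\<Prod>a\<leftarrow>rs. [:- a, 1:])"
    "\<And>k. esym k rs = esym k xs * esym k bs / real (length xs choose k)"
proof -
  define d where "d = length xs"
  define p where "p = (\<Prod>a\<leftarrow>xs. [:- a, 1:])"
  define r where "r = szego_op bs p"
  have degp: "degree p = d" by (simp add: p_def d_def degree_linear_factors)
  have topp: "coeff p d = 1" by (simp add: p_def d_def coeff_linear_factors_top)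
  have cor: "coeff r j = (-1) ^ (d - j) * (esym (d - j) xs * esym (d - j) bs / real (d choose j))" if "j \<le> d" for j
    using vieta_coeff[of j xs] that len by (simp add: r_def p_def coeff_szego_op d_def)
  have top: "coeff r d = 1" using cor[of d] by simp
  have degr: "degree r = d"
  proof (rule antisym)
    show "degree r \<le> d" by (rule degree_le) (auto simp: r_def coeff_szego_op degp coeff_eq_0)
    show "d \<le> degree r" using top by (intro le_degree) auto
  qed
  have "poly (map_poly complex_of_real r) z \<noteq> 0" if "Im z > 0" for z
    unfolding r_def szego_op_of_real[symmetric]
  proof (rule szego_composition[OF _ bs _ that])
    show "degree (map_poly complex_of_real p) = length bs" using degp len by (simp add: d_def degree_map_poly)
    fix w :: complex assume w: "Im w > 0"
    have "poly (map_poly complex_of_real p) w = (\<Prod>a\<leftarrow>xs. w - of_real a)"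
      unfolding p_def by (induction xs) (auto simp: map_poly_of_real_mult map_poly_pCons simp del: mult_pCons_left)
    moreover have "(\<Prod>a\<leftarrow>xs. w - of_real a) \<noteq> 0" using w by (auto simp: prod_list_zero_iff)
    ultimately show "poly (map_poly complex_of_real p) w \<noteq> 0" by simp
  qed
  \<comment> \<open>The signs of the coefficients make every term of
    \<open>(-1) ^ d * poly r x\<close> nonnegative at negative \<open>x\<close>, and the leading
    term is \<open>(-x) ^ d\<close>.\<close>
  moreover have "poly r x \<noteq> 0" if x: "x < 0" for x
  proof -
    have "(-1) ^ d * poly r x = (\<Sum>j\<le>d. (esym (d - j) xs * esym (d - j) bs / real (d choose j)) * (- x) ^ j)"
      unfolding poly_altdef degr sum_distrib_left
    proof (intro sum.cong refl)
      fix j assume "j \<in> {..d}"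
      hence "(-1::real) ^ d = (-1) ^ j * (-1) ^ (d - j)" by (simp add: power_add[symmetric])
      moreover have "(-1::real) ^ k * (-1) ^ k = 1" for k by (simp add: power_mult_distrib[symmetric])
      ultimately have "(-1::real) ^ d * (-1) ^ (d - j) = (-1) ^ j" by (simp only: mult.assoc mult_1_right)
      hence "(-1) ^ d * ((-1) ^ (d - j) * A * y) = A * ((-1) ^ j * y)" for A y :: real
        by (metis mult.assoc mult.left_commute)
      thus "(-1) ^ d * (coeff r j * x ^ j) = (esym (d - j) xs * esym (d - j) bs / real (d choose j)) * (- x) ^ j"
        unfolding power_minus[of x j] using cor[of j] \<open>j \<in> {..d}\<close> by (simp only: atMost_iff)
    qed
    also have "\<dots> \<ge> (-x) ^ d"
      using member_le_sum[of d "{..d}" "\<lambda>j. (esym (d - j) xs * esym (d - j) bs / real (d choose j)) * (- x) ^ j"] x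
      by (simp add: esym_nonneg xs bs)
    moreover have "(-x) ^ d > 0" using x by simp
    ultimately show ?thesis by auto
  qed
  ultimately obtain rs where rs: "length rs = d" "set rs \<subseteq> {0..}" "r = (\<Prod>a\<leftarrow>rs. [:- a, 1:])"
    using real_rooted_nonneg[of r] top degr by auto
  have "esym k rs = esym k xs * esym k bs / real (d choose k)" for k
  proof (cases "k \<le> d")
    case True
    have "(-1) ^ k * esym k rs = coeff r (d - k)" using vieta_coeff[of "d - k" rs] rs True by simp
    also have "\<dots> = (-1) ^ k * (esym k xs * esym k bs / real (d choose k))"
      using cor[of "d - k"] True binomial_symmetric[OF True] by simp
    finally show ?thesis by (simp only: mult_cancel_left) simp
  next
    case False thus ?thesis using rs(1) by (simp add: esym_gt_length d_def)
  qed
  thus ?thesis using that[of rs] rs by (simp add: r_def p_def d_def)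
qed

subsection \<open>Interlacing and the finite subordination kernel\<close>

text \<open>A real rational function whose imaginary part is nonpositive on the upper half-plane has
  only simple real poles with nonnegative residues. Near a pole of order \<open>k\<close> it behaves
  like \<open>C / u^k\<close>, so \<open>sin (k * \<theta>) * C\<close> must be nonnegative for all
  angles in \<open>(0, pi)\<close>. A multiple root of \<open>r\<close> is allowed provided
  \<open>g\<close> cancels all but one of its factors, hence the form of the conclusion.\<close>

lemma partial_fraction_local:
  fixes g r :: "real poly"
  assumes r0: "r \<noteq> 0" "poly r \<gamma> = 0"
    and Im: "\<And>z. Im z > 0 \<Longrightarrow> Im (poly (map_poly of_real g) z / poly (map_poly of_real r) z) \<le> 0"
  obtains m G R w where "r = [:- \<gamma>, 1:] ^ Suc m * R" "g = [:- \<gamma>, 1:] ^ m * G" "poly R \<gamma> \<noteq> 0" "w \<ge> 0"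
    "poly G \<gamma> = w * poly R \<gamma>"
proof -
  define M where "M = order \<gamma> r"
  have M: "M \<ge> 1" using r0 by (simp add: M_def order_gt_0_iff Suc_le_eq)
  obtain R where R: "r = [:- \<gamma>, 1:] ^ M * R" "\<not> [:- \<gamma>, 1:] dvd R"
    using order_decomp[OF r0(1), of \<gamma>] by (auto simp: M_def)
  have R0: "poly R \<gamma> \<noteq> 0" using R(2) by (simp add: poly_eq_0_iff_dvd)
  obtain m where m: "M = Suc m" using M by (cases M) auto
  show ?thesis
  proof (cases "g = 0")
    case True
    thus ?thesis using that[of m R 0 0] R R0 m by simp
  next
    case False
    define N where "N = order \<gamma> g"
    obtain G where G: "g = [:- \<gamma>, 1:] ^ N * G" "\<not> [:- \<gamma>, 1:] dvd G"
      using order_decomp[OF False, of \<gamma>] by (auto simp: N_def)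
    have G0: "poly G \<gamma> \<noteq> 0" using G(2) by (simp add: poly_eq_0_iff_dvd)
    show ?thesis
    proof (cases "M \<le> N")
      case True
      hence "N = m + Suc (N - M)" using m by simp
      hence "g = [:- \<gamma>, 1:] ^ m * ([:- \<gamma>, 1:] ^ Suc (N - M) * G)"
        using G(1) by (metis power_add mult.assoc)
      moreover have "poly ([:- \<gamma>, 1:] ^ Suc (N - M) * G) \<gamma> = 0 * poly R \<gamma>" by simp
      ultimately show ?thesis using that[of m R _ 0] R R0 m by blast
    next
      case False
      define k where "k = M - N"
      have k: "k \<ge> 1" "M = N + k" using False by (auto simp: k_def)
      define C where "C = poly G \<gamma> / poly R \<gamma>"
      have C0: "C \<noteq> 0" using G0 R0 by (simp add: C_def)
      have lin: "poly (map_poly complex_of_real ([:- \<gamma>, 1:] ^ n * P)) z = (z - of_real \<gamma>) ^ n * poly (map_poly complex_of_real P) z" for n P z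
        by (induction n) (simp_all add: map_poly_of_real_mult map_poly_pCons mult.assoc del: mult_pCons_left)
      have key: "sin (real k * \<theta>) * C \<ge> 0" if \<theta>: "0 < \<theta>" "\<theta> < pi" for \<theta>
      proof -
        define z where "z \<epsilon> = complex_of_real \<gamma> + of_real \<epsilon> * cis \<theta>" for \<epsilon>
        define \<phi> where "\<phi> \<epsilon> = poly (map_poly complex_of_real G) (z \<epsilon>) / poly (map_poly complex_of_real R) (z \<epsilon>) * cis (- (real k * \<theta>))" for \<epsilon>
        have z0: "(z \<longlongrightarrow> of_real \<gamma>) (at_right 0)"
          unfolding z_def by (auto intro!: tendsto_eq_intros)
        have "(\<phi> \<longlongrightarrow> poly (map_poly complex_of_real G) (of_real \<gamma>) / poly (map_poly complex_of_real R) (of_real \<gamma>) * cis (- (real k * \<theta>))) (at_right 0)"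
          unfolding \<phi>_def by (intro tendsto_intros z0) (use R0 in \<open>simp add: poly_map_of_real\<close>)
        hence "((\<lambda>\<epsilon>. Im (\<phi> \<epsilon>)) \<longlongrightarrow> Im (of_real C * cis (- (real k * \<theta>)))) (at_right 0)"
          by (intro tendsto_Im) (simp add: poly_map_of_real C_def)
        moreover have "eventually (\<lambda>\<epsilon>. Im (\<phi> \<epsilon>) \<le> 0) (at_right 0)"
          unfolding eventually_at_right_field
        proof (intro exI[of _ 1] conjI allI impI)
          fix \<epsilon> :: real assume \<epsilon>: "\<epsilon> > 0" "\<epsilon> < 1"
          have "sin \<theta> > 0" using \<theta> by (rule sin_gt_zero)
          hence "Im (z \<epsilon>) > 0" using \<epsilon> by (simp add: z_def)
          hence I: "Im (poly (map_poly of_real g) (z \<epsilon>) / poly (map_poly of_real r) (z \<epsilon>)) \<le> 0" by (rule Im)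
          define u where "u = complex_of_real \<epsilon> * cis \<theta>"
          have u: "u \<noteq> 0" using \<epsilon> by (simp add: u_def)
          have "poly (map_poly of_real g) (z \<epsilon>) / poly (map_poly of_real r) (z \<epsilon>) =
             (u ^ N * poly (map_poly of_real G) (z \<epsilon>)) / (u ^ N * u ^ k * poly (map_poly of_real R) (z \<epsilon>))"
            unfolding G(1) R(1) lin k(2) by (simp add: z_def u_def power_add)
          also have "\<dots> = poly (map_poly of_real G) (z \<epsilon>) / poly (map_poly of_real R) (z \<epsilon>) * inverse (u ^ k)"
            using u by (simp add: divide_inverse mult_ac)
          also have "inverse (u ^ k) = of_real (1 / \<epsilon> ^ k) * cis (- (real k * \<theta>))"
            by (simp add: u_def power_mult_distrib Complex.DeMoivre divide_inverse)
          finally have "poly (map_poly of_real g) (z \<epsilon>) / poly (map_poly of_real r) (z \<epsilon>) = of_real (1 / \<epsilon> ^ k) * \<phi> \<epsilon>"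
            by (simp add: \<phi>_def)
          hence "(1 / \<epsilon> ^ k) * Im (\<phi> \<epsilon>) \<le> 0"
            using I by (simp only: times_complex.sel Re_complex_of_real Im_complex_of_real mult_zero_left add_0_right)
          moreover have "1 / \<epsilon> ^ k > 0" using \<epsilon> by simp
          ultimately show "Im (\<phi> \<epsilon>) \<le> 0" by (simp only: mult_le_0_iff) linarith
        qed simp
        ultimately have "Im (of_real C * cis (- (real k * \<theta>))) \<le> 0"
          by (rule tendsto_upperbound) simp
        thus ?thesis by (simp add: mult.commute)
      qed
      have "k = 1"
      proof (rule ccontr)
        assume "k \<noteq> 1"
        hence k2: "real k \<ge> 2" using k by simp
        have "3 < 2 * real k" using k2 by simp
        hence "3 * pi < 2 * real k * pi" using pi_gt_zero by simp
        hence "3 * pi / (2 * real k) < pi" "pi / (2 * real k) < pi" using k2 by (simp_all add: field_simps)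
        \<comment> \<open>For \<open>k \<ge> 2\<close> both test angles lie below \<open>pi\<close>,
          and the sine takes the values -1 and 1 there.\<close>
        hence "sin (real k * (3 * pi / (2 * real k))) * C \<ge> 0" "sin (real k * (pi / (2 * real k))) * C \<ge> 0"
          using k2 by (intro key; simp)+
        moreover have "real k * (3 * pi / (2 * real k)) = 3 * pi / 2" "real k * (pi / (2 * real k)) = pi / 2"
          using k2 by simp_all
        ultimately have "sin (3 * pi / 2) * C \<ge> 0" "sin (pi / 2) * C \<ge> 0" by (simp_all only:)
        moreover have "sin (3 * pi / 2) = - 1" using sin_3over2_pi by simp
        ultimately have "- C \<ge> 0" "C \<ge> 0" by simp_all
        thus False using C0 by simp
      qed
      hence "M = Suc N" using k by simp
      moreover have "C \<ge> 0" using key[of "pi / 2"] \<open>k = 1\<close> by simp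
      moreover have "poly G \<gamma> = C * poly R \<gamma>" using R0 by (simp add: C_def)
      ultimately show ?thesis using that[of N R G C] R(1) R0 G(1) by simp
    qed
  qed
qed

text \<open>Let \<open>D\<close> be \<open>g\<close> minus \<open>r\<close> times the candidate
  principal parts. It vanishes at every root of \<open>r\<close> with full multiplicity while its
  degree is smaller, so it is zero. The sum runs over distinct roots because repeated factors cancel
  against \<open>g\<close>.\<close>

lemma partial_fractions_nonneg:
  fixes g r :: "real poly"
  assumes r: "r = (\<Prod>a\<leftarrow>rs. [:- a, 1:])" and deg: "g = 0 \<or> degree g < degree r"
    and Im: "\<And>z. Im z > 0 \<Longrightarrow> Im (poly (map_poly of_real g) z / poly (map_poly of_real r) z) \<le> 0"
  obtains w where "\<And>\<gamma>. \<gamma> \<in> set rs \<Longrightarrow> w \<gamma> \<ge> 0"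
    "\<And>x. x \<notin> set rs \<Longrightarrow> poly g x / poly r x = (\<Sum>\<gamma>\<in>set rs. w \<gamma> / (x - \<gamma>))"
proof -
  have r0: "r \<noteq> 0" unfolding r by (auto simp: prod_list_zero_iff)
  have root: "poly r x = 0 \<longleftrightarrow> x \<in> set rs" for x unfolding r poly_lfactors by (auto simp: prod_list_zero_iff)
  have "\<forall>\<gamma>\<in>set rs. \<exists>w. w \<ge> 0 \<and> (\<exists>m G R. r = [:- \<gamma>, 1:] ^ Suc m * R \<and> g = [:- \<gamma>, 1:] ^ m * G \<and> poly R \<gamma> \<noteq> 0 \<and> poly G \<gamma> = w * poly R \<gamma>)"
    using partial_fraction_local[OF r0 _ Im] root by metis
  then obtain w where w: "\<And>\<gamma>. \<gamma> \<in> set rs \<Longrightarrow> w \<gamma> \<ge> 0"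
    "\<And>\<gamma>. \<gamma> \<in> set rs \<Longrightarrow> \<exists>m G R. r = [:- \<gamma>, 1:] ^ Suc m * R \<and> g = [:- \<gamma>, 1:] ^ m * G \<and> poly R \<gamma> \<noteq> 0 \<and> poly G \<gamma> = w \<gamma> * poly R \<gamma>"
    by metis
  have "\<forall>\<gamma>\<in>set rs. \<exists>Q. r = [:- \<gamma>, 1:] * Q" using root poly_eq_0_iff_dvd by (metis dvdE)
  then obtain Q where Q: "\<And>\<gamma>. \<gamma> \<in> set rs \<Longrightarrow> r = [:- \<gamma>, 1:] * Q \<gamma>" by metis
  define D where "D = g - (\<Sum>\<gamma>\<in>set rs. smult (w \<gamma>) (Q \<gamma>))"
  have ord: "[:- \<gamma>, 1:] ^ order \<gamma> r dvd D" if \<gamma>: "\<gamma> \<in> set rs" for \<gamma>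
  proof -
    obtain m G R where *: "r = [:- \<gamma>, 1:] ^ Suc m * R" "g = [:- \<gamma>, 1:] ^ m * G" "poly R \<gamma> \<noteq> 0" "poly G \<gamma> = w \<gamma> * poly R \<gamma>"
      using w(2)[OF \<gamma>] by blast
    have "\<not> [:- \<gamma>, 1:] dvd R" using *(3) by (simp add: poly_eq_0_iff_dvd)
    hence om: "order \<gamma> r = Suc m"
      using * order_unique_lemma[of "\<gamma>" "Suc m" r] by (metis dvd_triv_left dvd_times_left_cancel_iff pCons_eq_0_iff power_Suc2 power_eq_0_iff one_neq_zero mult.commute)
    have "[:- \<gamma>, 1:] * Q \<gamma> = [:- \<gamma>, 1:] * ([:- \<gamma>, 1:] ^ m * R)" using Q[OF \<gamma>] *(1) by (simp only: power_Suc mult.assoc)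
    hence Qg: "Q \<gamma> = [:- \<gamma>, 1:] ^ m * R" by (subst (asm) mult_cancel_left) auto
    have "poly (G - smult (w \<gamma>) R) \<gamma> = 0" using *(4) by simp
    then obtain H where "G - smult (w \<gamma>) R = [:- \<gamma>, 1:] * H" unfolding poly_eq_0_iff_dvd by (rule dvdE)
    hence "g - smult (w \<gamma>) (Q \<gamma>) = [:- \<gamma>, 1:] ^ Suc m * H"
      unfolding *(2) Qg by (simp only: mult_smult_right[symmetric] right_diff_distrib[symmetric]) (simp only: power_Suc2 mult.assoc)
    hence 1: "[:- \<gamma>, 1:] ^ Suc m dvd g - smult (w \<gamma>) (Q \<gamma>)" by simp
    have 2: "[:- \<gamma>, 1:] ^ Suc m dvd (\<Sum>\<gamma>'\<in>set rs - {\<gamma>}. smult (w \<gamma>') (Q \<gamma>'))"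
    proof (rule dvd_sum)
      fix \<gamma>' assume \<gamma>': "\<gamma>' \<in> set rs - {\<gamma>}"
      have Q': "r = [:- \<gamma>', 1:] * Q \<gamma>'" using Q \<gamma>' by auto
      hence "order \<gamma> r = order \<gamma> [:- \<gamma>', 1:] + order \<gamma> (Q \<gamma>')" using r0 order_mult by metis
      moreover have "order \<gamma> [:- \<gamma>', 1:] = 0" using \<gamma>' by (intro order_0I) auto
      ultimately have "order \<gamma> (Q \<gamma>') = Suc m" using om by simp
      hence "[:- \<gamma>, 1:] ^ Suc m dvd Q \<gamma>'" using order_1 by metis
      thus "[:- \<gamma>, 1:] ^ Suc m dvd smult (w \<gamma>') (Q \<gamma>')" by (rule dvd_smult)
    qed
    have "D = (g - smult (w \<gamma>) (Q \<gamma>)) - (\<Sum>\<gamma>'\<in>set rs - {\<gamma>}. smult (w \<gamma>') (Q \<gamma>'))"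
      unfolding D_def by (subst sum.remove[OF finite_set \<gamma>]) simp
    thus ?thesis unfolding om using 1 2 by (simp only: dvd_diff)
  qed
  have "D = 0"
  proof (rule ccontr)
    assume D0: "D \<noteq> 0"
    have "proots r \<subseteq># proots D"
    proof (rule mset_subset_eqI)
      fix \<gamma>
      show "count (proots r) \<gamma> \<le> count (proots D) \<gamma>"
      proof (cases "\<gamma> \<in> set rs")
        case True
        thus ?thesis using ord[OF True] D0 r0 by (simp add: order_divides)
      next
        case False
        thus ?thesis using root[of \<gamma>] r0 by (simp add: order_0I)
      qed
    qed
    hence "size (proots r) \<le> size (proots D)" by (rule size_mset_mono)
    also have "\<dots> \<le> degree D" by (rule size_proots_le)
    finally have "size (proots r) \<le> degree D" .
    moreover have "size (proots r) = length rs"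
      unfolding r
    proof (induction rs)
      case (Cons a rs)
      have "[:- a, 1:] \<noteq> 0" "(\<Prod>a\<leftarrow>rs. [:- a, 1:]) \<noteq> 0" by (auto simp: prod_list_zero_iff)
      thus ?case using Cons by (simp add: proots_mult del: mult_pCons_left)
    qed simp
    ultimately have 1: "degree r \<le> degree D" by (simp add: r degree_linear_factors)
    have Qd: "degree (Q \<gamma>) < degree r" if "\<gamma> \<in> set rs" for \<gamma>
    proof -
      have "Q \<gamma> \<noteq> 0" using Q[OF that] r0 by auto
      hence "degree ([:- \<gamma>, 1:] * Q \<gamma>) = Suc (degree (Q \<gamma>))" by (simp add: degree_mult_eq del: mult_pCons_left)
      thus ?thesis using Q[OF that] by simp
    qed
    show False
    proof (cases "rs = []")
      case True
      thus ?thesis using D0 deg r by (simp add: D_def)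
    next
      case False
      hence dr: "degree r > 0" unfolding r degree_linear_factors by simp
      have "degree (\<Sum>\<gamma>\<in>set rs. smult (w \<gamma>) (Q \<gamma>)) < degree r"
        by (rule degree_sum_less) (use Qd dr in \<open>auto intro: le_less_trans[OF degree_smult_le]\<close>)
      moreover have "degree g < degree r" using deg dr by auto
      ultimately have "degree D < degree r" unfolding D_def by (intro degree_diff_less)
      thus ?thesis using 1 by simp
    qed
  qed
  hence g: "g = (\<Sum>\<gamma>\<in>set rs. smult (w \<gamma>) (Q \<gamma>))" by (simp add: D_def)
  have "poly g x / poly r x = (\<Sum>\<gamma>\<in>set rs. w \<gamma> / (x - \<gamma>))" if x: "x \<notin> set rs" for x
    unfolding g poly_sum sum_divide_distrib
  proof (intro sum.cong refl)
    fix \<gamma> assume \<gamma>: "\<gamma> \<in> set rs"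
    hence "x - \<gamma> \<noteq> 0" using x by auto
    moreover have "poly r x = (x - \<gamma>) * poly (Q \<gamma>) x" using arg_cong[OF Q[OF \<gamma>], of "\<lambda>p. poly p x"] by (simp add: algebra_simps)
    moreover have "poly r x \<noteq> 0" using root x by simp
    ultimately show "poly (smult (w \<gamma>) (Q \<gamma>)) x / poly r x = w \<gamma> / (x - \<gamma>)" by simp
  qed
  thus ?thesis using that w(1) by blast
qed

lemma esym_length: "esym (length xs) xs = prod_list xs"
  by (induction xs) (auto simp: esym_Cons esym_gt_length)

text \<open>The substitution \<open>x = -1/s\<close> absorbs the alternating signs and reverses the
  order of the coefficients, which links values of polynomials to generating functions such as
  \<open>btot\<close>.\<close>

lemma poly_at_neg_inverse:
  fixes f :: "real poly"
  assumes "degree f \<le> d" "s > 0" "\<And>k. k \<le> d \<Longrightarrow> coeff f (d - k) = (-1) ^ k * A k"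
  shows "poly f (- 1 / s) = (- 1 / s) ^ d * (\<Sum>k\<le>d. A k * s ^ k)"
proof -
  have "poly f (- 1 / s) = (\<Sum>j\<le>d. coeff f j * (- 1 / s) ^ j)"
    unfolding poly_altdef using assms(1) by (intro sum.mono_neutral_left) (auto simp: coeff_eq_0)
  also have "\<dots> = (\<Sum>k\<le>d. coeff f (d - k) * (- 1 / s) ^ (d - k))"
    by (rule sum.reindex_bij_witness[of _ "\<lambda>k. d - k" "\<lambda>k. d - k"]) auto
  also have "\<dots> = (\<Sum>k\<le>d. (- 1 / s) ^ d * (A k * s ^ k))"
  proof (intro sum.cong refl)
    fix k assume k: "k \<in> {..d}"
    have "(- 1 / s) ^ d = (- 1 / s) ^ (d - k) * (- 1 / s) ^ k" using k by (simp add: power_add[symmetric])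
    hence "(- 1 / s) ^ d * s ^ k = (- 1 / s) ^ (d - k) * ((- 1 / s) * s) ^ k" by (simp only: power_mult_distrib mult.assoc)
    also have "(- 1 / s) * s = - 1" using assms by simp
    finally have "(- 1 / s) ^ d * s ^ k = (- 1 / s) ^ (d - k) * (- 1) ^ k" .
    thus "coeff f (d - k) * (- 1 / s) ^ (d - k) = (- 1 / s) ^ d * (A k * s ^ k)"
      using assms(3)[of k] k by (simp add: mult_ac)
  qed
  finally show ?thesis by (simp add: sum_distrib_left)
qed

text \<open>Replacing one linear factor \<open>x - lam\<close> of \<open>p\<close> by \<open>x\<close> moves its root down, so after the composition with \<open>q\<close>
  the new polynomial interlaces the old one; the residues of the quotient are the weights.\<close>

lemma finite_kernel:
  assumes l: "lam > 0" and ys: "set ys \<subseteq> {0<..}" and bs: "set bs \<subseteq> {0<..}"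
    and len: "length bs = Suc (length ys)"
    and rs: "szego_op bs (\<Prod>a\<leftarrow>lam # ys. [:- a, 1:]) = (\<Prod>a\<leftarrow>rs. [:- a, 1:])" "set rs \<subseteq> {0..}" "length rs = length bs"
  obtains w where "\<And>\<gamma>. \<gamma> \<in> set rs \<Longrightarrow> w \<gamma> \<ge> 0" "(\<Sum>\<gamma>\<in>set rs. w \<gamma>) = (1::real)"
    "\<And>s. s > 0 \<Longrightarrow> (\<Sum>\<gamma>\<in>set rs. w \<gamma> / (1 + s * \<gamma>)) * btot s rs
        = (\<Sum>k\<le>length bs. esym k ys * esym k bs / real (length bs choose k) * s ^ k)"
proof -
  define d where "d = length bs"
  have d: "d = Suc (length ys)" "length rs = d" using len rs by (auto simp: d_def)
  define g where "g = (\<Prod>a\<leftarrow>ys. [:- a, 1:])"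
  define p where "p = (\<Prod>a\<leftarrow>lam # ys. [:- a, 1:])"
  define h where "h = szego_op bs (pCons 0 g)"
  define r where "r = (\<Prod>a\<leftarrow>rs. [:- a, 1:])"
  have Tp: "szego_op bs p = r" using rs by (simp add: p_def r_def)
  have pg: "p = [:- lam, 1:] * g" by (simp add: p_def g_def)
  have g0: "g \<noteq> 0" unfolding g_def by (auto simp: prod_list_zero_iff)
  have degg: "degree g = length ys" by (simp add: g_def degree_linear_factors)
  have degr: "degree r = d" by (simp add: r_def degree_linear_factors d)
  have topr: "coeff r d = 1" using coeff_linear_factors_top(1)[of rs] d by (simp add: r_def)
  have coh: "coeff h (d - k) = (-1) ^ k * (esym k ys * esym k bs / real (d choose k))" if "k \<le> d" for k
  proof (cases "k = d")
    case True
    thus ?thesis using d by (simp add: h_def coeff_szego_op esym_gt_length)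
  next
    case False
    hence "d - k = Suc (length ys - k)" "k \<le> length ys" using that d by auto
    moreover from this have "coeff g (length ys - k) = (-1) ^ k * esym k ys"
      using vieta_coeff[of "length ys - k" ys] by (simp add: g_def)
    moreover have "d choose (d - k) = d choose k" using that by (simp add: binomial_symmetric[symmetric])
    moreover have "d - (d - k) = k" using that by simp
    ultimately show ?thesis by (simp add: h_def coeff_szego_op d_def[symmetric])
  qed
  have toph: "coeff h d = 1" using coh[of 0] by simp
  have degh: "degree h \<le> d"
    by (rule degree_le) (auto simp: h_def coeff_szego_op coeff_pCons degg d coeff_eq_0 split: nat.splits)
  have h0: "poly h 0 = 0" by (simp add: poly_0_coeff_0 h_def coeff_szego_op)
  have bs0: "set bs \<subseteq> {0..}" using bs by fastforce
  \<comment> \<open>Strict positivity of all entries keeps 0 from being a root of \<open>r\<close>;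
    the weights are later divided by the roots.\<close>
  have esd: "esym d rs \<noteq> 0"
  proof -
    have "(-1) ^ d * esym d rs = coeff r 0" using vieta_coeff[of 0 rs] d by (simp add: r_def)
    also have "\<dots> = coeff p 0 * esym d bs" unfolding Tp[symmetric] by (simp add: coeff_szego_op d_def)
    also have "coeff p 0 = (-1) ^ d * esym d (lam # ys)" using vieta_coeff[of 0 "lam # ys"] d by (simp add: p_def)
    also have "esym d (lam # ys) = prod_list (lam # ys)" using esym_length[of "lam # ys"] d by simp
    also have "esym d bs = prod_list bs" using esym_length[of bs] by (simp add: d_def)
    finally have "esym d rs = prod_list (lam # ys) * prod_list bs" by simp
    moreover have "prod_list (lam # ys) \<noteq> 0" "prod_list bs \<noteq> 0" using l ys bs by (auto simp: prod_list_zero_iff)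
    ultimately show ?thesis by simp
  qed
  have r0: "poly r 0 \<noteq> 0" using vieta_coeff[of 0 rs] d esd by (simp add: r_def poly_0_coeff_0)
  have root: "poly r x = 0 \<longleftrightarrow> x \<in> set rs" for x unfolding r_def poly_lfactors by (auto simp: prod_list_zero_iff)
  have pos: "\<gamma> > 0" if "\<gamma> \<in> set rs" for \<gamma>
    using rs(2) that r0 root[of 0] by (metis atLeast_iff less_eq_real_def subsetD)
  \<comment> \<open>If \<open>h / r\<close> took a value \<open>Q\<close> with positive imaginary
    part at \<open>z\<close>, then with \<open>\<zeta> = 1 / Q\<close> the composition of
    \<open>p - \<zeta> x g\<close> would vanish at \<open>z\<close>. But this pencil equals
    \<open>((1 - \<zeta>) x - lam) g\<close>, all of whose zeros have nonpositive imaginary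
    part.\<close>
  have Imh: "Im (poly (map_poly of_real h) z / poly (map_poly of_real r) z) \<le> 0" if z: "Im z > 0" for z
  proof (rule ccontr)
    define Q where "Q = poly (map_poly of_real h) z / poly (map_poly of_real r) z"
    assume "\<not> Im (poly (map_poly of_real h) z / poly (map_poly of_real r) z) \<le> 0"
    hence Q: "Im Q > 0" by (simp add: Q_def)
    define \<zeta> where "\<zeta> = inverse Q"
    have "Q \<noteq> 0" using Q by auto
    have \<zeta>: "Im \<zeta> < 0" using Q \<open>Q \<noteq> 0\<close> by (simp add: \<zeta>_def complex_inverse divide_less_0_iff sum_power2_gt_zero_iff complex_eq_iff)
    hence one: "1 - \<zeta> \<noteq> 0" by auto
    define f where "f = [:- of_real lam, 1 - \<zeta>:] * map_poly complex_of_real g"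
    have f: "f = map_poly of_real p + smult (- \<zeta>) (map_poly of_real (pCons 0 g))"
      unfolding pg map_poly_of_real_mult f_def by (simp add: map_poly_pCons algebra_simps smult_diff_left)
    have "degree f = length bs"
    proof -
      have "map_poly complex_of_real g \<noteq> 0" using g0 by (simp add: map_poly_eq_0_iff)
      thus ?thesis using one degg len unfolding f_def by (simp add: degree_mult_eq degree_map_poly del: mult_pCons_left)
    qed
    moreover have "poly f x \<noteq> 0" if x: "Im x > 0" for x
    proof -
      have "poly (map_poly complex_of_real g) x = (\<Prod>a\<leftarrow>ys. x - of_real a)"
        unfolding g_def by (induction ys) (auto simp: map_poly_of_real_mult map_poly_pCons simp del: mult_pCons_left)
      moreover have "(\<Prod>a\<leftarrow>ys. x - of_real a) \<noteq> 0" using x by (auto simp: prod_list_zero_iff)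
      moreover have "- of_real lam + x * (1 - \<zeta>) \<noteq> 0"
      proof
        assume "- of_real lam + x * (1 - \<zeta>) = 0"
        hence "x = of_real lam * inverse (1 - \<zeta>)" using one by (simp add: field_simps)
        hence "Im x = lam * Im (inverse (1 - \<zeta>))" by simp
        moreover have "Im (inverse (1 - \<zeta>)) \<le> 0" using \<zeta> by (simp add: complex_inverse divide_nonpos_nonneg)
        ultimately have "Im x \<le> 0" using mult_nonneg_nonpos[of lam] l by (simp only: less_imp_le)
        thus False using x by simp
      qed
      ultimately show ?thesis by (simp add: f_def del: mult_pCons_left)
    qed
    ultimately have "poly (szego_op bs f) z \<noteq> 0" using szego_composition[OF _ bs0 _ z] by blast
    moreover have "poly (szego_op bs f) z = poly (map_poly of_real r) z - \<zeta> * poly (map_poly of_real h) z"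
      unfolding f szego_op_add szego_op_smult szego_op_of_real Tp h_def[symmetric] by simp
    moreover have "\<dots> = 0"
    proof -
      have "poly (map_poly complex_of_real r) z \<noteq> 0" using Q by (auto simp: Q_def)
      thus ?thesis using \<open>Q \<noteq> 0\<close> by (auto simp: \<zeta>_def Q_def field_simps)
    qed
    ultimately show False by simp
  qed
  have diff: "map_poly complex_of_real (h - r) = map_poly of_real h - map_poly of_real r"
    by (rule poly_eqI) (simp add: coeff_map_poly)
  have "Im (poly (map_poly of_real (h - r)) z / poly (map_poly of_real r) z) \<le> 0" if "Im z > 0" for z
  proof (cases "poly (map_poly complex_of_real r) z = 0")
    case False
    thus ?thesis using Imh[OF that] by (simp add: diff diff_divide_distrib)
  qed simp
  moreover have "h - r = 0 \<or> degree (h - r) < degree r"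
  proof -
    have "coeff (h - r) d = 0" using toph topr by simp
    moreover have "degree (h - r) \<le> d" using degh degr by (intro degree_diff_le) auto
    ultimately show ?thesis using degr by (metis leading_coeff_0_iff le_neq_implies_less)
  qed
  ultimately obtain v where v: "\<And>\<gamma>. \<gamma> \<in> set rs \<Longrightarrow> v \<gamma> \<ge> 0"
    "\<And>x. x \<notin> set rs \<Longrightarrow> poly (h - r) x / poly r x = (\<Sum>\<gamma>\<in>set rs. v \<gamma> / (x - \<gamma>))"
    using partial_fractions_nonneg[OF r_def, of "h - r"] by blast
  \<comment> \<open>The quotient \<open>h / r\<close> is 1 plus the sum of the
    \<open>v \<gamma> / (x - \<gamma>)\<close>, and \<open>h\<close> vanishes at 0, so the
    \<open>w \<gamma>\<close> sum to 1. Distributing the constant 1 over the roots turns each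
    summand into \<open>w \<gamma> / (1 + s * \<gamma>)\<close> at \<open>x = -1/s\<close>.\<close>
  define w where "w \<gamma> = v \<gamma> / \<gamma>" for \<gamma>
  have w0: "w \<gamma> \<ge> 0" if "\<gamma> \<in> set rs" for \<gamma> using v(1)[OF that] pos[OF that] by (simp add: w_def)
  have "0 \<notin> set rs" using pos by auto
  have "- 1 = (\<Sum>\<gamma>\<in>set rs. v \<gamma> / (0 - \<gamma>))"
    unfolding v(2)[OF \<open>0 \<notin> set rs\<close>, symmetric] using h0 r0 by simp
  also have "\<dots> = - (\<Sum>\<gamma>\<in>set rs. w \<gamma>)" by (simp add: w_def sum_negf[symmetric])
  finally have w1: "(\<Sum>\<gamma>\<in>set rs. w \<gamma>) = 1" by simp
  have "(\<Sum>\<gamma>\<in>set rs. w \<gamma> / (1 + s * \<gamma>)) * btot s rs = (\<Sum>k\<le>length bs. esym k ys * esym k bs / real (length bs choose k) * s ^ k)"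
    if s: "s > 0" for s
  proof -
    define x where "x = - 1 / s"
    have x: "x < 0" using s by (simp add: x_def)
    hence xrs: "x \<notin> set rs" using pos by force
    hence rx: "poly r x \<noteq> 0" using root by simp
    have "poly h x / poly r x = 1 + poly (h - r) x / poly r x" using rx by (simp add: field_simps)
    also have "\<dots> = (\<Sum>\<gamma>\<in>set rs. w \<gamma> + v \<gamma> / (x - \<gamma>))"
      unfolding v(2)[OF xrs] by (simp add: sum.distrib w1)
    also have "\<dots> = (\<Sum>\<gamma>\<in>set rs. w \<gamma> / (1 + s * \<gamma>))"
    proof (intro sum.cong refl)
      fix \<gamma> assume \<gamma>: "\<gamma> \<in> set rs"
      hence g0: "\<gamma> > 0" by (rule pos)
      have nz: "1 + s * \<gamma> \<noteq> 0" using g0 s by (auto simp: add_pos_pos less_imp_neq[symmetric])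
      have xg: "x - \<gamma> = - (1 + s * \<gamma>) / s" using s by (simp add: x_def field_simps)
      have "v \<gamma> / (- K / s) = - (v \<gamma> * s / K)" for K by simp
      from this[of "1 + s * \<gamma>"] have xv: "v \<gamma> / (x - \<gamma>) = - (v \<gamma> * s / (1 + s * \<gamma>))" by (simp only: xg)
      show "w \<gamma> + v \<gamma> / (x - \<gamma>) = w \<gamma> / (1 + s * \<gamma>)"
        unfolding w_def xv using g0 nz by (simp add: field_simps)
    qed
    finally have 1: "poly h x = (\<Sum>\<gamma>\<in>set rs. w \<gamma> / (1 + s * \<gamma>)) * poly r x" using rx by (simp add: field_simps)
    have 2: "poly h x = (- 1 / s) ^ d * (\<Sum>k\<le>d. (esym k ys * esym k bs / real (d choose k)) * s ^ k)"
      unfolding x_def by (rule poly_at_neg_inverse[OF degh s coh])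
    have "poly r x = (- 1 / s) ^ d * (\<Sum>k\<le>d. esym k rs * s ^ k)"
      unfolding x_def
    proof (rule poly_at_neg_inverse[OF _ s])
      show "coeff r (d - k) = (- 1) ^ k * esym k rs" if "k \<le> d" for k
        using vieta_coeff[of "d - k" rs] d that by (simp add: r_def)
    qed (simp add: degr)
    hence 3: "poly r x = (- 1 / s) ^ d * btot s rs" using esym_sum[of rs s] d by simp
    have "(- 1 / s) ^ d * ((\<Sum>\<gamma>\<in>set rs. w \<gamma> / (1 + s * \<gamma>)) * btot s rs) =
       (- 1 / s) ^ d * (\<Sum>k\<le>d. (esym k ys * esym k bs / real (d choose k)) * s ^ k)"
      using 1 unfolding 2 3 by (simp only: mult_ac)
    thus ?thesis using s by (simp add: d_def)
  qed
  thus ?thesis using that w0 w1 by blast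
qed

subsection \<open>Multiplicities of roots\<close>

lemma szego_op_euler:
  "szego_op bs (monom 1 j * (pderiv ^^ j) f) = monom 1 j * (pderiv ^^ j) (szego_op bs f)"
  by (rule poly_eqI) (auto simp: coeff_szego_op coeff_monom_mult coeff_higher_pderiv)

lemma higher_pderiv_linear_power:
  fixes a :: real
  assumes "j \<le> d"
  shows "\<exists>c. c \<noteq> 0 \<and> (pderiv ^^ j) ([:- a, 1:] ^ d) = smult c ([:- a, 1:] ^ (d - j))"
  using assms
proof (induction j)
  case 0 show ?case by (intro exI[of _ 1]) simp
next
  case (Suc j)
  then obtain c where c: "c \<noteq> 0" "(pderiv ^^ j) ([:- a, 1:] ^ d) = smult c ([:- a, 1:] ^ (d - j))" by auto
  obtain m where m: "d - j = Suc m" "d - Suc j = m" using Suc.prems by (metis Suc_diff_Suc Suc_le_lessD)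
  have "pderiv ([:- a, 1:] ^ Suc m) = smult (real (Suc m)) ([:- a, 1:] ^ m)"
    by (subst pderiv_power_Suc) (simp add: pderiv_pCons)
  thus ?case using c m by (intro exI[of _ "c * real (Suc m)"]) (simp add: pderiv_smult)
qed

lemma dvd_higher_pderiv:
  fixes f Q :: "real poly"
  assumes "f ^ n dvd Q" shows "f ^ (n - j) dvd (pderiv ^^ j) Q"
proof (induction j)
  case (Suc j)
  then obtain H where H: "(pderiv ^^ j) Q = f ^ (n - j) * H" by (auto elim: dvdE)
  show ?case
  proof (cases "n - j")
    case 0 thus ?thesis by simp
  next
    case (Suc m)
    hence "n - Suc j = m" by simp
    moreover have "(pderiv ^^ Suc j) Q = f ^ m * (f * pderiv H + smult (of_nat (Suc m)) (pderiv f) * H)"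
      using H Suc by (simp add: pderiv_mult pderiv_power_Suc algebra_simps del: of_nat_Suc power_Suc) (simp add: algebra_simps)
    ultimately show ?thesis by simp
  qed
qed (use assms in simp)

text \<open>The normalised symmetric functions of \<open>d\<close> copies of \<open>a\<close> are
  the powers of \<open>a\<close>, so composing with \<open>(x - a)^d\<close> dilates the roots of
  the other factor by \<open>a\<close>.\<close>

lemma szego_op_linear_power:
  assumes "d = length bs"
  shows "szego_op bs ([:- a, 1:] ^ d) = (\<Prod>b\<leftarrow>map ((*) a) bs. [:- b, 1:])"
proof (rule poly_eqI)
  fix j
  have len: "length (replicate d a) = d" "length (map ((*) a) bs) = d" using assms by auto
  have e1: "esym k (replicate n a) = real (n choose k) * a ^ k" for k n
  proof (induction n arbitrary: k)
    case 0 thus ?case by (cases k) auto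
  next
    case (Suc n) thus ?case by (cases k) (auto simp: esym_Cons algebra_simps)
  qed
  have e2: "esym k (map ((*) a) bs) = a ^ k * esym k bs" for k
  proof (induction bs arbitrary: k)
    case Nil thus ?case by (cases k) auto
  next
    case (Cons b bs) thus ?case by (cases k) (auto simp: esym_Cons algebra_simps)
  qed
  have rep: "[:- a, 1:] ^ d = (\<Prod>x\<leftarrow>replicate d a. [:- x, 1:])" by (simp add: map_replicate prod_list_replicate)
  show "coeff (szego_op bs ([:- a, 1:] ^ d)) j = coeff (\<Prod>b\<leftarrow>map ((*) a) bs. [:- b, 1:]) j"
  proof (cases "j \<le> d")
    case True
    have "d choose (d - j) = d choose j" using True by (simp add: binomial_symmetric[symmetric])
    moreover have "coeff ([:- a, 1:] ^ d) j = (- 1) ^ (d - j) * esym (d - j) (replicate d a)"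
      unfolding rep using vieta_coeff[of j "replicate d a"] True by (simp only: length_replicate)
    moreover have "coeff (\<Prod>b\<leftarrow>map ((*) a) bs. [:- b, 1:]) j = (- 1) ^ (d - j) * esym (d - j) (map ((*) a) bs)"
      using vieta_coeff[of j "map ((*) a) bs"] True by (simp only: len)
    ultimately show ?thesis using True unfolding e1 e2 coeff_szego_op assms[symmetric] by simp
  next
    case False
    have "degree ([:- a, 1:] ^ d) = d" by (simp add: degree_power_eq)
    moreover have "degree (\<Prod>b\<leftarrow>map ((*) a) bs. [:- b, 1:]) = d" using degree_linear_factors[of "map ((*) a) bs"] len by simp
    ultimately show ?thesis using False by (simp add: coeff_szego_op coeff_eq_0)
  qed
qed

text \<open>In the basis \<open>x\<^sup>j (x - a)\<^sup>d\<^sup>-\<^sup>j\<close> the composition acts by \<open>x\<^sup>j D\<^sup>j\<close>, because \<open>x\<^sup>j D\<^sup>j\<close> is diagonal on monomials.\<close>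

lemma szego_op_multiplicity:
  fixes a b :: real
  assumes a: "a \<noteq> 0" and len: "length bs = d"
    and p: "p = [:- a, 1:] ^ m * g" "degree g \<le> d - m" "m \<le> d"
    and n: "count_list bs b = n"
  shows "[:- (a * b), 1:] ^ (m + n - d) dvd szego_op bs p"
proof -
  define Q where "Q = szego_op bs ([:- a, 1:] ^ d)"
  define L where "L = [:- (a * b), 1:]"
  have "L ^ n dvd Q"
  proof -
    have "L ^ count_list cs b dvd (\<Prod>b\<leftarrow>map ((*) a) cs. [:- b, 1:])" for cs
      by (induction cs) (auto simp: L_def intro: mult_dvd_mono dvd_mult simp del: mult_pCons_left)
    thus ?thesis unfolding Q_def szego_op_linear_power[OF len[symmetric]] using n by auto
  qed
  \<comment> \<open>\<open>x^j (x - a)^(d-j)\<close> is a multiple of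
    \<open>x^j D^j (x - a)^d\<close>, so its image is a multiple of \<open>x^j D^j Q\<close>.
    Differentiation costs at most \<open>j\<close> orders of the zero \<open>a * b\<close>, and
    \<open>j \<le> d - m\<close> leaves at least \<open>m + n - d\<close>.\<close>
  hence base: "L ^ (m + n - d) dvd szego_op bs (monom 1 j * [:- a, 1:] ^ (d - j))" if j: "j \<le> d - m" for j
  proof -
    obtain c where c: "c \<noteq> 0" "(pderiv ^^ j) ([:- a, 1:] ^ d) = smult c ([:- a, 1:] ^ (d - j))"
      using higher_pderiv_linear_power[of j d a] j diff_le_self[of d m] order.trans by blast
    have "L ^ (m + n - d) dvd L ^ (n - j)" using j p(3) by (intro le_imp_power_dvd) auto
    also have "\<dots> dvd monom 1 j * (pderiv ^^ j) Q" using dvd_higher_pderiv[OF \<open>L ^ n dvd Q\<close>] by (rule dvd_mult)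
    also have "\<dots> = smult c (szego_op bs (monom 1 j * [:- a, 1:] ^ (d - j)))"
      unfolding Q_def szego_op_euler[symmetric] c(2) by (simp add: szego_op_smult[symmetric])
    finally show ?thesis using c(1) by (simp add: dvd_smult_iff)
  qed
  have "j + N \<le> d - m \<Longrightarrow> degree g \<le> N \<Longrightarrow>
    L ^ (m + n - d) dvd szego_op bs (monom 1 j * ([:- a, 1:] ^ (d - j - N) * g))" for j N g
  proof (induction N arbitrary: j g)
    case 0
    then obtain c where "g = [:c:]" using degree_eq_zeroE by auto
    hence "monom 1 j * ([:- a, 1:] ^ (d - j - 0) * g) = smult c (monom 1 j * [:- a, 1:] ^ (d - j))" by simp
    thus ?case using base[of j] 0 by (simp add: szego_op_smult dvd_smult)
  next
    case (Suc N)
    \<comment> \<open>Matching the values at 0 makes the remainder divisible by \<open>x\<close>,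
      which raises \<open>j\<close> by one and lowers the degree bound; here
      \<open>a \<noteq> 0\<close> enters.\<close>
    define c where "c = poly g 0 / (- a) ^ Suc N"
    define g' where "g' = g - smult c ([:- a, 1:] ^ Suc N)"
    have "poly g' 0 = 0" using a by (simp add: g'_def c_def poly_power del: power_Suc)
    then obtain g1 where g1: "g' = pCons 0 g1" by (metis poly_0_coeff_0 pCons_cases coeff_pCons_0)
    have "degree g' \<le> Suc N" unfolding g'_def
      by (intro degree_diff_le Suc.prems order.trans[OF degree_smult_le] order.trans[OF degree_power_le]) simp
    hence dg1: "degree g1 \<le> N" by (cases "g1 = 0") (auto simp: g1)
    have "d - j = Suc N + (d - j - Suc N)" using Suc.prems by simp
    hence pw: "[:- a, 1:] ^ (d - j) = [:- a, 1:] ^ (d - j - Suc N) * [:- a, 1:] ^ Suc N"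
      by (metis power_add add.commute)
    have "g = smult c ([:- a, 1:] ^ Suc N) + [:0, 1:] * g1" using g1 by (simp add: g'_def algebra_simps)
    moreover have "m * (A * (smult c B + X * g1)) = smult c (m * (A * B)) + (m * X) * (A * g1)" for m A B X :: "real poly"
      by (simp add: algebra_simps)
    moreover have "monom 1 j * [:0, 1:] = monom (1::real) (Suc j)" by (simp add: monom_Suc)
    ultimately have eq: "monom 1 j * ([:- a, 1:] ^ (d - j - Suc N) * g) =
       smult c (monom 1 j * [:- a, 1:] ^ (d - j)) + monom 1 (Suc j) * ([:- a, 1:] ^ (d - j - Suc N) * g1)"
      unfolding pw by metis
    have e: "d - j - Suc N = d - Suc j - N" by simp
    have "L ^ (m + n - d) dvd szego_op bs (monom 1 (Suc j) * ([:- a, 1:] ^ (d - j - Suc N) * g1))"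
      unfolding e using Suc.IH[of "Suc j" g1] Suc.prems dg1 by simp
    thus ?case unfolding eq szego_op_add szego_op_smult
      using base[of j] Suc.prems by (intro dvd_add dvd_smult) auto
  qed
  from this[of 0 "d - m" g] p show ?thesis by (simp add: L_def)
qed

subsection \<open>Distributions on the half line\<close>

lemma (in real_distribution) measure_UNIV_eq_1: "measure M UNIV = 1" "emeasure M UNIV = 1"
  using prob_space emeasure_space_1 by simp_all

definition pos_dist :: "real measure \<Rightarrow> bool" where
  "pos_dist M \<longleftrightarrow> real_distribution M \<and> measure M {..<0} = 0"

lemma pos_distD: "pos_dist M \<Longrightarrow> real_distribution M" by (simp add: pos_dist_def)

lemma pos_dist_AE:
  assumes "pos_dist M" shows "AE x in M. x \<ge> 0"
proof -
  interpret real_distribution M using assms by (rule pos_distD)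
  have "{..<0} \<in> null_sets M" using assms by (auto simp: pos_dist_def null_sets_def emeasure_eq_measure)
  thus ?thesis by (rule AE_I') auto
qed

lemma pos_distI:
  assumes "real_distribution M" "AE x in M. x \<ge> 0" shows "pos_dist M"
proof -
  interpret real_distribution M by fact
  have "measure M {..<0} = measure M {}" using assms(2) by (intro finite_measure_eq_AE) (auto elim: eventually_mono)
  thus ?thesis using assms by (simp add: pos_dist_def)
qed

text \<open>The truncation at zero makes the integrand bounded and continuous on the whole line; on \<open>[0,\<infinity>)\<close> the transform is \<open>- psi_tr M (- s)\<close>.\<close>

definition gker :: "real \<Rightarrow> real \<Rightarrow> real" where
  "gker s x = s * max 0 x / (1 + s * max 0 x)"

definition ftr :: "real measure \<Rightarrow> real \<Rightarrow> real" where
  "ftr M s = (\<integral>x. gker s x \<partial>M)"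

section \<open>Range, monotonicity and continuity of the transform\<close>

lemma gker_bounds: "s \<ge> 0 \<Longrightarrow> 0 \<le> gker s x" "s \<ge> 0 \<Longrightarrow> gker s x < 1"
  by (auto simp: gker_def divide_less_eq add_pos_nonneg)

lemma frac_one_plus_le_iff:
  fixes u w :: real
  assumes "0 \<le> u" "0 \<le> w" shows "u / (1 + u) \<le> w / (1 + w) \<longleftrightarrow> u \<le> w"
proof -
  have "u / (1 + u) = 1 - inverse (1 + u)" "w / (1 + w) = 1 - inverse (1 + w)" using assms by (auto simp: field_simps)
  moreover have "inverse (1 + w) \<le> inverse (1 + u) \<longleftrightarrow> 1 + u \<le> 1 + w" using assms by (intro inverse_le_iff_le) auto
  ultimately show ?thesis by simp
qed

lemma gker_mono: "0 \<le> s \<Longrightarrow> s \<le> s' \<Longrightarrow> gker s x \<le> gker s' x"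
proof -
  assume s: "0 \<le> s" "s \<le> s'"
  have "0 \<le> s * max 0 x" "0 \<le> s' * max 0 x" "s * max 0 x \<le> s' * max 0 x" using s by (auto intro: mult_right_mono)
  thus ?thesis unfolding gker_def by (simp only: frac_one_plus_le_iff)
qed

lemma isCont_gker: "s \<ge> 0 \<Longrightarrow> isCont (gker s) x"
proof -
  assume s: "s \<ge> 0"
  have "1 + s * max 0 x \<noteq> 0" using s by (smt (verit) mult_nonneg_nonneg max.cobounded1)
  thus ?thesis unfolding gker_def by (intro continuous_intros) auto
qed

lemma gker_measurable [measurable]: "gker s \<in> borel_measurable borel"
  unfolding gker_def by measurable

lemma (in real_distribution) integrable_gker: "s \<ge> 0 \<Longrightarrow> integrable M (gker s)"
  by (rule integrable_const_bound[of _ 1]) (auto simp: gker_bounds less_imp_le abs_of_nonneg)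

lemma psi_tr_neg:
  assumes "pos_dist M" "s > 0" shows "psi_tr M (- s) = - ftr M s"
proof -
  interpret real_distribution M using assms(1) by (rule pos_distD)
  have "psi_tr M (- s) = (\<integral>x. - gker s x \<partial>M)"
    unfolding psi_tr_def using pos_dist_AE[OF assms(1)]
    by (intro integral_cong_AE) (auto elim!: eventually_mono simp: gker_def max_def)
  thus ?thesis by (simp add: ftr_def)
qed

lemma ftr_bounds:
  assumes "real_distribution M" "s \<ge> 0" shows "0 \<le> ftr M s" "ftr M s \<le> 1"
proof -
  interpret real_distribution M by fact
  show "0 \<le> ftr M s" unfolding ftr_def using assms gker_bounds by (intro integral_nonneg_AE) auto
  have "ftr M s \<le> (\<integral>x. 1 \<partial>M)" unfolding ftr_def
    using assms gker_bounds integrable_gker by (intro integral_mono) (auto simp: less_imp_le)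
  thus "ftr M s \<le> 1" by (simp add: measure_UNIV_eq_1)
qed

lemma ftr_mono:
  assumes "real_distribution M" "0 \<le> s" "s \<le> s'" shows "ftr M s \<le> ftr M s'"
proof -
  interpret real_distribution M by fact
  show ?thesis unfolding ftr_def using assms integrable_gker gker_mono by (intro integral_mono) auto
qed

lemma ftr_tendsto:
  assumes M: "real_distribution M" and X: "\<And>n. X n \<ge> 0" "X \<longlonglongrightarrow> s" "s \<ge> 0"
  shows "(\<lambda>n. ftr M (X n)) \<longlonglongrightarrow> ftr M s"
proof -
  interpret real_distribution M by fact
  show ?thesis unfolding ftr_def
  proof (rule integral_dominated_convergence[where w = "\<lambda>_. 1"])
    show "AE x in M. (\<lambda>n. gker (X n) x) \<longlonglongrightarrow> gker s x"
    proof (intro AE_I2)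
      fix x
      have "1 + s * max 0 x \<noteq> 0" using X(3) by (smt (verit) mult_nonneg_nonneg max.cobounded1)
      thus "(\<lambda>n. gker (X n) x) \<longlonglongrightarrow> gker s x" unfolding gker_def by (intro tendsto_intros X) auto
    qed
    show "AE x in M. norm (gker (X n) x) \<le> 1" for n
      using gker_bounds[of "X n"] X(1)[of n] by (intro AE_I2) (auto simp: less_imp_le)
  qed auto
qed

lemma ftr_0: "ftr M 0 = 0" by (simp add: ftr_def gker_def)

lemma ftr_continuous_on:
  assumes M: "real_distribution M" shows "continuous_on {0..} (ftr M)"
  unfolding continuous_on_sequentially using ftr_tendsto[OF M] by (auto simp: o_def)

text \<open>An atom at 0 is invisible to \<open>gker\<close>, so the range of the transform ends at
  \<open>1 - measure M {0}\<close>. This is the origin of the lower endpoint of the domain of the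
  S-transform.\<close>

lemma ftr_at_top:
  assumes M: "pos_dist M" shows "(\<lambda>n. ftr M (real n)) \<longlonglongrightarrow> 1 - measure M {0}"
proof -
  interpret real_distribution M using M by (rule pos_distD)
  have "(\<lambda>n. ftr M (real n)) \<longlonglongrightarrow> (\<integral>x. indicator {0<..} x \<partial>M)"
    unfolding ftr_def
  proof (rule integral_dominated_convergence[where w = "\<lambda>_. 1"])
    show "AE x in M. (\<lambda>n. gker (real n) x) \<longlonglongrightarrow> indicator {0<..} x"
    proof (intro AE_I2)
      fix x :: real
      show "(\<lambda>n. gker (real n) x) \<longlonglongrightarrow> indicator {0<..} x"
      proof (cases "x > 0")
        case True
        have "(\<lambda>n. real n * x / (1 + real n * x)) \<longlonglongrightarrow> 1" using True by real_asymp
        thus ?thesis using True by (simp add: gker_def max_def)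
      next
        case False
        thus ?thesis by (simp add: gker_def max_def)
      qed
    qed
    show "AE x in M. norm (gker (real n) x) \<le> 1" for n
      using gker_bounds[of "real n"] by (intro AE_I2) (auto simp: less_imp_le)
  qed auto
  also have "(\<integral>x. indicator {0<..} x \<partial>M) = measure M {0<..}" by simp
  also have "measure M {0<..} = 1 - measure M {0}"
  proof -
    have "measure M {0<..} = measure M (space M - {0})"
      using pos_dist_AE[OF M] by (intro finite_measure_eq_AE) (auto elim!: eventually_mono)
    also have "\<dots> = 1 - measure M {0}" by (rule prob_compl) auto
    finally show ?thesis .
  qed
  finally show ?thesis .
qed

lemma ftr_le_atom:
  assumes M: "pos_dist M" and s: "s \<ge> 0" shows "ftr M s \<le> 1 - measure M {0}"
proof -
  interpret real_distribution M using M by (rule pos_distD)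
  obtain N where "s \<le> real N" using real_arch_simple by blast
  hence "\<forall>n\<ge>N. ftr M s \<le> ftr M (real n)" using s by (auto intro!: ftr_mono pos_distD[OF M])
  thus ?thesis using ftr_at_top[OF M] by (intro LIMSEQ_le_const) auto
qed

lemma ftr_small:
  assumes M: "real_distribution M" and e: "\<epsilon> > 0" shows "\<exists>s>0. ftr M s < \<epsilon>"
proof -
  have "(\<lambda>n. ftr M (inverse (real (Suc n)))) \<longlonglongrightarrow> ftr M 0"
    using LIMSEQ_inverse_real_of_nat by (intro ftr_tendsto[OF M]) auto
  hence "eventually (\<lambda>n. ftr M (inverse (real (Suc n))) < \<epsilon>) sequentially"
    using e by (intro order_tendstoD) (auto simp: ftr_0)
  then obtain n where "ftr M (inverse (real (Suc n))) < \<epsilon>" by (auto simp: eventually_sequentially)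
  thus ?thesis by (intro exI[of _ "inverse (real (Suc n))"]) auto
qed

lemma ftr_large:
  assumes M: "pos_dist M" and t: "t < 1 - measure M {0}" shows "\<exists>s>0. ftr M s > t"
proof -
  have "eventually (\<lambda>n. ftr M (real n) > t) sequentially"
    using ftr_at_top[OF M] t by (rule order_tendstoD)
  hence "eventually (\<lambda>n. ftr M (real n) > t \<and> n > 0) sequentially"
    using eventually_gt_at_top by (rule eventually_conj)
  then obtain n where "ftr M (real n) > t" "n > 0" by (auto simp: eventually_sequentially)
  thus ?thesis by (intro exI[of _ "real n"]) auto
qed

lemma ftr_surj:
  assumes M: "pos_dist M" and t: "0 < t" "t < 1 - measure M {0}" shows "\<exists>s>0. ftr M s = t"
proof -
  obtain s where s: "s > 0" "ftr M s > t" using ftr_large[OF M t(2)] by blast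
  have "\<exists>x\<ge>0. x \<le> s \<and> ftr M x = t"
    using s t ftr_continuous_on[OF pos_distD[OF M]]
    by (intro IVT') (auto simp: ftr_0 intro: continuous_on_subset)
  then obtain x where x: "x \<ge> 0" "ftr M x = t" by blast
  have "x \<noteq> 0" using x(2) t ftr_0 by (metis less_irrefl)
  thus ?thesis using x by (intro exI[of _ x]) auto
qed

lemma eq_return_0:
  assumes "real_distribution M" "AE x in M. x = 0" shows "M = return borel 0"
proof (rule measure_eqI)
  interpret real_distribution M by fact
  show "sets M = sets (return borel 0)" by simp
  fix A assume A: "A \<in> sets M"
  show "emeasure M A = emeasure (return borel 0) A"
  proof (cases "0 \<in> A")
    case True
    have "emeasure M A = emeasure M (space M)" using assms(2) True A by (intro emeasure_eq_AE) (auto elim!: eventually_mono)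
    thus ?thesis using True A by (simp add: measure_UNIV_eq_1)
  next
    case False
    have "emeasure M A = emeasure M {}" using assms(2) False A by (intro emeasure_eq_AE) (auto elim!: eventually_mono)
    thus ?thesis using False A by simp
  qed
qed

lemma atom_0_less_1:
  assumes "real_distribution M" "M \<noteq> return borel 0" shows "measure M {0} < 1"
proof -
  interpret real_distribution M by fact
  have "measure M {0} \<noteq> 1"
  proof
    assume "measure M {0} = 1"
    hence "AE x in M. x \<in> {0}" by (subst AE_in_set_eq_1) auto
    thus False using eq_return_0[OF assms(1)] assms(2) by auto
  qed
  thus ?thesis using prob_le_1[of "{0}"] by linarith
qed

lemma ftr_strict_mono:
  assumes M: "pos_dist M" and nz: "M \<noteq> return borel 0" and s: "0 \<le> s" "s < s'"
  shows "ftr M s < ftr M s'"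
proof -
  interpret real_distribution M using M by (rule pos_distD)
  have le: "ftr M s \<le> ftr M s'" using s by (intro ftr_mono pos_distD[OF M]) auto
  have "ftr M s \<noteq> ftr M s'"
  proof
    assume "ftr M s = ftr M s'"
    hence "(\<integral>x. gker s' x - gker s x \<partial>M) = 0" using s integrable_gker by (simp add: ftr_def)
    hence "AE x in M. gker s' x - gker s x = 0"
      using s gker_mono[of s s'] integrable_gker
      by (subst (asm) integral_nonneg_eq_0_iff_AE) auto
    hence "AE x in M. x = 0" using pos_dist_AE[OF M]
    proof eventually_elim
      case (elim x)
      have "1 + s * x > 0" "1 + s' * x > 0" using s elim by (auto intro!: add_pos_nonneg mult_nonneg_nonneg)
      moreover have "s' * x / (1 + s' * x) = s * x / (1 + s * x)" using elim by (simp add: gker_def max_def split: if_splits)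
      ultimately have "s' * x = s * x" by (simp add: frac_eq_eq algebra_simps)
      thus ?case using s by simp
    qed
    thus False using eq_return_0 nz by (simp add: real_distribution_axioms)
  qed
  thus ?thesis using le by simp
qed

lemma ftr_eq_0D:
  assumes M: "pos_dist M" and s: "s > 0" "ftr M s = 0" shows "M = return borel 0"
  using ftr_strict_mono[OF M, of 0 s] s by (auto simp: ftr_0)

subsection \<open>Tightness and uniqueness\<close>

text \<open>\<open>gker s\<close> is at least 1/2 beyond \<open>1 / s\<close>, so a small transform
  bounds the tail mass uniformly. The finitely many measures before the threshold are handled one at
  a time.\<close>

lemma pos_tight:
  assumes X: "\<And>n. pos_dist (X n)"
    and small: "\<And>\<epsilon>. \<epsilon> > 0 \<Longrightarrow> \<exists>s>0. eventually (\<lambda>n. ftr (X n) s \<le> \<epsilon>) sequentially"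
  shows "tight X"
  unfolding tight_def
proof (intro conjI allI impI)
  show rd: "real_distribution (X n)" for n using X by (rule pos_distD)
  fix \<epsilon> :: real assume e: "\<epsilon> > 0"
  have "\<epsilon> / 4 > 0" using e by simp
  then obtain s N where s: "s > 0" "\<And>n. n \<ge> N \<Longrightarrow> ftr (X n) s \<le> \<epsilon> / 4"
    using small unfolding eventually_sequentially by meson
  have big: "cdf (X n) (1 / s) > 1 - \<epsilon>" if n: "n \<ge> N" for n
  proof -
    interpret real_distribution "X n" by (rule rd)
    have "measure (X n) {1/s<..} / 2 = (\<integral>x. indicator {1/s<..} x / 2 \<partial>X n)" by simp
    also have "\<dots> \<le> ftr (X n) s"
      unfolding ftr_def
    proof (intro integral_mono integrable_gker)
      fix x :: real
      show "indicator {1/s<..} x / 2 \<le> gker s x"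
      proof (cases "x > 1 / s")
        case True
        hence "s * x > 1" using s by (simp add: field_simps)
        moreover have "x > 0" using True s by (meson divide_pos_pos less_trans zero_less_one)
        ultimately have "1 / 2 \<le> s * x / (1 + s * x)" by (simp add: field_simps)
        thus ?thesis using True \<open>x > 0\<close> by (simp add: gker_def max_def)
      next
        case False thus ?thesis using gker_bounds[of s x] s by simp
      qed
    qed (use s in \<open>auto intro!: integrable_real_indicator simp: emeasure_eq_measure\<close>)
    also have "\<dots> \<le> \<epsilon> / 4" using s(2) n by simp
    finally have "measure (X n) {1/s<..} \<le> \<epsilon> / 2" by simp
    moreover have "measure (X n) {1/s<..} = 1 - cdf (X n) (1 / s)"
      unfolding cdf_def2 using prob_compl[of "{..1/s}"] by (simp add: Compl_eq_Diff_UNIV[symmetric])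
    ultimately show ?thesis using e by simp
  qed
  have "\<exists>b. cdf (X n) b > 1 - \<epsilon>" for n
  proof -
    interpret real_distribution "X n" by (rule rd)
    have "eventually (\<lambda>b. cdf (X n) b > 1 - \<epsilon>) at_top" using cdf_lim_at_top_prob e by (intro order_tendstoD) auto
    thus ?thesis by (auto simp: eventually_at_top_linorder)
  qed
  then obtain b where b: "\<And>n. cdf (X n) (b n) > 1 - \<epsilon>" by metis
  define B where "B = Max (insert 1 (insert (1 / s) (b ` {..<N})))"
  have B: "1 \<le> B" "1 / s \<le> B" "\<And>n. n < N \<Longrightarrow> b n \<le> B" unfolding B_def by (rule Max_ge; simp)+
  have "measure (X n) {-1<..B} > 1 - \<epsilon>" for n
  proof -
    interpret real_distribution "X n" by (rule rd)
    have "measure (X n) {-1<..B} = cdf (X n) B - cdf (X n) (-1)" using B by (intro cdf_diff_eq[symmetric]) auto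
    moreover have "cdf (X n) (-1) \<le> measure (X n) {..<0}" unfolding cdf_def2 by (intro finite_measure_mono) auto
    moreover have "measure (X n) {..<0} = 0" using X[of n] by (simp add: pos_dist_def)
    moreover have "cdf (X n) B > 1 - \<epsilon>"
    proof (cases "n < N")
      case True thus ?thesis using b[of n] cdf_nondecreasing[OF B(3)] by fastforce
    next
      case False thus ?thesis using big[of n] cdf_nondecreasing[OF B(2)] by fastforce
    qed
    ultimately show ?thesis by simp
  qed
  thus "\<exists>a b. a < b \<and> (\<forall>n. 1 - \<epsilon> < measure (X n) {a<..b})"
    using B by (intro exI[of _ "-1"] exI[of _ B]) auto
qed

lemma weak_conv_imp_ftr:
  assumes "\<And>n. real_distribution (X n)" "real_distribution M" "weak_conv_m X M" "s \<ge> 0"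
  shows "(\<lambda>n. ftr (X n) s) \<longlonglongrightarrow> ftr M s"
  unfolding ftr_def
  by (rule weak_conv_imp_integral_bdd_continuous_conv[OF assms(1-3), where B = 1])
    (use assms(4) isCont_gker gker_bounds[of s] in \<open>auto simp: less_imp_le\<close>)

lemma weak_conv_pos_dist:
  assumes X: "\<And>n. pos_dist (X n)" and M: "real_distribution M" and wc: "weak_conv_m X M"
  shows "pos_dist M"
proof -
  interpret real_distribution M by fact
  \<comment> \<open>A bounded continuous function that is positive exactly on the negative
    half-line.\<close>
  define h :: "real \<Rightarrow> real" where "h x = max 0 (min 1 (- x))" for x
  have h: "continuous_on UNIV h" "\<And>x. 0 \<le> h x" "\<And>x. h x \<le> 1" unfolding h_def by (auto intro!: continuous_intros)
  have [measurable]: "h \<in> borel_measurable borel" using h(1) by (rule borel_measurable_continuous_onI)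
  have "(\<lambda>n. \<integral>x. h x \<partial>X n) \<longlonglongrightarrow> (\<integral>x. h x \<partial>M)"
    using h by (intro weak_conv_imp_integral_bdd_continuous_conv[OF pos_distD[OF X] M wc, where B = 1])
      (auto simp: continuous_on_eq_continuous_at)
  moreover have "(\<integral>x. h x \<partial>X n) = 0" for n
  proof -
    interpret X: real_distribution "X n" using X by (rule pos_distD)
    have "(\<integral>x. h x \<partial>X n) = (\<integral>x. 0 \<partial>X n)"
      using pos_dist_AE[OF X[of n]] by (intro integral_cong_AE) (auto elim!: eventually_mono simp: h_def)
    thus ?thesis by simp
  qed
  ultimately have "(\<integral>x. h x \<partial>M) = 0" by (simp add: LIMSEQ_const_iff)
  moreover have "integrable M h" using h by (intro integrable_const_bound[of _ 1]) auto
  ultimately have "AE x in M. h x = 0" using h(2) by (subst (asm) integral_nonneg_eq_0_iff_AE) auto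
  hence "AE x in M. x \<ge> 0" by (rule eventually_mono) (auto simp: h_def max_def min_def split: if_splits)
  thus ?thesis using M by (rule pos_distI[rotated])
qed

text \<open>Expanding \<open>1 - ftr M s\<close> in \<open>\<delta> = 1 - s / s\<^sub>0\<close> yields the moments of \<open>gker s\<^sub>0\<close> under \<open>M\<close>.\<close>

lemma ftr_moments:
  assumes M: "real_distribution M" "real_distribution M'" and e: "e > 0"
    and eq: "\<And>s. 0 < s \<Longrightarrow> s < 2 * e \<Longrightarrow> ftr M s = ftr M' s"
  shows "(\<integral>x. gker e x ^ n \<partial>M) = (\<integral>x. gker e x ^ n \<partial>M')"
proof -
  define v where "v = gker e"
  have v: "0 \<le> v x" "v x < 1" for x using gker_bounds e by (auto simp: v_def)
  have [measurable]: "v \<in> borel_measurable borel" unfolding v_def by measurable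
  define a where "a N n = (\<integral>x. (1 - v x) * v x ^ n \<partial>N)" for N :: "real measure" and n
  have int: "integrable N (\<lambda>x. v x ^ n)" "integrable N (\<lambda>x. (1 - v x) * v x ^ n)" if "real_distribution N" for N n
  proof -
    interpret real_distribution N by fact
    show "integrable N (\<lambda>x. v x ^ n)"
      using v by (intro integrable_const_bound[of _ 1]) (auto intro!: power_le_one simp: less_imp_le)
    show "integrable N (\<lambda>x. (1 - v x) * v x ^ n)"
      using v by (intro integrable_const_bound[of _ 1]) (auto intro!: mult_le_one power_le_one simp: less_imp_le abs_mult)
  qed
  \<comment> \<open>With the parameter written as \<open>e * (1 - \<delta>)\<close>, the function
    \<open>1 - gker\<close> becomes \<open>(1 - v) / (1 - \<delta> * v)\<close>, a geometric series
    in \<open>\<delta>\<close>. The condition \<open>\<bar>\<delta>\<bar> < 1\<close> corresponds to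
    parameters between 0 and \<open>2 * e\<close>.\<close>
  have sums: "(\<lambda>n. a N n * \<delta> ^ n) sums (1 - ftr N (e * (1 - \<delta>)))" if N: "real_distribution N" and d: "\<bar>\<delta>\<bar> < 1" for N \<delta>
  proof -
    interpret real_distribution N by fact
    have sd: "e * (1 - \<delta>) \<ge> 0" using e d by simp
    have pos: "1 - \<delta> * v x > 0" for x
    proof -
      have "\<bar>\<delta> * v x\<bar> \<le> \<bar>\<delta>\<bar> * 1" using v[of x] unfolding abs_mult by (intro mult_left_mono) auto
      thus ?thesis using d by linarith
    qed
    have ker: "1 - gker (e * (1 - \<delta>)) x = (1 - v x) / (1 - \<delta> * v x)" for x
    proof -
      define y where "y = max 0 x"
      have y: "1 + e * y > 0" "1 + e * (1 - \<delta>) * y > 0" using e d by (auto simp: y_def intro!: add_pos_nonneg mult_nonneg_nonneg)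
      have "v x = e * y / (1 + e * y)" by (simp add: v_def gker_def y_def)
      hence "1 - v x = 1 / (1 + e * y)" "1 - \<delta> * v x = (1 + e * (1 - \<delta>) * y) / (1 + e * y)"
        using y by (simp_all add: field_simps)
      moreover have "1 - gker (e * (1 - \<delta>)) x = 1 / (1 + e * (1 - \<delta>) * y)"
        using y by (simp add: gker_def y_def[symmetric] field_simps)
      ultimately show ?thesis using y by simp
    qed
    have rem: "\<bar>(1 - gker (e * (1 - \<delta>)) x) - (\<Sum>n<m. (1 - v x) * v x ^ n * \<delta> ^ n)\<bar> \<le> \<bar>\<delta>\<bar> ^ m * (1 / (1 - \<bar>\<delta>\<bar>))" for x m
    proof -
      have ne: "\<delta> * v x \<noteq> 1" using pos[of x] by auto
      have "(\<Sum>n<m. (1 - v x) * v x ^ n * \<delta> ^ n) = (1 - v x) * (\<Sum>n<m. (\<delta> * v x) ^ n)"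
        by (simp add: sum_distrib_left power_mult_distrib mult_ac)
      also have "\<dots> = (1 - v x) * ((1 - (\<delta> * v x) ^ m) / (1 - \<delta> * v x))"
        unfolding sum_gp_strict using ne by simp
      finally have "(1 - gker (e * (1 - \<delta>)) x) - (\<Sum>n<m. (1 - v x) * v x ^ n * \<delta> ^ n) = (1 - v x) * (\<delta> * v x) ^ m / (1 - \<delta> * v x)"
        unfolding ker using pos[of x] by (simp add: field_simps)
      also have "\<bar>\<dots>\<bar> = (1 - v x) * (\<bar>\<delta>\<bar> ^ m * v x ^ m) / (1 - \<delta> * v x)"
        using v[of x] pos[of x] by (simp add: abs_mult power_abs power_mult_distrib)
      also have "\<dots> \<le> 1 * (\<bar>\<delta>\<bar> ^ m * 1) / (1 - \<bar>\<delta>\<bar>)"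
      proof (intro frac_le mult_mono)
        have "\<delta> * v x \<le> \<bar>\<delta>\<bar> * 1" using v[of x] by (intro mult_mono) auto
        thus "1 - \<bar>\<delta>\<bar> \<le> 1 - \<delta> * v x" by simp
      qed (use v[of x] d in \<open>auto intro: power_le_one\<close>)
      finally show ?thesis by simp
    qed
    have "(\<lambda>m. \<Sum>n<m. a N n * \<delta> ^ n) \<longlonglongrightarrow> 1 - ftr N (e * (1 - \<delta>))"
    proof (rule LIM_zero_cancel, rule Lim_null_comparison)
      show "eventually (\<lambda>m. norm ((\<Sum>n<m. a N n * \<delta> ^ n) - (1 - ftr N (e * (1 - \<delta>)))) \<le> \<bar>\<delta>\<bar> ^ m * (1 / (1 - \<bar>\<delta>\<bar>))) sequentially"
      proof (intro always_eventually allI)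
        fix m
        have ig: "integrable N (\<lambda>x. 1 - gker (e * (1 - \<delta>)) x)" using integrable_gker[OF sd] by simp
        have isu: "integrable N (\<lambda>x. \<Sum>n<m. (1 - v x) * v x ^ n * \<delta> ^ n)" using int[OF N] by simp
        have "1 - ftr N (e * (1 - \<delta>)) = (\<integral>x. 1 - gker (e * (1 - \<delta>)) x \<partial>N)"
          using integrable_gker[OF sd] by (simp add: ftr_def measure_UNIV_eq_1)
        moreover have "(\<Sum>n<m. a N n * \<delta> ^ n) = (\<integral>x. (\<Sum>n<m. (1 - v x) * v x ^ n * \<delta> ^ n) \<partial>N)"
          using int[OF N] by (simp add: a_def)
        ultimately have "norm ((\<Sum>n<m. a N n * \<delta> ^ n) - (1 - ftr N (e * (1 - \<delta>)))) =
           \<bar>\<integral>x. (1 - gker (e * (1 - \<delta>)) x) - (\<Sum>n<m. (1 - v x) * v x ^ n * \<delta> ^ n) \<partial>N\<bar>"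
          by (subst Bochner_Integration.integral_diff[OF ig isu]) (simp add: abs_minus_commute)
        also have "\<dots> \<le> (\<integral>x. \<bar>(1 - gker (e * (1 - \<delta>)) x) - (\<Sum>n<m. (1 - v x) * v x ^ n * \<delta> ^ n)\<bar> \<partial>N)"
          by (rule integral_abs_bound)
        also have "\<dots> \<le> (\<integral>x. \<bar>\<delta>\<bar> ^ m * (1 / (1 - \<bar>\<delta>\<bar>)) \<partial>N)"
          by (rule integral_mono[OF integrable_abs[OF Bochner_Integration.integrable_diff[OF ig isu]]]) (use rem in auto)
        finally show "norm ((\<Sum>n<m. a N n * \<delta> ^ n) - (1 - ftr N (e * (1 - \<delta>)))) \<le> \<bar>\<delta>\<bar> ^ m * (1 / (1 - \<bar>\<delta>\<bar>))"
          by (simp add: measure_UNIV_eq_1)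
      qed
      show "(\<lambda>m. \<bar>\<delta>\<bar> ^ m * (1 / (1 - \<bar>\<delta>\<bar>))) \<longlonglongrightarrow> 0"
        using d by (intro tendsto_mult_left_zero LIMSEQ_power_zero) auto
    qed
    thus ?thesis by (simp add: sums_def)
  qed
  define b where "b n = a M n - a M' n" for n
  have bs: "(\<lambda>n. b n * \<delta> ^ n) sums 0" if d: "\<bar>\<delta>\<bar> < 1" for \<delta>
  proof -
    have "0 < e * (1 - \<delta>)" "e * (1 - \<delta>) < 2 * e" using d e by (auto intro!: mult_pos_pos)
    hence "ftr M (e * (1 - \<delta>)) = ftr M' (e * (1 - \<delta>))" by (rule eq)
    thus ?thesis using sums_diff[OF sums[OF M(1) d] sums[OF M(2) d]] by (simp add: b_def left_diff_distrib)
  qed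
  have b0: "b 0 = 0" using bs[of 0] by simp
  \<comment> \<open>A power series with zero constant term and some nonzero coefficient is nonzero
    on a punctured neighbourhood of 0.\<close>
  have b: "b m = 0" for m
  proof (rule ccontr)
    assume m: "b m \<noteq> 0"
    hence "m > 0" using b0 by (cases m) auto
    obtain s where s: "s > 0" "\<And>z. z \<in> cball 0 s - {0} \<Longrightarrow> (\<lambda>_::real. 0::real) z \<noteq> 0"
      by (rule powser_0_nonzero[of 1 0 b "\<lambda>_. 0" m]) (use bs m \<open>m > 0\<close> in auto)
    thus False using s(2)[of s] by (auto simp: dist_norm)
  qed
  show ?thesis unfolding v_def[symmetric]
  proof (induction n)
    case 0
    interpret M: real_distribution M by fact
    interpret M': real_distribution M' by fact
    show ?case by (simp add: M.measure_UNIV_eq_1 M'.measure_UNIV_eq_1)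
  next
    case (Suc n)
    have "(\<integral>x. v x ^ Suc n \<partial>N) = (\<integral>x. v x ^ n \<partial>N) - a N n" if "real_distribution N" for N
      using int[OF that, of n] int(1)[OF that, of "Suc n"]
      by (simp add: a_def algebra_simps)
    thus ?case using Suc b[of n] M by (simp add: b_def del: power_Suc)
  qed
qed

text \<open>\<open>v = gker e\<close> maps \<open>[0,\<infinity>)\<close> increasingly onto
  \<open>[0,1)\<close>, where moments determine a law: Stone-Weierstrass passes to all continuous
  test functions, Levy's theorem gives the law of \<open>v\<close>, and monotonicity of
  \<open>v\<close> recovers the distribution function. Agreement near 0 suffices because the
  expansion behind \<open>ftr_moments\<close> is local.\<close>

lemma ftr_unique:
  assumes M: "pos_dist M" "pos_dist M'" and e: "\<epsilon> > 0"
    and eq: "\<And>s. 0 < s \<Longrightarrow> s < \<epsilon> \<Longrightarrow> ftr M s = ftr M' s"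
  shows "M = M'"
proof -
  note rd = pos_distD[OF M(1)] pos_distD[OF M(2)]
  interpret M: real_distribution M by (rule rd)
  interpret M': real_distribution M' by (rule rd)
  define e where "e = \<epsilon> / 2"
  have e0: "e > 0" using e by (simp add: e_def)
  define v where "v = gker e"
  have v: "0 \<le> v x" "v x < 1" for x using gker_bounds e0 by (auto simp: v_def)
  have vm [measurable]: "v \<in> borel_measurable borel" unfolding v_def by measurable
  have mom: "(\<integral>x. v x ^ n \<partial>M) = (\<integral>x. v x ^ n \<partial>M')" for n
    unfolding v_def by (rule ftr_moments[OF rd e0]) (use eq in \<open>auto simp: e_def\<close>)
  have int: "integrable N (\<lambda>x. h (v x))" if "real_distribution N" "continuous_on {0..1} h" for N and h :: "real \<Rightarrow> real"
  proof -
    interpret real_distribution N by fact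
    have "compact (h ` {0..1})" using that(2) by (intro compact_continuous_image) auto
    then obtain B where B: "\<And>y. y \<in> {0..1} \<Longrightarrow> \<bar>h y\<bar> \<le> B" unfolding compact_eq_bounded_closed bounded_iff real_norm_def by blast
    have [measurable]: "(\<lambda>x. h (v x)) \<in> borel_measurable borel"
    proof -
      have "(\<lambda>y. indicator {0..1} y *\<^sub>R h y) \<in> borel_measurable borel"
        using that(2) by (intro borel_measurable_continuous_on_indicator) auto
      hence "(\<lambda>x. indicator {0..1} (v x) *\<^sub>R h (v x)) \<in> borel_measurable borel"
        using vm by (rule measurable_compose[rotated])
      moreover have "(\<lambda>x. indicator {0..1} (v x) *\<^sub>R h (v x)) = (\<lambda>x. h (v x))" using v by (auto simp: less_imp_le)
      ultimately show ?thesis by simp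
    qed
    show ?thesis using B v by (intro integrable_const_bound[of _ B]) (auto simp: less_imp_le)
  qed
  have cont: "(\<integral>x. h (v x) \<partial>M) = (\<integral>x. h (v x) \<partial>M')" if h: "continuous_on {0..1} h" for h :: "real \<Rightarrow> real"
  proof (rule ccontr)
    define D where "D = \<bar>(\<integral>x. h (v x) \<partial>M) - (\<integral>x. h (v x) \<partial>M')\<bar>"
    assume "(\<integral>x. h (v x) \<partial>M) \<noteq> (\<integral>x. h (v x) \<partial>M')"
    hence D: "D / 3 > 0" by (simp add: D_def)
    obtain g where g: "real_polynomial_function g" "\<And>x. x \<in> {0..1} \<Longrightarrow> \<bar>h x - g x\<bar> < D / 3"
      using Stone_Weierstrass_real_polynomial_function[of "{0..1}" h "D / 3"] h D by auto
    obtain a n where gs: "g = (\<lambda>x. \<Sum>i\<le>n. a i * x ^ i)" using g(1) real_polynomial_function_iff_sum by blast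
    have cg: "continuous_on {0..1} g" unfolding gs by (intro continuous_intros)
    have ip: "integrable N (\<lambda>x. v x ^ i)" if "real_distribution N" for N i
      by (rule int[OF that]) (intro continuous_intros)
    have "(\<integral>x. g (v x) \<partial>M) = (\<integral>x. g (v x) \<partial>M')" using ip[OF rd(1)] ip[OF rd(2)] mom by (simp add: gs)
    moreover have "\<bar>(\<integral>x. h (v x) \<partial>N) - (\<integral>x. g (v x) \<partial>N)\<bar> \<le> D / 3" if N: "real_distribution N" for N
    proof -
      interpret real_distribution N by fact
      have "\<bar>(\<integral>x. h (v x) \<partial>N) - (\<integral>x. g (v x) \<partial>N)\<bar> = \<bar>\<integral>x. h (v x) - g (v x) \<partial>N\<bar>"
        using int[OF N h] int[OF N cg] by simp
      also have "\<dots> \<le> (\<integral>x. D / 3 \<partial>N)"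
        using int[OF N h] int[OF N cg] g(2) v
        by (intro integral_abs_bound[THEN order.trans] integral_mono integrable_abs Bochner_Integration.integrable_diff) (auto simp: less_imp_le)
      finally show ?thesis by (simp add: measure_UNIV_eq_1)
    qed
    from this[OF rd(1)] this[OF rd(2)] have "D \<le> 2 * (D / 3)" unfolding D_def using calculation by linarith
    thus False using D by simp
  qed
  have char: "char (distr N borel v) t = complex_of_real (\<integral>x. cos (t * v x) \<partial>N) + \<i> * complex_of_real (\<integral>x. sin (t * v x) \<partial>N)"
    if N: "real_distribution N" for N t
  proof -
    interpret real_distribution N by fact
    have i: "integrable N (\<lambda>x. cos (t * v x))" "integrable N (\<lambda>x. sin (t * v x))"
      by (rule int[OF N], intro continuous_intros)+
    have "char (distr N borel v) t = (\<integral>x. iexp (t * v x) \<partial>N)"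
      unfolding char_def by (subst integral_distr) auto
    also have "\<dots> = (\<integral>x. complex_of_real (cos (t * v x)) + \<i> * complex_of_real (sin (t * v x)) \<partial>N)"
      by (intro Bochner_Integration.integral_cong) (auto simp: exp_Euler cos_of_real sin_of_real simp flip: of_real_mult)
    also have "\<dots> = complex_of_real (\<integral>x. cos (t * v x) \<partial>N) + \<i> * complex_of_real (\<integral>x. sin (t * v x) \<partial>N)"
      using i by (simp add: integral_complex_of_real)
    finally show ?thesis .
  qed
  have "distr M borel v = distr M' borel v"
  proof (rule Levy_uniqueness)
    show "char (distr M borel v) = char (distr M' borel v)"
      using cont[of "\<lambda>y. cos (t * y)" for t] cont[of "\<lambda>y. sin (t * y)" for t]
      by (intro ext) (simp add: char rd continuous_intros)
  qed (use vm in \<open>auto intro!: M.real_distribution_distr M'.real_distribution_distr\<close>)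
  hence cdv: "cdf (distr M borel v) y = cdf (distr M' borel v) y" for y by simp
  have cd: "cdf N x = (if x < 0 then 0 else cdf (distr N borel v) (v x))" if N: "pos_dist N" for N x
  proof -
    interpret real_distribution N using N by (rule pos_distD)
    show ?thesis
    proof (cases "x < 0")
      case True
      have "measure N {..x} \<le> measure N {..<0}" using True by (intro finite_measure_mono) auto
      thus ?thesis using N True by (simp add: pos_dist_def cdf_def2 measure_le_0_iff)
    next
      case False
      have "v y \<le> v x \<longleftrightarrow> y \<le> x" for y
      proof -
        have "v y \<le> v x \<longleftrightarrow> e * max 0 y \<le> e * max 0 x"
          unfolding v_def gker_def using e0 by (intro frac_one_plus_le_iff) auto
        also have "\<dots> \<longleftrightarrow> y \<le> x" using e0 False by auto
        finally show ?thesis .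
      qed
      hence "v -` {..v x} \<inter> space N = {..x}" by auto
      thus ?thesis using False by (simp add: cdf_def2 measure_distr)
    qed
  qed
  show ?thesis
    by (rule cdf_unique[OF rd]) (use cd[OF M(1)] cd[OF M(2)] cdv in \<open>auto simp: fun_eq_iff\<close>)
qed

subsection \<open>Root distributions\<close>

lemma poly_lfactors_nonzero [simp]: "(\<Prod>a\<leftarrow>xs. [:- a, 1:]) \<noteq> (0 :: 'a :: idom poly)"
  by (auto simp: prod_list_zero_iff)

lemma proots_lfactors: "proots (\<Prod>a\<leftarrow>xs. [:- a, 1:]) = mset (xs :: 'a :: idom list)"
  by (induction xs) (simp_all add: proots_mult proots_linear_factor[of "- a" for a, simplified] del: mult_pCons_left)

lemma polys_roots_inE:
  assumes "p \<in> polys_roots_in d {0..}"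
  obtains xs where "length xs = d" "set xs \<subseteq> {0..}" "p = (\<Prod>a\<leftarrow>xs. [:- a, 1:])"
proof -
  have split: "\<exists>xs. length xs = degree q \<and> mset xs = proots q \<and> q = (\<Prod>a\<leftarrow>xs. [:- a, 1:])"
    if "lead_coeff q = 1" "size (proots q) = degree q" for q :: "real poly"
    using that
  proof (induction "degree q" arbitrary: q)
    case 0
    then obtain c where "q = [:c:]" using degree_eq_zeroE[of q] by auto
    with 0 have "q = 1" by (simp add: one_pCons)
    thus ?case by simp
  next
    case (Suc n)
    hence q0: "q \<noteq> 0" by auto
    have "proots q \<noteq> {#}" using Suc by auto
    then obtain a where "a \<in># proots q" by blast
    hence "poly q a = 0" using q0 by simp
    then obtain q' where q': "q = [:- a, 1:] * q'" by (auto simp: poly_eq_0_iff_dvd elim: dvdE)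
    hence q'0: "q' \<noteq> 0" using q0 by auto
    have deg: "degree q = Suc (degree q')" using q'0 unfolding q' by (simp add: degree_mult_eq del: mult_pCons_left)
    have pr: "proots q = {#a#} + proots q'" using q'0 unfolding q' by (subst proots_mult) auto
    have "lead_coeff q' = 1" using Suc.prems(1) unfolding q' by (simp add: lead_coeff_mult del: mult_pCons_left)
    moreover have "size (proots q') = degree q'" using Suc.prems(2) deg pr by simp
    ultimately obtain xs where "length xs = degree q'" "mset xs = proots q'" "q' = (\<Prod>a\<leftarrow>xs. [:- a, 1:])"
      using Suc.hyps(1)[of q'] Suc.hyps(2) deg by auto
    thus ?case using q' deg pr by (intro exI[of _ "a # xs"]) auto
  qed
  have "degree p = d" "lead_coeff p = 1" "size (proots p) = d" and sub: "set_mset (proots p) \<subseteq> {0..}"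
    using assms by (auto simp: polys_roots_in_def)
  then obtain xs where "length xs = d" "mset xs = proots p" "p = (\<Prod>a\<leftarrow>xs. [:- a, 1:])" using split[of p] by auto
  moreover from this have "set xs \<subseteq> {0..}" using sub by (metis set_mset_mset)
  ultimately show ?thesis using that by blast
qed

lemma etilde_lfactors:
  "etilde d (\<Prod>a\<leftarrow>xs. [:- a, 1:]) k = esym k xs / real (d choose k)"
proof -
  have "esym k (sorted_list_of_multiset (mset xs)) = esym k xs" by (rule esym_mset_cong) simp
  thus ?thesis unfolding etilde_def proots_lfactors by (simp only:)
qed

lemma fin_free_mult_eq_szego_op:
  assumes "length xs = d" "length bs = d"
  shows "fin_free_mult d (\<Prod>a\<leftarrow>xs. [:- a, 1:]) (\<Prod>a\<leftarrow>bs. [:- a, 1:]) = szego_op bs (\<Prod>a\<leftarrow>xs. [:- a, 1:])"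
proof (rule poly_eqI)
  fix j
  define c where "c k = (-1) ^ k * real (d choose k) * (esym k xs / real (d choose k)) * (esym k bs / real (d choose k))" for k
  have "coeff (fin_free_mult d (\<Prod>a\<leftarrow>xs. [:- a, 1:]) (\<Prod>a\<leftarrow>bs. [:- a, 1:])) j = (\<Sum>k\<le>d. if d - k = j then c k else 0)"
    unfolding fin_free_mult_def coeff_sum etilde_lfactors by (intro sum.cong) (auto simp: c_def)
  also have "\<dots> = (if j \<le> d then c (d - j) else 0)"
  proof (cases "j \<le> d")
    case True
    have "(\<Sum>k\<le>d. if d - k = j then c k else 0) = (\<Sum>k\<le>d. if k = d - j then c k else 0)"
      using True by (intro sum.cong) auto
    thus ?thesis using True by simp
  qed (auto intro!: sum.neutral)
  also have "\<dots> = coeff (szego_op bs (\<Prod>a\<leftarrow>xs. [:- a, 1:])) j"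
  proof (cases "j \<le> d")
    case True
    have "d choose (d - j) = d choose j" using True by (simp add: binomial_symmetric[symmetric])
    thus ?thesis using True vieta_coeff[of j xs] assms by (simp add: coeff_szego_op c_def)
  next
    case False
    hence "coeff (\<Prod>a\<leftarrow>xs. [:- a, 1:]) j = 0" using assms by (intro coeff_eq_0) (simp add: degree_linear_factors)
    thus ?thesis using False by (simp add: coeff_szego_op)
  qed
  finally show "coeff (fin_free_mult d (\<Prod>a\<leftarrow>xs. [:- a, 1:]) (\<Prod>a\<leftarrow>bs. [:- a, 1:])) j = coeff (szego_op bs (\<Prod>a\<leftarrow>xs. [:- a, 1:])) j" .
qed

definition rmeas :: "real list \<Rightarrow> real measure" where
  "rmeas xs = root_measure (\<Prod>a\<leftarrow>xs. [:- a, 1:])"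

lemma real_distribution_root_measure: "real_distribution (root_measure p)"
  unfolding root_measure_def by (intro prob_space.real_distribution_distr measure_pmf.prob_space_axioms) auto

lemma integral_rmeas:
  fixes f :: "real \<Rightarrow> real"
  assumes "xs \<noteq> []" and [measurable]: "f \<in> borel_measurable borel"
  shows "(\<integral>x. f x \<partial>rmeas xs) = (\<Sum>x\<leftarrow>xs. f x) / length xs"
proof -
  have ne: "mset xs \<noteq> {#}" using assms by simp
  have "(\<integral>x. f x \<partial>rmeas xs) = (\<integral>x. f x \<partial>measure_pmf (pmf_of_multiset (mset xs)))"
    unfolding rmeas_def root_measure_def proots_lfactors by (subst integral_distr) auto
  also have "\<dots> = (\<Sum>x\<in>set xs. f x * pmf (pmf_of_multiset (mset xs)) x)"
    using ne by (subst integral_measure_pmf_real[of "set xs"]) auto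
  also have "\<dots> = (\<Sum>x\<in>set xs. real (count_list xs x) * f x) / length xs"
    using ne by (simp add: sum_divide_distrib count_mset mult_ac)
  also have "(\<Sum>x\<in>set xs. real (count_list xs x) * f x) = (\<Sum>x\<leftarrow>xs. f x)"
  proof -
    have "finite S \<Longrightarrow> set ys \<subseteq> S \<Longrightarrow> (\<Sum>x\<in>S. real (count_list ys x) * f x) = (\<Sum>x\<leftarrow>ys. f x)" for S ys
    proof (induction ys)
      case (Cons a ys)
      have "(\<Sum>x\<in>S. real (count_list (a # ys) x) * f x) = (\<Sum>x\<in>S. real (count_list ys x) * f x + (if x = a then f x else 0))"
        by (intro sum.cong) (auto simp: algebra_simps)
      thus ?case using Cons by (simp add: sum.distrib)
    qed simp
    thus ?thesis by simp
  qed
  finally show ?thesis .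
qed

lemma measure_rmeas_singleton:
  assumes "xs \<noteq> []" shows "measure (rmeas xs) {a} = real (count_list xs a) / length xs"
proof -
  interpret real_distribution "rmeas xs" unfolding rmeas_def by (rule real_distribution_root_measure)
  have "measure (rmeas xs) {a} = (\<integral>x. indicator {a} x \<partial>rmeas xs)" by simp
  also have "\<dots> = (\<Sum>x\<leftarrow>xs. indicator {a} x) / length xs" using assms by (rule integral_rmeas) simp
  also have "(\<Sum>x\<leftarrow>xs. indicator {a} x) = real (count_list xs a)" by (induction xs) auto
  finally show ?thesis .
qed

lemma pos_dist_rmeas:
  assumes "xs \<noteq> []" "set xs \<subseteq> {0..}" shows "pos_dist (rmeas xs)"
proof -
  interpret real_distribution "rmeas xs" unfolding rmeas_def by (rule real_distribution_root_measure)
  have "measure (rmeas xs) {..<0} = (\<integral>x. indicator {..<0} x \<partial>rmeas xs)" by simp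
  also have "\<dots> = (\<Sum>x\<leftarrow>xs. indicator {..<0} x) / length xs" using assms(1) by (rule integral_rmeas) simp
  also have "(\<Sum>x\<leftarrow>xs. indicator {..<0} x) = (0::real)" using assms(2) by (induction xs) auto
  finally show ?thesis by (simp add: pos_dist_def real_distribution_axioms)
qed

text \<open>The link between coefficients and measures: the transform of a root distribution is the
  normalised mean of the Bernoulli sum.\<close>

lemma ftr_rmeas:
  assumes "xs \<noteq> []" "set xs \<subseteq> {0..}" shows "ftr (rmeas xs) s = bmean s xs / length xs"
proof -
  have "ftr (rmeas xs) s = (\<Sum>x\<leftarrow>xs. gker s x) / length xs" unfolding ftr_def using assms(1) by (rule integral_rmeas) simp
  also have "(\<Sum>x\<leftarrow>xs. gker s x) = bmean s xs" using assms(2) by (induction xs) (auto simp: bmean_def gker_def max_def)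
  finally show ?thesis .
qed

subsection \<open>Asymptotics of coefficient ratios\<close>

text \<open>If the mean at parameter \<open>a\<close> stays below \<open>t * Suc n\<close>, so
  essentially does the mode, and the ratio at index about \<open>t * Suc n\<close> has reached
  \<open>a\<close> up to the factor \<open>\<theta>\<close>. This is the contrapositive of
  \<open>bmean_ge_of_ratio\<close>, whose error \<open>\<theta> / (1 - \<theta>)\<close> vanishes
  after division by \<open>Suc n\<close>.\<close>

lemma esym_ratio_eventually_ge:
  assumes X: "\<And>n. set (X n) \<subseteq> {0..}" and F: "(\<lambda>n. bmean a (X n) / real (Suc n)) \<longlonglongrightarrow> F" "F < t"
    and k: "(\<lambda>n. real (k n) / real (Suc n)) \<longlonglongrightarrow> t" and a: "a > 0" and th: "0 < \<theta>" "\<theta> < 1"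
  shows "eventually (\<lambda>n. esym (k n) (X n) \<ge> \<theta> * a * esym (Suc (k n)) (X n)) sequentially"
proof -
  define C where "C = 1 - \<theta> / (1 - \<theta>)"
  have "(\<lambda>n. C / real (Suc n)) \<longlonglongrightarrow> 0" by real_asymp
  hence "(\<lambda>n. real (k n) / real (Suc n) + C / real (Suc n) - bmean a (X n) / real (Suc n)) \<longlonglongrightarrow> t + 0 - F"
    by (intro tendsto_intros F k)
  hence "eventually (\<lambda>n. real (k n) / real (Suc n) + C / real (Suc n) - bmean a (X n) / real (Suc n) > 0) sequentially"
    using F(2) by (intro order_tendstoD) auto
  thus ?thesis
  proof eventually_elim
    case (elim n)
    have "bmean a (X n) / real (Suc n) < (real (k n) + C) / real (Suc n)" using elim by (simp add: add_divide_distrib)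
    hence "bmean a (X n) < real (k n) + C" by (simp only: divide_less_cancel)
    hence "\<not> bmean a (X n) \<ge> real (Suc (k n)) - \<theta> / (1 - \<theta>)" by (simp add: C_def)
    thus ?case using bmean_ge_of_ratio[OF X a th, of "k n" n] by force
  qed
qed

lemma esym_ratio_eventually_less:
  assumes X: "\<And>n. set (X n) \<subseteq> {0..}" and F: "(\<lambda>n. bmean a (X n) / real (Suc n)) \<longlonglongrightarrow> F" "F > t"
    and k: "(\<lambda>n. real (k n) / real (Suc n)) \<longlonglongrightarrow> t" and a: "a > 0" and th: "0 < \<theta>" "\<theta> < 1"
  shows "eventually (\<lambda>n. \<theta> * esym (k n) (X n) < a * esym (Suc (k n)) (X n)) sequentially"
proof -
  define C where "C = \<theta> / (1 - \<theta>)"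
  have "(\<lambda>n. C / real (Suc n)) \<longlonglongrightarrow> 0" by real_asymp
  hence "(\<lambda>n. real (k n) / real (Suc n) + C / real (Suc n) - bmean a (X n) / real (Suc n)) \<longlonglongrightarrow> t + 0 - F"
    by (intro tendsto_intros F k)
  hence "eventually (\<lambda>n. real (k n) / real (Suc n) + C / real (Suc n) - bmean a (X n) / real (Suc n) < 0) sequentially"
    using F(2) by (intro order_tendstoD) auto
  thus ?thesis
  proof eventually_elim
    case (elim n)
    have "(real (k n) + C) / real (Suc n) < bmean a (X n) / real (Suc n)" using elim by (simp add: add_divide_distrib)
    hence "real (k n) + C < bmean a (X n)" by (simp only: divide_less_cancel)
    hence "\<not> bmean a (X n) \<le> real (k n) + \<theta> / (1 - \<theta>)" by (simp add: C_def)
    thus ?case using bmean_le_of_ratio[OF X a th, of "k n" n] by force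
  qed
qed

lemma floor_ratio_tendsto:
  assumes "0 \<le> t" shows "(\<lambda>n. real (nat \<lfloor>t * real (Suc n)\<rfloor>) / real (Suc n)) \<longlonglongrightarrow> t"
proof (rule tendsto_sandwich)
  show "eventually (\<lambda>n. t - 1 / real (Suc n) \<le> real (nat \<lfloor>t * real (Suc n)\<rfloor>) / real (Suc n)) sequentially"
  proof (intro always_eventually allI)
    fix n
    have "t * real (Suc n) - 1 \<le> real (nat \<lfloor>t * real (Suc n)\<rfloor>)" using assms by linarith
    hence "(t * real (Suc n) - 1) / real (Suc n) \<le> real (nat \<lfloor>t * real (Suc n)\<rfloor>) / real (Suc n)"
      by (rule divide_right_mono) simp
    moreover have "(t * real (Suc n) - 1) / real (Suc n) = t - 1 / real (Suc n)" by (simp add: diff_divide_distrib)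
    ultimately show "t - 1 / real (Suc n) \<le> real (nat \<lfloor>t * real (Suc n)\<rfloor>) / real (Suc n)" by simp
  qed
  show "eventually (\<lambda>n. real (nat \<lfloor>t * real (Suc n)\<rfloor>) / real (Suc n) \<le> t) sequentially"
  proof (intro always_eventually allI)
    fix n
    have "real (nat \<lfloor>t * real (Suc n)\<rfloor>) \<le> t * real (Suc n)"
      using assms by (metis of_int_floor_le of_nat_nat of_nat_0_le_iff mult_nonneg_nonneg zero_le_floor of_int_of_nat_eq)
    hence "real (nat \<lfloor>t * real (Suc n)\<rfloor>) / real (Suc n) \<le> t * real (Suc n) / real (Suc n)"
      by (rule divide_right_mono) simp
    thus "real (nat \<lfloor>t * real (Suc n)\<rfloor>) / real (Suc n) \<le> t" by simp
  qed
  show "(\<lambda>n. t - 1 / real (Suc n)) \<longlonglongrightarrow> t" by real_asymp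
qed simp

text \<open>The factor \<open>(d - k) / Suc k\<close> tends to \<open>(1 - t) / t\<close> when
  \<open>k / d\<close> tends to \<open>t\<close>; up to sign this is the factor
  \<open>(1 + z) / z\<close> of the S-transform at \<open>z = - t\<close>.\<close>

lemma binomial_ratio:
  assumes "Suc k \<le> d"
  shows "1 / real (d choose k) = (real d - real k) / real (Suc k) / real (d choose Suc k)"
proof -
  have "Suc k * (d choose Suc k) = (d - k) * (d choose k)"
  proof -
    obtain n where "d = Suc n" using assms by (cases d) auto
    thus ?thesis using Suc_times_binomial[of k n] binomial_absorb_comp[of "Suc n" k] by (simp only: diff_Suc_1)
  qed
  hence "real (Suc k) * real (d choose Suc k) = (real d - real k) * real (d choose k)"
    using assms by (metis of_nat_diff of_nat_mult Suc_leD)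
  thus ?thesis using assms by (simp add: field_simps del: binomial_Suc_Suc of_nat_Suc)
qed

text \<open>Only the coefficient identity and the limits of the means enter, so the same statements
  serve the given polynomials and the perturbed ones behind the subordination kernel.\<close>

locale list_convolution =
  fixes X B R :: "nat \<Rightarrow> real list" and F G :: "real \<Rightarrow> real"
  assumes X: "\<And>n. set (X n) \<subseteq> {0..}" and B: "\<And>n. set (B n) \<subseteq> {0..}" and R: "\<And>n. set (R n) \<subseteq> {0..}"
    and lenR: "\<And>n. length (R n) = Suc n"
    and F: "\<And>s. s > 0 \<Longrightarrow> (\<lambda>n. bmean s (X n) / real (Suc n)) \<longlonglongrightarrow> F s"
    and G: "\<And>s. s > 0 \<Longrightarrow> (\<lambda>n. bmean s (B n) / real (Suc n)) \<longlonglongrightarrow> G s"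
    and RXB: "\<And>n k. esym k (R n) = esym k (X n) * esym k (B n) / real (Suc n choose k)"
begin

lemma floor_Suc_le:
  assumes "0 < t" "t < 1" shows "Suc (nat \<lfloor>t * real (Suc n)\<rfloor>) \<le> Suc n"
proof -
  have "t * real (Suc n) < real (Suc n)" using assms by simp
  hence "\<lfloor>t * real (Suc n)\<rfloor> < int (Suc n)" by linarith
  thus ?thesis by linarith
qed

lemma ratio_limit:
  assumes "0 < t" "t < 1"
  shows "(\<lambda>n. (real (Suc n) - real (nat \<lfloor>t * real (Suc n)\<rfloor>)) / real (Suc (nat \<lfloor>t * real (Suc n)\<rfloor>))) \<longlonglongrightarrow> (1 - t) / t"
proof -
  define k where "k n = nat \<lfloor>t * real (Suc n)\<rfloor>" for n
  have k: "(\<lambda>n. real (k n) / real (Suc n)) \<longlonglongrightarrow> t" unfolding k_def using assms by (intro floor_ratio_tendsto) auto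
  have "(\<lambda>n. 1 / real (Suc n)) \<longlonglongrightarrow> 0" by real_asymp
  hence "(\<lambda>n. (1 - real (k n) / real (Suc n)) / (real (k n) / real (Suc n) + 1 / real (Suc n))) \<longlonglongrightarrow> (1 - t) / (t + 0)"
    using assms by (intro tendsto_intros k) auto
  moreover have "(1 - real (k n) / real (Suc n)) / (real (k n) / real (Suc n) + 1 / real (Suc n)) =
      (real (Suc n) - real (k n)) / real (Suc (k n))" for n
  proof -
    have "1 - real (k n) / real (Suc n) = (real (Suc n) - real (k n)) / real (Suc n)" by (simp add: diff_divide_distrib)
    moreover have "real (k n) / real (Suc n) + 1 / real (Suc n) = real (Suc (k n)) / real (Suc n)" by (simp add: add_divide_distrib)
    ultimately show ?thesis by simp
  qed
  ultimately show ?thesis by (simp add: k_def)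
qed

text \<open>For \<open>q \<noteq> 1\<close> the number \<open>\<theta> = q\<^sup>1\<^sup>/\<^sup>4\<close> lies between \<open>1\<close> and \<open>q\<close> and so does its cube.\<close>

lemma bmean_R_le:
  assumes t: "0 < t" "t < 1" and ab: "a > 0" "b > 0" "F a < t" "G b < t"
    and s: "0 < s" "s < a * b * (1 - t) / t" and t': "t < t'"
  shows "eventually (\<lambda>n. bmean s (R n) / real (Suc n) \<le> t') sequentially"
proof -
  define k where "k n = nat \<lfloor>t * real (Suc n)\<rfloor>" for n
  have k: "(\<lambda>n. real (k n) / real (Suc n)) \<longlonglongrightarrow> t" unfolding k_def using t by (intro floor_ratio_tendsto) auto
  define c where "c = a * b * (1 - t) / t"
  have c: "c > 0" using ab t by (simp add: c_def)
  \<comment> \<open>Three factors \<open>\<theta>\<close> are spent, one on each ratio estimate for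
    \<open>X\<close> and \<open>B\<close> and one on the mode estimate for \<open>R\<close>;
    \<open>\<theta> ^ 4 = s / c\<close> leaves a strict margin.\<close>
  define \<theta> where "\<theta> = sqrt (sqrt (s / c))"
  have "s < c" using s(2) by (simp only: c_def)
  hence q: "0 < s / c" "s / c < 1" using s(1) c by simp_all
  hence th: "0 < \<theta>" "\<theta> < 1" by (simp_all add: \<theta>_def)
  have th4: "\<theta> ^ 4 = s / c"
  proof -
    have "\<theta> ^ 4 = (\<theta>\<^sup>2)\<^sup>2" by simp
    thus ?thesis using q by (simp only: \<theta>_def real_sqrt_pow2_iff real_sqrt_pow2 real_sqrt_ge_zero less_imp_le)
  qed
  have th3: "\<theta> ^ 3 > s / c"
  proof -
    have "\<theta> ^ 4 = \<theta> * \<theta> ^ 3" by (simp add: eval_nat_numeral)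
    also have "\<dots> < 1 * \<theta> ^ 3" using th by (intro mult_strict_right_mono) auto
    finally show ?thesis using th4 by simp
  qed
  have 1: "eventually (\<lambda>n. esym (k n) (X n) \<ge> \<theta> * a * esym (Suc (k n)) (X n)) sequentially"
    by (rule esym_ratio_eventually_ge[OF X F[OF ab(1)] ab(3) k ab(1) th])
  have 2: "eventually (\<lambda>n. esym (k n) (B n) \<ge> \<theta> * b * esym (Suc (k n)) (B n)) sequentially"
    by (rule esym_ratio_eventually_ge[OF B G[OF ab(2)] ab(4) k ab(2) th])
  have "(\<lambda>n. \<theta> ^ 3 * (a * b) * ((real (Suc n) - real (k n)) / real (Suc (k n)))) \<longlonglongrightarrow> \<theta> ^ 3 * (a * b) * ((1 - t) / t)"
    unfolding k_def by (intro tendsto_intros ratio_limit t)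
  moreover have "\<theta> ^ 3 * (a * b) * ((1 - t) / t) > s"
  proof -
    have "\<theta> ^ 3 * c > s" using th3 c by (simp add: field_simps)
    thus ?thesis by (simp add: c_def mult_ac)
  qed
  ultimately have 3: "eventually (\<lambda>n. \<theta> ^ 3 * (a * b) * ((real (Suc n) - real (k n)) / real (Suc (k n))) > s) sequentially"
    by (rule order_tendstoD)
  have "(\<lambda>n. \<theta> / (1 - \<theta>) / real (Suc n)) \<longlonglongrightarrow> 0" by real_asymp
  hence "(\<lambda>n. real (k n) / real (Suc n) + \<theta> / (1 - \<theta>) / real (Suc n)) \<longlonglongrightarrow> t + 0" by (intro tendsto_intros k)
  hence 4: "eventually (\<lambda>n. real (k n) / real (Suc n) + \<theta> / (1 - \<theta>) / real (Suc n) < t') sequentially"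
    using t' by (intro order_tendstoD) auto
  show ?thesis using 1 2 3 4
  proof eventually_elim
    case (elim n)
    define \<rho> where "\<rho> = (real (Suc n) - real (k n)) / real (Suc (k n))"
    have kn: "Suc (k n) \<le> Suc n" unfolding k_def by (rule floor_Suc_le[OF t])
    have nn: "esym j (X n) \<ge> 0" "esym j (B n) \<ge> 0" "esym j (R n) \<ge> 0" for j using esym_nonneg X B R by auto
    have rho: "\<rho> \<ge> 0" using kn by (simp add: \<rho>_def)
    have "(\<theta> * a * esym (Suc (k n)) (X n)) * (\<theta> * b * esym (Suc (k n)) (B n)) \<le> esym (k n) (X n) * esym (k n) (B n)"
      by (rule mult_mono) (use elim nn th ab in auto)
    hence "\<theta> * (((\<theta> * a * esym (Suc (k n)) (X n)) * (\<theta> * b * esym (Suc (k n)) (B n))) * (1 / real (Suc n choose k n)))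
      \<le> \<theta> * ((esym (k n) (X n) * esym (k n) (B n)) * (1 / real (Suc n choose k n)))"
      using th by (intro mult_left_mono mult_right_mono) auto
    also have "\<dots> = \<theta> * esym (k n) (R n)" by (simp add: RXB)
    also have "\<theta> * (((\<theta> * a * esym (Suc (k n)) (X n)) * (\<theta> * b * esym (Suc (k n)) (B n))) * (1 / real (Suc n choose k n)))
      = (\<theta> ^ 3 * (a * b) * \<rho>) * esym (Suc (k n)) (R n)"
      unfolding binomial_ratio[OF kn] RXB \<rho>_def by (simp add: eval_nat_numeral mult_ac del: binomial_Suc_Suc of_nat_Suc)
    finally have "(\<theta> ^ 3 * (a * b) * \<rho>) * esym (Suc (k n)) (R n) \<le> \<theta> * esym (k n) (R n)" .
    moreover have "s * esym (Suc (k n)) (R n) \<le> (\<theta> ^ 3 * (a * b) * \<rho>) * esym (Suc (k n)) (R n)"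
      using elim(3) nn by (intro mult_right_mono) (auto simp: \<rho>_def)
    ultimately have "\<theta> * esym (k n) (R n) \<ge> s * esym (Suc (k n)) (R n)" by linarith
    hence "bmean s (R n) \<le> real (k n) + \<theta> / (1 - \<theta>)" by (rule bmean_le_of_ratio[OF R s(1) th])
    hence "bmean s (R n) / real (Suc n) \<le> (real (k n) + \<theta> / (1 - \<theta>)) / real (Suc n)" by (rule divide_right_mono) simp
    thus ?case using elim(4) by (simp add: add_divide_distrib)
  qed
qed

lemma bmean_R_ge:
  assumes t: "0 < t" "t < 1" and ab: "a > 0" "b > 0" "F a > t" "G b > t"
    and s: "s > a * b * (1 - t) / t" and t': "t' < t"
  shows "eventually (\<lambda>n. bmean s (R n) / real (Suc n) \<ge> t') sequentially"
proof -
  define k where "k n = nat \<lfloor>t * real (Suc n)\<rfloor>" for n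
  have k: "(\<lambda>n. real (k n) / real (Suc n)) \<longlonglongrightarrow> t" unfolding k_def using t by (intro floor_ratio_tendsto) auto
  define c where "c = a * b * (1 - t) / t"
  have c: "c > 0" using ab t by (simp add: c_def)
  have s0: "s > 0" using s c by (simp add: c_def)
  define \<theta> where "\<theta> = sqrt (sqrt (c / s))"
  have "c < s" using s by (simp only: c_def)
  hence q: "0 < c / s" "c / s < 1" using s0 c by simp_all
  hence th: "0 < \<theta>" "\<theta> < 1" by (simp_all add: \<theta>_def)
  have th4: "\<theta> ^ 4 = c / s"
  proof -
    have "\<theta> ^ 4 = (\<theta>\<^sup>2)\<^sup>2" by simp
    thus ?thesis using q by (simp only: \<theta>_def real_sqrt_pow2_iff real_sqrt_pow2 real_sqrt_ge_zero less_imp_le)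
  qed
  have th3: "\<theta> ^ 3 > c / s"
  proof -
    have "\<theta> ^ 4 = \<theta> * \<theta> ^ 3" by (simp add: eval_nat_numeral)
    also have "\<dots> < 1 * \<theta> ^ 3" using th by (intro mult_strict_right_mono) auto
    finally show ?thesis using th4 by simp
  qed
  have 1: "eventually (\<lambda>n. \<theta> * esym (k n) (X n) < a * esym (Suc (k n)) (X n)) sequentially"
    by (rule esym_ratio_eventually_less[OF X F[OF ab(1)] ab(3) k ab(1) th])
  have 2: "eventually (\<lambda>n. \<theta> * esym (k n) (B n) < b * esym (Suc (k n)) (B n)) sequentially"
    by (rule esym_ratio_eventually_less[OF B G[OF ab(2)] ab(4) k ab(2) th])
  have "(\<lambda>n. (a * b) * ((real (Suc n) - real (k n)) / real (Suc (k n)))) \<longlonglongrightarrow> (a * b) * ((1 - t) / t)"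
    unfolding k_def by (intro tendsto_intros ratio_limit t)
  moreover have "(a * b) * ((1 - t) / t) < \<theta> ^ 3 * s"
  proof -
    have "\<theta> ^ 3 * s > c" using th3 s0 by (simp add: field_simps)
    thus ?thesis by (simp add: c_def mult_ac)
  qed
  ultimately have 3: "eventually (\<lambda>n. (a * b) * ((real (Suc n) - real (k n)) / real (Suc (k n))) < \<theta> ^ 3 * s) sequentially"
    by (rule order_tendstoD)
  have "(\<lambda>n. (1 - \<theta> / (1 - \<theta>)) / real (Suc n)) \<longlonglongrightarrow> 0" by real_asymp
  hence "(\<lambda>n. real (k n) / real (Suc n) + (1 - \<theta> / (1 - \<theta>)) / real (Suc n)) \<longlonglongrightarrow> t + 0" by (intro tendsto_intros k)
  hence 4: "eventually (\<lambda>n. real (k n) / real (Suc n) + (1 - \<theta> / (1 - \<theta>)) / real (Suc n) > t') sequentially"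
    using t' by (intro order_tendstoD) auto
  show ?thesis using 1 2 3 4
  proof eventually_elim
    case (elim n)
    define \<rho> where "\<rho> = (real (Suc n) - real (k n)) / real (Suc (k n))"
    have kn: "Suc (k n) \<le> Suc n" unfolding k_def by (rule floor_Suc_le[OF t])
    have nn: "esym j (X n) \<ge> 0" "esym j (B n) \<ge> 0" "esym j (R n) \<ge> 0" for j using esym_nonneg X B R by auto
    have rho: "\<rho> \<ge> 0" using kn by (simp add: \<rho>_def)
    have "a * esym (Suc (k n)) (X n) > 0" using elim(1) nn(1)[of "k n"] th by (smt (verit) mult_nonneg_nonneg)
    hence pX: "esym (Suc (k n)) (X n) > 0" using ab by (simp add: zero_less_mult_iff)
    have "b * esym (Suc (k n)) (B n) > 0" using elim(2) nn(2)[of "k n"] th by (smt (verit) mult_nonneg_nonneg)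
    hence pB: "esym (Suc (k n)) (B n) > 0" using ab by (simp add: zero_less_mult_iff)
    have "(Suc n choose Suc (k n)) > 0" using kn by (simp del: binomial_Suc_Suc)
    hence pR: "esym (Suc (k n)) (R n) > 0" using pX pB unfolding RXB by (simp del: binomial_Suc_Suc)
    have "(\<theta> * esym (k n) (X n)) * (\<theta> * esym (k n) (B n)) \<le> (a * esym (Suc (k n)) (X n)) * (b * esym (Suc (k n)) (B n))"
      by (rule mult_mono) (use elim nn th ab in auto)
    hence "((\<theta> * esym (k n) (X n)) * (\<theta> * esym (k n) (B n))) * (1 / real (Suc n choose k n))
      \<le> ((a * esym (Suc (k n)) (X n)) * (b * esym (Suc (k n)) (B n))) * (1 / real (Suc n choose k n))"
      by (intro mult_right_mono) auto
    also have "\<dots> = ((a * b) * \<rho>) * esym (Suc (k n)) (R n)"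
      unfolding binomial_ratio[OF kn] RXB \<rho>_def by (simp add: mult_ac del: binomial_Suc_Suc of_nat_Suc)
    also have "\<dots> < (\<theta> ^ 3 * s) * esym (Suc (k n)) (R n)"
      using elim(3) pR by (intro mult_strict_right_mono) (auto simp: \<rho>_def)
    also have "((\<theta> * esym (k n) (X n)) * (\<theta> * esym (k n) (B n))) * (1 / real (Suc n choose k n)) = \<theta>\<^sup>2 * esym (k n) (R n)"
      by (simp add: RXB power2_eq_square)
    also have "(\<theta> ^ 3 * s) * esym (Suc (k n)) (R n) = \<theta>\<^sup>2 * (\<theta> * s * esym (Suc (k n)) (R n))"
      by (simp add: eval_nat_numeral)
    finally have "esym (k n) (R n) < \<theta> * s * esym (Suc (k n)) (R n)" using th by simp
    hence "bmean s (R n) \<ge> real (Suc (k n)) - \<theta> / (1 - \<theta>)" by (rule bmean_ge_of_ratio[OF R s0 th])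
    hence "bmean s (R n) / real (Suc n) \<ge> (real (Suc (k n)) - \<theta> / (1 - \<theta>)) / real (Suc n)" by (rule divide_right_mono) simp
    moreover have "(real (Suc (k n)) - \<theta> / (1 - \<theta>)) / real (Suc n) = real (k n) / real (Suc n) + (1 - \<theta> / (1 - \<theta>)) / real (Suc n)"
      by (simp add: add_divide_distrib diff_divide_distrib)
    ultimately show ?case using elim(4) by linarith
  qed
qed

end

subsection \<open>Weak convergence to the free multiplicative convolution\<close>

lemma ftr_le_left:
  assumes M: "real_distribution M" and c: "c > 0" and le: "\<And>s. 0 < s \<Longrightarrow> s < c \<Longrightarrow> ftr M s \<le> t"
  shows "ftr M c \<le> t"
proof -
  define s where "s n = c * (real (Suc n) / real (Suc (Suc n)))" for n
  have "(\<lambda>n. real (Suc n) / real (Suc (Suc n))) \<longlonglongrightarrow> 1" by real_asymp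
  hence "s \<longlonglongrightarrow> c * 1" unfolding s_def by (intro tendsto_intros)
  hence lim: "s \<longlonglongrightarrow> c" by simp
  have s: "0 < s n" "s n < c" for n
    using c mult_strict_left_mono[of "real (Suc n) / real (Suc (Suc n))" 1 c] by (simp_all add: s_def)
  have "(\<lambda>n. ftr M (s n)) \<longlonglongrightarrow> ftr M c" using s c by (intro ftr_tendsto[OF M _ lim]) (auto simp: less_imp_le)
  thus ?thesis by (rule LIMSEQ_le_const2) (use le s in auto)
qed

lemma ftr_ge_right:
  assumes M: "real_distribution M" and c: "c > 0" and ge: "\<And>s. c < s \<Longrightarrow> ftr M s \<ge> t"
  shows "ftr M c \<ge> t"
proof -
  define s where "s n = c + 1 / real (Suc n)" for n
  have lim: "s \<longlonglongrightarrow> c" unfolding s_def by real_asymp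
  have s: "c < s n" for n by (simp add: s_def)
  have "(\<lambda>n. ftr M (s n)) \<longlonglongrightarrow> ftr M c" using s c by (intro ftr_tendsto[OF M _ lim]) (auto intro: less_imp_le less_trans)
  thus ?thesis by (rule LIMSEQ_le_const) (use ge s in auto)
qed

text \<open>With \<open>\<chi>(-t) = -s\<close> for \<open>ftr s = t\<close> this is \<open>S\<^sub>\<rho> = S\<^sub>\<mu> S\<^sub>\<nu>\<close> freed of the inverse function.\<close>

definition S_mult_rel :: "real measure \<Rightarrow> real measure \<Rightarrow> real measure \<Rightarrow> bool" where
  "S_mult_rel \<mu> \<nu> \<rho> \<longleftrightarrow> pos_dist \<rho> \<and>
     (\<forall>t a b. 0 < t \<longrightarrow> a > 0 \<longrightarrow> b > 0 \<longrightarrow> ftr \<mu> a = t \<longrightarrow> ftr \<nu> b = t \<longrightarrow> ftr \<rho> (a * b * (1 - t) / t) = t)"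

lemma S_mult_relD:
  "S_mult_rel \<mu> \<nu> \<rho> \<Longrightarrow> 0 < t \<Longrightarrow> a > 0 \<Longrightarrow> b > 0 \<Longrightarrow> ftr \<mu> a = t \<Longrightarrow> ftr \<nu> b = t \<Longrightarrow>
     ftr \<rho> (a * b * (1 - t) / t) = t"
  by (simp add: S_mult_rel_def)

lemma ftr_less_1:
  assumes M: "pos_dist M" and s: "s \<ge> 0" and nz: "M \<noteq> return borel 0"
  shows "ftr M s < 1 - measure M {0}"
proof -
  have "ftr M s < ftr M (s + 1)" using s by (intro ftr_strict_mono[OF M nz]) auto
  also have "\<dots> \<le> 1 - measure M {0}" using s by (intro ftr_le_atom[OF M]) auto
  finally show ?thesis .
qed

lemma ftr_inj:
  assumes M: "pos_dist M" and nz: "M \<noteq> return borel 0" and s: "s \<ge> 0" "s' \<ge> 0" "ftr M s = ftr M s'"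
  shows "s = s'"
  using ftr_strict_mono[OF M nz, of s s'] ftr_strict_mono[OF M nz, of s' s] s by (cases s s' rule: linorder_cases) auto

lemma ftr_pos:
  assumes M: "pos_dist M" and nz: "M \<noteq> return borel 0" and s: "s > 0" shows "ftr M s > 0"
  using ftr_strict_mono[OF M nz, of 0 s] s by (simp add: ftr_0)

locale two_pos_dists =
  fixes \<mu> \<nu> :: "real measure"
  assumes mu: "pos_dist \<mu>" and nu: "pos_dist \<nu>"
    and mu0: "\<mu> \<noteq> return borel 0" and nu0: "\<nu> \<noteq> return borel 0"
begin

text \<open>The interval \<open>(0, tmax)\<close> is the common range of both transforms on positive
  arguments, and the reflection \<open>t = - z\<close> of the domain in the definition of
  \<open>free_mult_conv\<close>.\<close>

definition tmax :: real where "tmax = 1 - max (measure \<mu> {0}) (measure \<nu> {0})"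

lemma tmax: "0 < tmax" "tmax \<le> 1 - measure \<mu> {0}" "tmax \<le> 1 - measure \<nu> {0}" "tmax \<le> 1"
  using atom_0_less_1[OF pos_distD[OF mu] mu0] atom_0_less_1[OF pos_distD[OF nu] nu0] measure_nonneg[of \<mu> "{0}"]
  by (auto simp: tmax_def max_def)

lemma preimages:
  assumes "0 < t" "t < tmax" obtains a b where "a > 0" "b > 0" "ftr \<mu> a = t" "ftr \<nu> b = t"
proof -
  obtain a where "a > 0" "ftr \<mu> a = t" using ftr_surj[OF mu assms(1)] assms tmax by auto
  moreover obtain b where "b > 0" "ftr \<nu> b = t" using ftr_surj[OF nu assms(1)] assms tmax by auto
  ultimately show ?thesis using that by blast
qed

lemma less_tmax:
  assumes "a \<ge> 0" "b \<ge> 0" "ftr \<mu> a = t" "ftr \<nu> b = t" shows "t < tmax"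
  using ftr_less_1[OF mu assms(1) mu0] ftr_less_1[OF nu assms(2) nu0] assms by (simp add: tmax_def)

lemma S_mult_rel_nontrivial:
  assumes "S_mult_rel \<mu> \<nu> \<rho>" shows "\<rho> \<noteq> return borel 0"
proof
  assume r: "\<rho> = return borel 0"
  obtain t where t: "0 < t" "t < tmax" using tmax(1) dense by blast
  obtain a b where ab: "a > 0" "b > 0" "ftr \<mu> a = t" "ftr \<nu> b = t" using preimages[OF t] by blast
  have "ftr \<rho> (a * b * (1 - t) / t) = t" using assms t ab by (auto simp: S_mult_rel_def)
  moreover have "ftr \<rho> s = 0" for s unfolding ftr_def r by (simp add: integral_return gker_def)
  ultimately show False using t by simp
qed

lemma S_mult_relE:
  assumes r: "S_mult_rel \<mu> \<nu> \<rho>" and s: "s > 0" "ftr \<rho> s < tmax"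
  obtains a b where "a > 0" "b > 0" "ftr \<mu> a = ftr \<rho> s" "ftr \<nu> b = ftr \<rho> s" "s = a * b * (1 - ftr \<rho> s) / ftr \<rho> s"
proof -
  have rho: "pos_dist \<rho>" using r by (simp add: S_mult_rel_def)
  have nz: "\<rho> \<noteq> return borel 0" using r by (rule S_mult_rel_nontrivial)
  define t where "t = ftr \<rho> s"
  have t: "0 < t" "t < tmax" using s ftr_pos[OF rho nz] by (auto simp: t_def)
  obtain a b where ab: "a > 0" "b > 0" "ftr \<mu> a = t" "ftr \<nu> b = t" using preimages[OF t] by blast
  have "ftr \<rho> (a * b * (1 - t) / t) = ftr \<rho> s" using r t ab by (auto simp: S_mult_rel_def t_def)
  moreover have "a * b * (1 - t) / t \<ge> 0" using t tmax ab by (auto intro!: divide_nonneg_pos mult_nonneg_nonneg)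
  ultimately have "s = a * b * (1 - t) / t" using ftr_inj[OF rho nz] s(1) by (metis less_imp_le)
  thus ?thesis using that ab by (simp add: t_def)
qed

text \<open>Near 0 the values of \<open>ftr \<rho>\<close> stay below \<open>tmax\<close>, where the
  relation fixes the inverse function of \<open>ftr \<rho>\<close>. Two solutions therefore have
  transforms that agree on an interval \<open>(0, e)\<close>.\<close>

lemma S_mult_rel_unique:
  assumes r: "S_mult_rel \<mu> \<nu> \<rho>" and r': "S_mult_rel \<mu> \<nu> \<rho>'" shows "\<rho> = \<rho>'"
proof -
  have rho: "pos_dist \<rho>" "pos_dist \<rho>'" using r r' by (auto simp: S_mult_rel_def)
  obtain e where e: "e > 0" "ftr \<rho> e < tmax" using ftr_small[OF pos_distD[OF rho(1)] tmax(1)] by blast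
  show ?thesis
  proof (rule ftr_unique[OF rho e(1)])
    fix s assume s: "0 < s" "s < e"
    have "ftr \<rho> s \<le> ftr \<rho> e" using s by (intro ftr_mono pos_distD[OF rho(1)]) auto
    hence lt: "ftr \<rho> s < tmax" using e(2) by linarith
    obtain a b where ab: "a > 0" "b > 0" "ftr \<mu> a = ftr \<rho> s" "ftr \<nu> b = ftr \<rho> s" "s = a * b * (1 - ftr \<rho> s) / ftr \<rho> s"
      using S_mult_relE[OF r s(1) lt] by blast
    have "ftr \<rho> s > 0" using ftr_pos[OF rho(1) S_mult_rel_nontrivial[OF r] s(1)] .
    hence "ftr \<rho>' (a * b * (1 - ftr \<rho> s) / ftr \<rho> s) = ftr \<rho> s" using S_mult_relD[OF r'] ab by blast
    thus "ftr \<rho> s = ftr \<rho>' s" using ab(5) by simp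
  qed
qed

end

section \<open>Translation between the S-transform and \<open>ftr\<close>\<close>

lemma chi_tr_eq:
  assumes M: "pos_dist M" and nz: "M \<noteq> return borel 0" and s: "s > 0" "ftr M s = t"
  shows "chi_tr M (- t) = - s" "x < 0 \<and> psi_tr M x = - t \<longleftrightarrow> x = - s"
proof -
  show iff: "x < 0 \<and> psi_tr M x = - t \<longleftrightarrow> x = - s" for x
  proof
    assume x: "x < 0 \<and> psi_tr M x = - t"
    hence "ftr M (- x) = t" using psi_tr_neg[OF M, of "- x"] by simp
    hence "- x = s" using ftr_inj[OF M nz, of "- x" s] s x by simp
    thus "x = - s" by simp
  qed (use psi_tr_neg[OF M s(1)] s in auto)
  show "chi_tr M (- t) = - s" unfolding chi_tr_def by (rule the_equality) (simp_all only: iff)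
qed

lemma S_tr_eq:
  assumes "pos_dist M" "M \<noteq> return borel 0" "s > 0" "ftr M s = t" "t > 0"
  shows "S_tr M (- t) = (1 - t) / t * s"
  unfolding S_tr_def chi_tr_eq(1)[OF assms(1-4)] using assms(5) by (simp add: field_simps)

context two_pos_dists
begin

text \<open>This discharges the definite description. Any competitor has, by the clause on unique
  preimages, a genuine inverse at each \<open>- t\<close>, so its S-transform identity translates
  back into \<open>S_mult_rel\<close>, where uniqueness is known. A suitable \<open>\<rho>\<close>
  is supplied later by the limit argument.\<close>

lemma free_mult_conv_eq:
  assumes r: "S_mult_rel \<mu> \<nu> \<rho>" shows "free_mult_conv \<mu> \<nu> = \<rho>"
proof -
  define \<Phi> where "\<Phi> \<rho> \<longleftrightarrow> real_distribution \<rho> \<and> measure \<rho> {..<0} = 0 \<and>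
       (\<forall>z\<in>{max (measure \<mu> {0}) (measure \<nu> {0}) - 1 <..< 0}.
          (\<exists>!x. x < 0 \<and> psi_tr \<rho> x = z) \<and> S_tr \<rho> z = S_tr \<mu> z * S_tr \<nu> z)" for \<rho>
  have "\<Phi> \<rho>" unfolding \<Phi>_def
  proof (intro conjI ballI)
    have rho: "pos_dist \<rho>" using r by (simp add: S_mult_rel_def)
    have nz: "\<rho> \<noteq> return borel 0" using r by (rule S_mult_rel_nontrivial)
    show "real_distribution \<rho>" "measure \<rho> {..<0} = 0" using rho by (auto simp: pos_dist_def)
    fix z assume z: "z \<in> {max (measure \<mu> {0}) (measure \<nu> {0}) - 1 <..< 0}"
    define t where "t = - z"
    have t: "0 < t" "t < tmax" "z = - t" using z by (auto simp: t_def tmax_def)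
    have t1: "t < 1" using t tmax by simp
    obtain a b where ab: "a > 0" "b > 0" "ftr \<mu> a = t" "ftr \<nu> b = t" using preimages[OF t(1,2)] by blast
    define c where "c = a * b * (1 - t) / t"
    have c: "c > 0" "ftr \<rho> c = t" using r t ab t1 by (auto simp: S_mult_rel_def c_def)
    show "\<exists>!x. x < 0 \<and> psi_tr \<rho> x = z" unfolding t(3) chi_tr_eq(2)[OF rho nz c] by simp
    show "S_tr \<rho> z = S_tr \<mu> z * S_tr \<nu> z"
      unfolding t(3) S_tr_eq[OF rho nz c t(1)] S_tr_eq[OF mu mu0 ab(1,3) t(1)] S_tr_eq[OF nu nu0 ab(2,4) t(1)]
      by (simp add: c_def)
  qed
  moreover have "\<rho>' = \<rho>" if P: "\<Phi> \<rho>'" for \<rho>'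
  proof (rule S_mult_rel_unique[OF _ r])
    have rho: "pos_dist \<rho>'" using P by (simp add: \<Phi>_def pos_dist_def)
    show "S_mult_rel \<mu> \<nu> \<rho>'" unfolding S_mult_rel_def
    proof (intro conjI rho allI impI)
      fix t a b :: real assume t: "0 < t" and ab: "a > 0" "b > 0" "ftr \<mu> a = t" "ftr \<nu> b = t"
      have tm: "t < tmax" using less_tmax[of a b t] ab by simp
      hence t1: "t < 1" using tmax by simp
      have "- t \<in> {max (measure \<mu> {0}) (measure \<nu> {0}) - 1 <..< 0}" using t tm by (simp add: tmax_def)
      hence ex: "\<exists>!x. x < 0 \<and> psi_tr \<rho>' x = - t" and S: "S_tr \<rho>' (- t) = S_tr \<mu> (- t) * S_tr \<nu> (- t)"
        using P by (auto simp: \<Phi>_def)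
      obtain x where x: "x < 0" "psi_tr \<rho>' x = - t" using ex by blast
      define c where "c = - x"
      have c: "c > 0" "ftr \<rho>' c = t" using x psi_tr_neg[OF rho, of c] by (auto simp: c_def)
      have nz: "\<rho>' \<noteq> return borel 0"
      proof
        assume "\<rho>' = return borel 0"
        hence "ftr \<rho>' c = 0" unfolding ftr_def by (simp add: integral_return gker_def)
        thus False using c t by simp
      qed
      have "(1 - t) / t * c = (1 - t) / t * a * ((1 - t) / t * b)"
        using S unfolding S_tr_eq[OF rho nz c t(1)] S_tr_eq[OF mu mu0 ab(1,3) t(1)] S_tr_eq[OF nu nu0 ab(2,4) t(1)] .
      moreover have "(1 - t) / t > 0" using t t1 by simp
      ultimately have "c = a * ((1 - t) / t * b)" by (simp only: mult.assoc mult_cancel_left) auto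
      hence "c = a * b * (1 - t) / t" by simp
      thus "ftr \<rho>' (a * b * (1 - t) / t) = t" using c by simp
    qed
  qed
  ultimately have "(THE \<rho>. \<Phi> \<rho>) = \<rho>" by (rule the_equality)
  thus ?thesis using mu0 nu0 unfolding free_mult_conv_def \<Phi>_def by simp
qed

end

section \<open>Limit points of the composed root distributions\<close>

locale dist_convolution = list_convolution X B R "ftr \<mu>" "ftr \<nu>"
  for X B R :: "nat \<Rightarrow> real list" and \<mu> \<nu> :: "real measure" +
  assumes mu: "pos_dist \<mu>" and nu: "pos_dist \<nu>"
begin

lemma pos_R: "pos_dist (rmeas (R n))"
  using R[of n] lenR[of n] by (intro pos_dist_rmeas) auto

lemma ftr_R: "ftr (rmeas (R n)) s = bmean s (R n) / real (Suc n)"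
  using R[of n] lenR[of n] by (subst ftr_rmeas) auto

context
  fixes r :: "nat \<Rightarrow> nat" and \<rho> :: "real measure"
  assumes r: "strict_mono r" and rd: "real_distribution \<rho>" and wc: "weak_conv_m ((\<lambda>n. rmeas (R n)) \<circ> r) \<rho>"
begin

lemma limit_pos_dist: "pos_dist \<rho>"
  by (rule weak_conv_pos_dist[OF _ rd wc]) (simp add: pos_R)

lemma limit_ftr: "s > 0 \<Longrightarrow> (\<lambda>n. bmean s (R (r n)) / real (Suc (r n))) \<longlonglongrightarrow> ftr \<rho> s"
  using weak_conv_imp_ftr[OF _ rd wc, of s] by (simp add: pos_R pos_distD ftr_R)

lemma limit_upper:
  assumes "0 < t" "t < 1" "a > 0" "b > 0" "ftr \<mu> a < t" "ftr \<nu> b < t" "0 < s" "s < a * b * (1 - t) / t"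
  shows "ftr \<rho> s \<le> t"
proof (rule field_le_epsilon)
  fix e :: real assume "e > 0"
  hence "eventually (\<lambda>n. bmean s (R n) / real (Suc n) \<le> t + e) sequentially"
    using assms by (intro bmean_R_le[of t a b s]) auto
  hence "eventually (\<lambda>n. bmean s (R (r n)) / real (Suc (r n)) \<le> t + e) sequentially" by (rule eventually_subseq[OF r])
  thus "ftr \<rho> s \<le> t + e" using limit_ftr[OF assms(7)] by (intro tendsto_upperbound) auto
qed

lemma limit_lower:
  assumes "0 < t" "t < 1" "a > 0" "b > 0" "ftr \<mu> a > t" "ftr \<nu> b > t" "s > a * b * (1 - t) / t"
  shows "ftr \<rho> s \<ge> t"
proof (rule field_le_epsilon)
  have s: "s > 0" using assms by (smt (verit) divide_pos_pos mult_pos_pos)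
  fix e :: real assume "e > 0"
  hence "eventually (\<lambda>n. bmean s (R n) / real (Suc n) \<ge> t - e) sequentially"
    using assms by (intro bmean_R_ge[of t a b s]) auto
  hence "eventually (\<lambda>n. bmean s (R (r n)) / real (Suc (r n)) \<ge> t - e) sequentially" by (rule eventually_subseq[OF r])
  hence "ftr \<rho> s \<ge> t - e" using limit_ftr[OF s] by (intro tendsto_lowerbound) auto
  thus "t \<le> ftr \<rho> s + e" by simp
qed

text \<open>The one-sided estimates require strict inequalities, so \<open>a\<close> and
  \<open>b\<close> are scaled by the fourth root \<open>q\<close> of \<open>s / c\<close>. Then
  \<open>q\<^sup>2 * c\<close> lies strictly between \<open>s\<close> and \<open>c\<close>, and
  continuity squeezes \<open>ftr \<rho> c\<close> to \<open>t\<close>.\<close>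

lemma limit_S_mult_rel:
  assumes mu0: "\<mu> \<noteq> return borel 0" and nu0: "\<nu> \<noteq> return borel 0"
  shows "S_mult_rel \<mu> \<nu> \<rho>"
  unfolding S_mult_rel_def
proof (intro conjI limit_pos_dist allI impI)
  fix t a b :: real assume t: "0 < t" and ab: "a > 0" "b > 0" "ftr \<mu> a = t" "ftr \<nu> b = t"
  interpret two_pos_dists \<mu> \<nu> using mu nu mu0 nu0 by unfold_locales
  have t1: "t < 1" using less_tmax[of a b t] ab tmax by simp
  define c where "c = a * b * (1 - t) / t"
  have c: "c > 0" using t t1 ab by (simp add: c_def)
  have q: "(q * a) * (q * b) * (1 - t) / t = q\<^sup>2 * c" for q by (simp add: c_def power2_eq_square)
  have "ftr \<rho> s \<le> t" if s: "0 < s" "s < c" for s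
  proof -
    define q where "q = sqrt (sqrt (s / c))"
    have sc: "0 < s / c" "s / c < 1" using s c by simp_all
    have q0: "0 < q" "q < 1" using sc by (simp_all add: q_def)
    have q2: "q\<^sup>2 = sqrt (s / c)" using sc by (simp add: q_def)
    have e: "sqrt (s / c) * sqrt (s / c) = s / c" using sc(1) by (simp only: real_sqrt_mult_self abs_of_pos)
    have "sqrt (s / c) * sqrt (s / c) < 1 * sqrt (s / c)" using sc by (intro mult_strict_right_mono) auto
    hence "s / c < q\<^sup>2" unfolding e q2 by (simp only: mult_1_left)
    hence "s < (q * a) * (q * b) * (1 - t) / t" unfolding q using c by (simp add: field_simps)
    moreover have "ftr \<mu> (q * a) < t" using ftr_strict_mono[OF mu mu0, of "q * a" a] q0 ab by simp
    moreover have "ftr \<nu> (q * b) < t" using ftr_strict_mono[OF nu nu0, of "q * b" b] q0 ab by simp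
    ultimately show ?thesis using q0 ab t t1 s by (intro limit_upper[of t "q * a" "q * b" s]) auto
  qed
  moreover have "ftr \<rho> s \<ge> t" if s: "c < s" for s
  proof -
    define q where "q = sqrt (sqrt (s / c))"
    have sc: "1 < s / c" using s c by simp
    have q0: "1 < q" using sc by (simp add: q_def)
    have q2: "q\<^sup>2 = sqrt (s / c)" using sc by (simp add: q_def)
    have "s / c > 0" using sc by simp
    hence e: "sqrt (s / c) * sqrt (s / c) = s / c" by (simp only: real_sqrt_mult_self abs_of_pos)
    have "1 * sqrt (s / c) < sqrt (s / c) * sqrt (s / c)" using sc by (intro mult_strict_right_mono) auto
    hence "q\<^sup>2 < s / c" unfolding e q2 by (simp only: mult_1_left)
    hence "s > (q * a) * (q * b) * (1 - t) / t" unfolding q using c by (simp add: field_simps)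
    moreover have "ftr \<mu> (q * a) > t" using ftr_strict_mono[OF mu mu0, of a "q * a"] q0 ab by simp
    moreover have "ftr \<nu> (q * b) > t" using ftr_strict_mono[OF nu nu0, of b "q * b"] q0 ab by simp
    ultimately show ?thesis using q0 ab t t1 s by (intro limit_lower[of t "q * a" "q * b" s]) auto
  qed
  ultimately have "ftr \<rho> c = t" using ftr_le_left[OF rd c] ftr_ge_right[OF rd c] by (meson antisym)
  thus "ftr \<rho> (a * b * (1 - t) / t) = t" by (simp add: c_def)
qed

lemma limit_degenerate:
  assumes "\<mu> = return borel 0 \<or> \<nu> = return borel 0" shows "\<rho> = return borel 0"
proof (rule ftr_eq_0D[OF limit_pos_dist])
  show "(1::real) > 0" by simp
  have z: "ftr (return borel 0) s = 0" for s unfolding ftr_def by (simp add: integral_return gker_def)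
  have "ftr \<rho> 1 \<le> t" if t: "0 < t" "t < 1" for t
  proof -
    obtain a where a: "a > 0" "ftr \<mu> a < t" using ftr_small[OF pos_distD[OF mu] t(1)] by blast
    obtain b where b: "b > 0" "ftr \<nu> b < t" using ftr_small[OF pos_distD[OF nu] t(1)] by blast
    \<comment> \<open>The transform of the degenerate factor vanishes identically, so its argument
      may be enlarged freely; \<open>K\<close> brings the threshold
      \<open>K * a * b * (1 - t) / t\<close> above 1.\<close>
    define K where "K = 1 + t / (a * b * (1 - t))"
    have K: "K > 0" using t a b by (auto simp: K_def intro!: add_pos_nonneg)
    have "K * (a * b * (1 - t)) = a * b * (1 - t) + t" using t a b by (simp add: K_def field_simps)
    hence "1 < K * (a * b * (1 - t)) / t" using t a b by simp
    hence "1 < (K * a) * b * (1 - t) / t" "1 < a * (K * b) * (1 - t) / t" by (simp_all add: mult_ac)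
    with assms a b K t show ?thesis
      by (auto intro: limit_upper[of t "K * a" b 1] limit_upper[of t a "K * b" 1] simp: z)
  qed
  hence "ftr \<rho> 1 \<le> 0" by (intro dense_ge_bounded[of 0 1]) auto
  thus "ftr \<rho> 1 = 0" using ftr_bounds[OF rd, of 1] by simp
qed

end

lemma tight_R: "tight (\<lambda>n. rmeas (R n))"
proof (rule pos_tight[OF pos_R])
  fix \<epsilon> :: real assume e: "\<epsilon> > 0"
  define t where "t = min (\<epsilon> / 2) (1 / 2)"
  have t: "0 < t" "t < 1" "t < \<epsilon>" using e by (auto simp: t_def)
  obtain a where a: "a > 0" "ftr \<mu> a < t" using ftr_small[OF pos_distD[OF mu] t(1)] by blast
  obtain b where b: "b > 0" "ftr \<nu> b < t" using ftr_small[OF pos_distD[OF nu] t(1)] by blast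
  have c: "a * b * (1 - t) / t > 0" using a b t by simp
  then obtain s where s: "0 < s" "s < a * b * (1 - t) / t" using dense by blast
  have "eventually (\<lambda>n. ftr (rmeas (R n)) s \<le> \<epsilon>) sequentially"
    unfolding ftr_R by (rule bmean_R_le[OF t(1,2) a(1) b(1) a(2) b(2) s t(3)])
  thus "\<exists>s>0. eventually (\<lambda>n. ftr (rmeas (R n)) s \<le> \<epsilon>) sequentially" using s by blast
qed

text \<open>Tightness yields one limit point, which shows that the description defining the free
  convolution is satisfied; every further subsequential limit obeys the same relation and equals it.
  The degenerate case forces all limit points to be the unit mass at 0.\<close>

theorem weak_conv_R:
  "weak_conv_m (\<lambda>n. rmeas (R n)) (free_mult_conv \<mu> \<nu>)"
  "\<mu> \<noteq> return borel 0 \<Longrightarrow> \<nu> \<noteq> return borel 0 \<Longrightarrow> S_mult_rel \<mu> \<nu> (free_mult_conv \<mu> \<nu>)"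
  "pos_dist (free_mult_conv \<mu> \<nu>)"
proof -
  obtain r \<rho> where r: "strict_mono (r :: nat \<Rightarrow> nat)" "real_distribution \<rho>" "weak_conv_m ((\<lambda>n. rmeas (R n)) \<circ> id \<circ> r) \<rho>"
    using tight_imp_convergent_subsubsequence[OF tight_R, of id] by (auto simp: strict_mono_id)
  hence wc: "weak_conv_m ((\<lambda>n. rmeas (R n)) \<circ> r) \<rho>" by simp
  have *: "\<rho>' = free_mult_conv \<mu> \<nu>" if "strict_mono r'" "real_distribution \<rho>'" "weak_conv_m ((\<lambda>n. rmeas (R n)) \<circ> r') \<rho>'" for r' \<rho>'
  proof (cases "\<mu> = return borel 0 \<or> \<nu> = return borel 0")
    case True
    thus ?thesis using limit_degenerate[OF that True] by (simp add: free_mult_conv_def)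
  next
    case False
    interpret two_pos_dists \<mu> \<nu> using mu nu False by unfold_locales auto
    show ?thesis using free_mult_conv_eq[OF limit_S_mult_rel[OF that]] False by simp
  qed
  have eq: "\<rho> = free_mult_conv \<mu> \<nu>" using *[OF r(1,2) wc] .
  show "pos_dist (free_mult_conv \<mu> \<nu>)" using limit_pos_dist[OF r(1,2) wc] by (simp add: eq)
  show "S_mult_rel \<mu> \<nu> (free_mult_conv \<mu> \<nu>)" if "\<mu> \<noteq> return borel 0" "\<nu> \<noteq> return borel 0"
    using limit_S_mult_rel[OF r(1,2) wc that] by (simp add: eq)
  show "weak_conv_m (\<lambda>n. rmeas (R n)) (free_mult_conv \<mu> \<nu>)"
  proof (rule tight_subseq_weak_converge[OF _ _ tight_R])
    show "real_distribution (free_mult_conv \<mu> \<nu>)" using r(2) by (simp add: eq)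
    show "weak_conv_m ((\<lambda>n. rmeas (R n)) \<circ> s) (free_mult_conv \<mu> \<nu>)"
      if "strict_mono s" "real_distribution \<nu>'" "weak_conv_m ((\<lambda>n. rmeas (R n)) \<circ> s) \<nu>'" for s \<nu>'
      using *[OF that] that(3) by simp
  qed (simp add: pos_R pos_distD)
qed

end

subsection \<open>The subordination kernel\<close>

text \<open>The map from \<open>x\<close> to \<open>s * x / (1 + s * x)\<close> has slope at most
  \<open>s\<close> on the half-line. Roots can thus be pushed off 0 by a vanishing amount without
  affecting limits of the normalised means.\<close>

lemma bmean_shift:
  assumes "set xs \<subseteq> {0..}" "s \<ge> 0" "e \<ge> 0"
  shows "\<bar>bmean s (map (\<lambda>x. x + e) xs) - bmean s xs\<bar> \<le> real (length xs) * (s * e)"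
  using assms
proof (induction xs)
  case (Cons x xs)
  define u where "u = 1 + s * x"
  have u: "u \<ge> 1" using Cons.prems by (simp add: u_def)
  have se: "s * e \<ge> 0" using Cons.prems by simp
  have "s * (x + e) / (1 + s * (x + e)) - s * x / (1 + s * x) = (s * e) / (u * (u + s * e))"
    using u se by (simp add: u_def field_simps)
  moreover have "0 \<le> (s * e) / (u * (u + s * e))" using u se by simp
  moreover have "(s * e) / (u * (u + s * e)) \<le> (s * e) / 1"
  proof (intro divide_left_mono)
    show "1 \<le> u * (u + s * e)" using u se mult_mono[of 1 u 1 "u + s * e"] by simp
  qed (use u se in auto)
  ultimately have "\<bar>s * (x + e) / (1 + s * (x + e)) - s * x / (1 + s * x)\<bar> \<le> s * e" by linarith
  moreover have "\<bar>bmean s (map (\<lambda>x. x + e) xs) - bmean s xs\<bar> \<le> real (length xs) * (s * e)" using Cons by simp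
  ultimately have "\<bar>(s * (x + e) / (1 + s * (x + e)) - s * x / (1 + s * x)) + (bmean s (map (\<lambda>x. x + e) xs) - bmean s xs)\<bar>
      \<le> s * e + real (length xs) * (s * e)" by linarith
  thus ?case by (simp add: bmean_Cons algebra_simps)
qed (simp add: bmean_def)

lemma bern_bounds: "s \<ge> 0 \<Longrightarrow> x \<ge> 0 \<Longrightarrow> 0 \<le> s * x / (1 + s * x) \<and> s * x / (1 + s * x) \<le> (1::real)"
  by (simp add: divide_le_eq add_nonneg_pos add_pos_nonneg)

lemma weighted_dist:
  fixes w :: "real \<Rightarrow> real"
  assumes S: "finite S" "S \<subseteq> {0..}" and w: "\<And>x. x \<in> S \<Longrightarrow> w x \<ge> 0" "(\<Sum>x\<in>S. w x) = 1"
  obtains \<sigma> where "pos_dist \<sigma>" "\<And>f. f \<in> borel_measurable borel \<Longrightarrow> (\<integral>x. f x \<partial>\<sigma>) = (\<Sum>x\<in>S. w x * (f x :: real))"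
proof -
  define f where "f x = (if x \<in> S then w x else 0)" for x
  have f0: "f x \<ge> 0" for x using w by (simp add: f_def)
  have "(\<integral>\<^sup>+x. ennreal (f x) \<partial>count_space UNIV) = (\<Sum>x\<in>S. ennreal (f x))"
    by (rule nn_integral_count_space') (use S in \<open>auto simp: f_def\<close>)
  also have "\<dots> = ennreal (\<Sum>x\<in>S. f x)" using f0 by (simp add: sum_ennreal)
  also have "(\<Sum>x\<in>S. f x) = 1" using w(2) by (simp add: f_def)
  finally have pm: "pmf (embed_pmf f) x = f x" for x using f0 by (intro pmf_embed_pmf) auto
  define \<sigma> where "\<sigma> = distr (measure_pmf (embed_pmf f)) borel (\<lambda>x. x)"
  have rd: "real_distribution \<sigma>"
    unfolding \<sigma>_def by (intro prob_space.real_distribution_distr measure_pmf.prob_space_axioms) auto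
  have int: "(\<integral>x. g x \<partial>\<sigma>) = (\<Sum>x\<in>S. w x * g x)" if [measurable]: "g \<in> borel_measurable borel" for g :: "real \<Rightarrow> real"
  proof -
    have "(\<integral>x. g x \<partial>\<sigma>) = (\<integral>x. g x \<partial>measure_pmf (embed_pmf f))" unfolding \<sigma>_def by (subst integral_distr) auto
    also have "\<dots> = (\<Sum>x\<in>S. g x * pmf (embed_pmf f) x)"
      using S by (intro integral_measure_pmf_real) (auto simp: set_pmf_iff pm f_def split: if_splits)
    also have "\<dots> = (\<Sum>x\<in>S. w x * g x)" by (intro sum.cong) (auto simp: pm f_def)
    finally show ?thesis .
  qed
  interpret real_distribution \<sigma> by (rule rd)
  have "measure \<sigma> {..<0} = (\<integral>x. indicator {..<0} x \<partial>\<sigma>)" by simp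
  also have "\<dots> = (\<Sum>x\<in>S. w x * indicator {..<0} x)" by (rule int) simp
  also have "\<dots> = 0" using S by (intro sum.neutral) auto
  finally have "pos_dist \<sigma>" using rd by (simp add: pos_dist_def)
  thus ?thesis using that int by blast
qed

text \<open>Chebyshev's inequality for the Bernoulli sum attached to \<open>rs\<close>.\<close>

lemma esym_tail:
  assumes rs: "set rs \<subseteq> {0..}" and s: "s \<ge> 0" and A: "A \<subseteq> {..length rs}"
    and h: "h > 0" "\<And>k. k \<in> A \<Longrightarrow> \<bar>real k - bmean s rs\<bar> \<ge> h"
  shows "(\<Sum>k\<in>A. esym k rs * s ^ k) \<le> btot s rs * (real (length rs) / h\<^sup>2)"
proof -
  have nn: "esym k rs * s ^ k \<ge> 0" for k using esym_nonneg[OF rs] s by simp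
  have "h\<^sup>2 * (\<Sum>k\<in>A. esym k rs * s ^ k) \<le> (\<Sum>k\<in>A. (real k - bmean s rs)\<^sup>2 * (esym k rs * s ^ k))"
    unfolding sum_distrib_left
  proof (intro sum_mono mult_right_mono nn)
    fix k assume "k \<in> A"
    hence "h\<^sup>2 \<le> \<bar>real k - bmean s rs\<bar>\<^sup>2" using h by (intro power_mono) auto
    thus "h\<^sup>2 \<le> (real k - bmean s rs)\<^sup>2" by simp
  qed
  also have "\<dots> \<le> (\<Sum>k\<le>length rs. (real k - bmean s rs)\<^sup>2 * (esym k rs * s ^ k))"
    using A nn by (intro sum_mono2) auto
  also have "\<dots> \<le> btot s rs * real (length rs)" using esym_variance[OF rs s, of "bmean s rs"] by simp
  finally show ?thesis using h(1) by (simp add: field_simps)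
qed

text \<open>Adding the root \<open>l\<close> contributes \<open>l\<close> times the preceding
  symmetric function. Above \<open>k0\<close> that one is at least \<open>x\<close> times the
  current one, which gives the factor \<open>1 / (1 + l * x)\<close>; the indices up to
  \<open>k0\<close> are paid for in full and will form a negligible tail.\<close>

lemma kernel_upper_finite:
  assumes ys: "set ys \<subseteq> {0..}" and l: "l \<ge> 0" and x: "x \<ge> 0" and k0: "esym k0 ys \<ge> x * esym (Suc k0) ys"
    and v: "\<And>k. v k \<ge> 0"
  shows "(\<Sum>k\<le>n. esym k ys * v k) \<le> 1 / (1 + l * x) * (\<Sum>k\<le>n. esym k (l # ys) * v k) + (\<Sum>k\<in>{..n} \<inter> {..k0}. esym k (l # ys) * v k)"
proof -
  have lys: "set (l # ys) \<subseteq> {0..}" using ys l by simp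
  have lx: "1 + l * x > 0" using l x by (simp add: add_pos_nonneg)
  have nn: "esym k (l # ys) * v k \<ge> 0" for k using esym_nonneg[OF lys] v by simp
  have "esym k ys * v k \<le> 1 / (1 + l * x) * (esym k (l # ys) * v k) + (if k \<le> k0 then esym k (l # ys) * v k else 0)" for k
  proof (cases "k \<le> k0")
    case True
    have "esym k ys \<le> esym k (l # ys)" using esym_nonneg[OF ys] l by (cases k) (auto simp: esym_Cons)
    hence "esym k ys * v k \<le> esym k (l # ys) * v k" using v by (rule mult_right_mono)
    moreover have "1 / (1 + l * x) * (esym k (l # ys) * v k) \<ge> 0" using lx nn by simp
    ultimately show ?thesis using True by simp
  next
    case False
    then obtain j where j: "k = Suc j" "k0 \<le> j" by (cases k) auto
    have "esym j ys \<ge> x * esym (Suc j) ys" using esym_ratio_ge_up[OF ys k0 j(2)] .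
    hence "l * (x * esym k ys) \<le> l * esym j ys" using l j by (intro mult_left_mono) auto
    hence "(1 + l * x) * esym k ys \<le> esym k (l # ys)" using j by (simp add: esym_Cons algebra_simps)
    hence "(1 + l * x) * esym k ys * v k \<le> esym k (l # ys) * v k" using v by (rule mult_right_mono)
    thus ?thesis using False lx by (simp add: field_simps)
  qed
  hence "(\<Sum>k\<le>n. esym k ys * v k) \<le> (\<Sum>k\<le>n. 1 / (1 + l * x) * (esym k (l # ys) * v k) + (if k \<le> k0 then esym k (l # ys) * v k else 0))"
    by (rule sum_mono)
  also have "\<dots> = 1 / (1 + l * x) * (\<Sum>k\<le>n. esym k (l # ys) * v k) + (\<Sum>k\<in>{..n} \<inter> {..k0}. esym k (l # ys) * v k)"
  proof -
    have "(\<Sum>k\<in>{..n} \<inter> {..k0}. esym k (l # ys) * v k) = (\<Sum>k\<le>n. if k \<in> {..k0} then esym k (l # ys) * v k else 0)"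
      by (rule sum.inter_restrict) simp
    thus ?thesis by (simp only: sum.distrib sum_distrib_left atMost_iff)
  qed
  finally show ?thesis .
qed

text \<open>The mirror image: the ratio bound holds below \<open>k1\<close>, and the discarded tail
  consists of the indices from \<open>k1\<close> on.\<close>

lemma kernel_lower_finite:
  assumes ys: "set ys \<subseteq> {0..}" and l: "l \<ge> 0" and x: "x \<ge> 0" and k1: "esym k1 ys \<le> x * esym (Suc k1) ys" "esym (Suc k1) ys > 0"
    and v: "\<And>k. v k \<ge> 0"
  shows "(\<Sum>k\<le>n. esym k ys * v k) \<ge> 1 / (1 + l * x) * (\<Sum>k\<le>n. esym k (l # ys) * v k) - (\<Sum>k\<in>{..n} \<inter> {k1..}. esym k (l # ys) * v k)"
proof -
  have lys: "set (l # ys) \<subseteq> {0..}" using ys l by simp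
  have lx: "1 + l * x \<ge> 1" using l x by simp
  have nn: "esym k (l # ys) * v k \<ge> 0" "esym k ys * v k \<ge> 0" for k using esym_nonneg[OF lys] esym_nonneg[OF ys] v by auto
  have "esym k ys * v k \<ge> 1 / (1 + l * x) * (esym k (l # ys) * v k) - (if k1 \<le> k then esym k (l # ys) * v k else 0)" for k
  proof (cases "k1 \<le> k")
    case True
    have "1 / (1 + l * x) * (esym k (l # ys) * v k) \<le> 1 * (esym k (l # ys) * v k)" using lx nn(1)[of k] by (intro mult_right_mono) auto
    thus ?thesis using True nn(2)[of k] by simp
  next
    case False
    have "esym k (l # ys) \<le> (1 + l * x) * esym k ys"
    proof (cases k)
      case 0 thus ?thesis using lx by simp
    next
      case (Suc j)
      have "esym j ys \<le> x * esym (Suc j) ys" using esym_ratio_le_down[OF ys k1, of j] False Suc by simp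
      hence "l * esym j ys \<le> l * (x * esym k ys)" using l Suc by (intro mult_left_mono) auto
      thus ?thesis using Suc by (simp add: esym_Cons algebra_simps)
    qed
    hence "esym k (l # ys) * v k \<le> (1 + l * x) * esym k ys * v k" using v by (rule mult_right_mono)
    thus ?thesis using False lx by (simp add: field_simps)
  qed
  hence "(\<Sum>k\<le>n. 1 / (1 + l * x) * (esym k (l # ys) * v k) - (if k1 \<le> k then esym k (l # ys) * v k else 0)) \<le> (\<Sum>k\<le>n. esym k ys * v k)"
    by (rule sum_mono)
  moreover have "(\<Sum>k\<le>n. 1 / (1 + l * x) * (esym k (l # ys) * v k) - (if k1 \<le> k then esym k (l # ys) * v k else 0)) =
     1 / (1 + l * x) * (\<Sum>k\<le>n. esym k (l # ys) * v k) - (\<Sum>k\<in>{..n} \<inter> {k1..}. esym k (l # ys) * v k)"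
  proof -
    have "(\<Sum>k\<in>{..n} \<inter> {k1..}. esym k (l # ys) * v k) = (\<Sum>k\<le>n. if k \<in> {k1..} then esym k (l # ys) * v k else 0)"
      by (rule sum.inter_restrict) simp
    thus ?thesis by (simp only: sum_subtractf sum_distrib_left atLeast_iff)
  qed
  ultimately show ?thesis by simp
qed

text \<open>The variance is of order \<open>n\<close> and the squared distance between mean and cut
  of order \<open>n^2\<close>, so Chebyshev's bound tends to 0.\<close>

lemma chebyshev_vanish:
  assumes "(\<lambda>n. m n / real (Suc n)) \<longlonglongrightarrow> t" "(\<lambda>n. k n / real (Suc n)) \<longlonglongrightarrow> t'" "t \<noteq> t'"
  shows "(\<lambda>n. real (Suc n) / (m n - k n)\<^sup>2) \<longlonglongrightarrow> 0"
proof -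
  have "(\<lambda>n. 1 / real (Suc n)) \<longlonglongrightarrow> 0" by real_asymp
  hence "(\<lambda>n. 1 / real (Suc n) / (m n / real (Suc n) - k n / real (Suc n))\<^sup>2) \<longlonglongrightarrow> 0 / (t - t')\<^sup>2"
    using assms(3) by (intro tendsto_intros assms) auto
  moreover have "1 / real (Suc n) / (m n / real (Suc n) - k n / real (Suc n))\<^sup>2 = real (Suc n) / (m n - k n)\<^sup>2" for n
    unfolding diff_divide_distrib[symmetric] power_divide by (simp add: power2_eq_square)
  ultimately show ?thesis by simp
qed

text \<open>One root of \<open>X n\<close> is replaced by \<open>l\<close> and the weights of
  \<open>finite_kernel\<close> are read as measures. One minus their transform is the average of
  \<open>esym k (Y n) / esym k (l # Y n)\<close> over the Bernoulli law of \<open>R n\<close>. This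
  law concentrates where \<open>k / Suc n\<close> is near \<open>t\<close>; there the neighbouring
  ratios of \<open>Y n\<close> are near \<open>a\<close>, so the average is near
  \<open>1 / (1 + l * a)\<close>.\<close>

lemma kernel_exists:
  fixes X B :: "nat \<Rightarrow> real list"
  assumes X: "\<And>n. set (X n) \<subseteq> {0..}" "\<And>n. length (X n) = Suc n" and B: "\<And>n. set (B n) \<subseteq> {0..}" "\<And>n. length (B n) = Suc n"
    and F: "\<And>s. s > 0 \<Longrightarrow> (\<lambda>n. bmean s (X n) / real (Suc n)) \<longlonglongrightarrow> ftr \<mu> s"
    and G: "\<And>s. s > 0 \<Longrightarrow> (\<lambda>n. bmean s (B n) / real (Suc n)) \<longlonglongrightarrow> ftr \<nu> s"
    and mu: "pos_dist \<mu>" "\<mu> \<noteq> return borel 0" and nu: "pos_dist \<nu>" "\<nu> \<noteq> return borel 0" and l: "l > 0"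
  shows "\<exists>\<sigma>. pos_dist \<sigma> \<and> (\<forall>t a b. 0 < t \<longrightarrow> a > 0 \<longrightarrow> b > 0 \<longrightarrow> ftr \<mu> a = t \<longrightarrow> ftr \<nu> b = t \<longrightarrow>
     ftr \<sigma> (a * b * (1 - t) / t) = l * a / (1 + l * a))"
proof -
  interpret T: two_pos_dists \<mu> \<nu> using mu nu by unfold_locales
  \<comment> \<open>\<open>finite_kernel\<close> asks for strictly positive roots; the shift
    provides them and changes normalised means by at most \<open>s / Suc n\<close>.\<close>
  define e where "e n = 1 / real (Suc n)" for n
  have e: "e n > 0" for n by (simp add: e_def)
  define Y where "Y n = map (\<lambda>x. x + e n) (tl (X n))" for n
  define B' where "B' n = map (\<lambda>x. x + e n) (B n)" for n
  have tlX: "set (tl (X n)) \<subseteq> {0..}" "length (tl (X n)) = n" for n using X[of n] list.set_sel(2)[of "X n"] by (cases "X n"; auto)+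
  have Y: "set (Y n) \<subseteq> {0<..}" "length (Y n) = n" for n
    using tlX[of n] e[of n] by (auto simp: Y_def add_nonneg_pos)
  have B': "set (B' n) \<subseteq> {0<..}" "length (B' n) = Suc n" for n
    using B[of n] e[of n] by (auto simp: B'_def add_nonneg_pos)
  have Y0: "set (Y n) \<subseteq> {0..}" "set (l # Y n) \<subseteq> {0..}" and B'0: "set (B' n) \<subseteq> {0..}" for n
    using Y(1)[of n] B'(1)[of n] l by (auto dest!: subsetD)
  have FY: "(\<lambda>n. bmean s (Y n) / real (Suc n)) \<longlonglongrightarrow> ftr \<mu> s" if s: "s > 0" for s
  proof (rule Lim_transform[OF F[OF s]], rule Lim_null_comparison)
    show "eventually (\<lambda>n. norm (bmean s (Y n) / real (Suc n) - bmean s (X n) / real (Suc n)) \<le> (1 + s) / real (Suc n)) sequentially"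
    proof (intro always_eventually allI)
      fix n
      obtain x where x: "X n = x # tl (X n)" "x \<ge> 0" using X[of n] by (cases "X n") auto
      have "bmean s (X n) = s * x / (1 + s * x) + bmean s (tl (X n))" by (subst x(1)) (rule bmean_Cons)
      moreover have "\<bar>bmean s (Y n) - bmean s (tl (X n))\<bar> \<le> real n * (s * e n)"
        unfolding Y_def using bmean_shift[OF tlX(1), of s "e n" n] s e[of n] tlX(2)[of n] by simp
      moreover have "real n * (s * e n) \<le> s" using s by (simp add: e_def field_simps)
      moreover have "0 \<le> s * x / (1 + s * x)" "s * x / (1 + s * x) \<le> 1" using bern_bounds[of s x] s x by auto
      ultimately have "\<bar>bmean s (Y n) - bmean s (X n)\<bar> \<le> 1 + s" by linarith
      hence "\<bar>bmean s (Y n) - bmean s (X n)\<bar> / real (Suc n) \<le> (1 + s) / real (Suc n)" by (rule divide_right_mono) simp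
      thus "norm (bmean s (Y n) / real (Suc n) - bmean s (X n) / real (Suc n)) \<le> (1 + s) / real (Suc n)"
        unfolding diff_divide_distrib[symmetric] by simp
    qed
    show "(\<lambda>n. (1 + s) / real (Suc n)) \<longlonglongrightarrow> 0" by real_asymp
  qed
  have FlY: "(\<lambda>n. bmean s (l # Y n) / real (Suc n)) \<longlonglongrightarrow> ftr \<mu> s" if s: "s > 0" for s
  proof -
    have "(\<lambda>n. s * l / (1 + s * l) / real (Suc n)) \<longlonglongrightarrow> 0" by real_asymp
    from tendsto_add[OF this FY[OF s]] show ?thesis by (simp add: bmean_Cons add_divide_distrib)
  qed
  have GB: "(\<lambda>n. bmean s (B' n) / real (Suc n)) \<longlonglongrightarrow> ftr \<nu> s" if s: "s > 0" for s
  proof (rule Lim_transform[OF G[OF s]], rule Lim_null_comparison)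
    show "eventually (\<lambda>n. norm (bmean s (B' n) / real (Suc n) - bmean s (B n) / real (Suc n)) \<le> s / real (Suc n)) sequentially"
    proof (intro always_eventually allI)
      fix n
      have "\<bar>bmean s (B' n) - bmean s (B n)\<bar> \<le> real (Suc n) * (s * e n)"
        unfolding B'_def using bmean_shift[OF B(1), of s "e n" n] s e[of n] B(2)[of n] by simp
      moreover have "real (Suc n) * (s * e n) = s" by (simp add: e_def)
      ultimately have "\<bar>bmean s (B' n) - bmean s (B n)\<bar> \<le> s" by linarith
      hence "\<bar>bmean s (B' n) - bmean s (B n)\<bar> / real (Suc n) \<le> s / real (Suc n)" by (rule divide_right_mono) simp
      thus "norm (bmean s (B' n) / real (Suc n) - bmean s (B n) / real (Suc n)) \<le> s / real (Suc n)"
        unfolding diff_divide_distrib[symmetric] by simp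
    qed
    show "(\<lambda>n. s / real (Suc n)) \<longlonglongrightarrow> 0" by real_asymp
  qed
  have "\<exists>rs. length rs = Suc n \<and> set rs \<subseteq> {0..} \<and> szego_op (B' n) (\<Prod>a\<leftarrow>l # Y n. [:- a, 1:]) = (\<Prod>a\<leftarrow>rs. [:- a, 1:]) \<and>
     (\<forall>k. esym k rs = esym k (l # Y n) * esym k (B' n) / real (Suc n choose k))" for n
    using szego_op_real_rooted[OF Y0(2) B'0, of n n] B'(2)[of n] Y(2)[of n] by (metis length_Cons)
  then obtain R where R: "\<And>n. length (R n) = Suc n" "\<And>n. set (R n) \<subseteq> {0..}"
    "\<And>n. szego_op (B' n) (\<Prod>a\<leftarrow>l # Y n. [:- a, 1:]) = (\<Prod>a\<leftarrow>R n. [:- a, 1:])"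
    "\<And>n k. esym k (R n) = esym k (l # Y n) * esym k (B' n) / real (Suc n choose k)" by metis
  \<comment> \<open>A bounded change of the means leaves their normalised limits intact, so the
    perturbed polynomials still converge to the free convolution of \<open>\<mu>\<close> and
    \<open>\<nu>\<close>.\<close>
  interpret C: dist_convolution "\<lambda>n. l # Y n" B' R \<mu> \<nu>
    using Y0 B'0 R FlY GB mu nu by unfold_locales
  define \<rho> where "\<rho> = free_mult_conv \<mu> \<nu>"
  have Sr: "S_mult_rel \<mu> \<nu> \<rho>" and rho: "pos_dist \<rho>" and wc: "weak_conv_m (\<lambda>n. rmeas (R n)) \<rho>"
    using C.weak_conv_R mu(2) nu(2) by (auto simp: \<rho>_def)
  have H: "(\<lambda>n. bmean s (R n) / real (Suc n)) \<longlonglongrightarrow> ftr \<rho> s" if s: "s > 0" for s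
    using weak_conv_imp_ftr[OF pos_distD[OF C.pos_R] pos_distD[OF rho] wc, of s] s by (simp add: C.ftr_R)
  define PW where "PW n w \<longleftrightarrow> (\<forall>\<gamma>\<in>set (R n). w \<gamma> \<ge> 0) \<and> (\<Sum>\<gamma>\<in>set (R n). w \<gamma>) = (1::real) \<and>
    (\<forall>s>0. (\<Sum>\<gamma>\<in>set (R n). w \<gamma> / (1 + s * \<gamma>)) * btot s (R n)
        = (\<Sum>k\<le>Suc n. esym k (Y n) * esym k (B' n) / real (Suc n choose k) * s ^ k))" for n w
  have "\<exists>w. PW n w" for n
  proof -
    have len: "length (B' n) = Suc (length (Y n))" "length (R n) = length (B' n)" using B'(2)[of n] Y(2)[of n] R(1)[of n] by auto
    obtain w where "\<And>\<gamma>. \<gamma> \<in> set (R n) \<Longrightarrow> w \<gamma> \<ge> 0" "(\<Sum>\<gamma>\<in>set (R n). w \<gamma>) = (1::real)"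
      "\<And>s. s > 0 \<Longrightarrow> (\<Sum>\<gamma>\<in>set (R n). w \<gamma> / (1 + s * \<gamma>)) * btot s (R n)
        = (\<Sum>k\<le>length (B' n). esym k (Y n) * esym k (B' n) / real (length (B' n) choose k) * s ^ k)"
      by (rule finite_kernel[OF l Y(1) B'(1) len(1) R(3) R(2) len(2)]) blast
    hence "PW n w" unfolding PW_def B'(2) by blast
    thus ?thesis by blast
  qed
  then obtain w where "\<And>n. PW n (w n)" by metis
  hence w: "\<And>n \<gamma>. \<gamma> \<in> set (R n) \<Longrightarrow> w n \<gamma> \<ge> 0" "\<And>n. (\<Sum>\<gamma>\<in>set (R n). w n \<gamma>) = (1::real)"
    "\<And>n s. s > 0 \<Longrightarrow> (\<Sum>\<gamma>\<in>set (R n). w n \<gamma> / (1 + s * \<gamma>)) * btot s (R n)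
        = (\<Sum>k\<le>Suc n. esym k (Y n) * esym k (B' n) / real (Suc n choose k) * s ^ k)" unfolding PW_def by blast+
  define PS where "PS n \<sigma> \<longleftrightarrow> pos_dist \<sigma> \<and> (\<forall>f\<in>borel_measurable borel. (\<integral>x. f x \<partial>\<sigma>) = (\<Sum>x\<in>set (R n). w n x * (f x :: real)))" for n \<sigma>
  have "\<exists>\<sigma>. PS n \<sigma>" for n
  proof -
    obtain \<sigma> where "pos_dist \<sigma>" "\<And>f. f \<in> borel_measurable borel \<Longrightarrow> (\<integral>x. f x \<partial>\<sigma>) = (\<Sum>x\<in>set (R n). w n x * (f x :: real))"
      by (rule weighted_dist[OF finite_set R(2) w(1) w(2)]) blast+
    thus ?thesis unfolding PS_def by blast
  qed
  then obtain \<sigma> where "\<And>n. PS n (\<sigma> n)" by metis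
  hence sig: "\<And>n. pos_dist (\<sigma> n)"
    "\<And>n f. f \<in> borel_measurable borel \<Longrightarrow> (\<integral>x. f x \<partial>\<sigma> n) = (\<Sum>x\<in>set (R n). w n x * (f x :: real))" unfolding PS_def by blast+
  define A where "A s n = (\<Sum>\<gamma>\<in>set (R n). w n \<gamma> / (1 + s * \<gamma>))" for s n
  have ftrA: "ftr (\<sigma> n) s = 1 - A s n" if s: "s > 0" for n s
  proof -
    have "ftr (\<sigma> n) s = (\<Sum>x\<in>set (R n). w n x * gker s x)" unfolding ftr_def by (rule sig(2)) simp
    also have "\<dots> = (\<Sum>x\<in>set (R n). w n x - w n x / (1 + s * x))"
    proof (intro sum.cong refl)
      fix x assume "x \<in> set (R n)"
      hence x: "x \<ge> 0" using R(2)[of n] by auto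
      hence "1 + s * x > 0" using s by (simp add: add_pos_nonneg)
      thus "w n x * gker s x = w n x - w n x / (1 + s * x)" using x by (simp add: gker_def max_def field_simps)
    qed
    finally show ?thesis by (simp add: sum_subtractf w(2) A_def)
  qed
  have key: "(\<lambda>n. A (a * b * (1 - t) / t) n) \<longlonglongrightarrow> 1 / (1 + l * a)"
    if t: "0 < t" and ab: "a > 0" "b > 0" "ftr \<mu> a = t" "ftr \<nu> b = t" for t a b
  proof -
    have t1: "t < 1" using T.less_tmax[of a b t] ab T.tmax by simp
    define c where "c = a * b * (1 - t) / t"
    have c: "c > 0" using t t1 ab by (simp add: c_def)
    have "ftr \<rho> c = t" using Sr t ab by (auto simp: S_mult_rel_def c_def)
    hence Hc: "(\<lambda>n. bmean c (R n) / real (Suc n)) \<longlonglongrightarrow> t" using H[OF c] by simp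
    define v where "v n k = esym k (B' n) / real (Suc n choose k) * c ^ k" for n k
    have v0: "v n k \<ge> 0" for n k unfolding v_def using esym_nonneg[OF B'0] c by simp
    have vR: "esym k (l # Y n) * v n k = esym k (R n) * c ^ k" for n k by (simp add: v_def R(4))
    have Z: "btot c (R n) > 0" for n using btot_pos[OF R(2)] c by simp
    have vZ: "(\<Sum>k\<le>Suc n. esym k (l # Y n) * v n k) = btot c (R n)" for n
      unfolding vR using esym_sum[of "R n" c] R(1)[of n] by simp
    have vZ': "(\<Sum>k\<le>Suc n. esym k (R n) * c ^ k) = btot c (R n)" for n using vZ[of n] unfolding vR .
    have AZ: "A c n * btot c (R n) = (\<Sum>k\<le>Suc n. esym k (Y n) * v n k)" for n
      unfolding A_def w(3)[OF c] by (intro sum.cong) (auto simp: v_def)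
    have up: "eventually (\<lambda>n. A c n < L) sequentially" if L: "L > 1 / (1 + l * a)" for L
    proof -
      have "((\<lambda>x. 1 / (1 + l * x)) \<longlongrightarrow> 1 / (1 + l * a)) (at_left a)"
        using l ab by (intro tendsto_intros) (auto simp: add_pos_pos less_imp_neq[symmetric])
      hence "eventually (\<lambda>x. 1 / (1 + l * x) < L) (at_left a)" using L by (rule order_tendstoD)
      hence "eventually (\<lambda>x. 1 / (1 + l * x) < L \<and> x \<in> {0<..<a}) (at_left a)"
        using eventually_at_left_real[OF ab(1)] by (rule eventually_conj)
      then obtain x where x: "1 / (1 + l * x) < L" "0 < x" "x < a"
        using eventually_happens'[OF trivial_limit_at_left_real] by fastforce
      define a1 where "a1 = (x + a) / 2"
      define \<theta> where "\<theta> = x / a1"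
      have a1: "a1 > 0" "a1 < a" "x < a1" using x by (auto simp: a1_def)
      have th: "0 < \<theta>" "\<theta> < 1" "\<theta> * a1 = x" using a1 x by (auto simp: \<theta>_def)
      have "ftr \<mu> a1 < t" using ftr_strict_mono[OF mu, of a1 a] a1 ab by simp
      moreover have "0 \<le> ftr \<mu> a1" using a1 by (intro ftr_bounds pos_distD[OF mu(1)]) auto
      \<comment> \<open>The cut \<open>k n\<close> is placed at density \<open>t'\<close> below the
        concentration point \<open>t\<close>, yet above \<open>ftr \<mu> a1\<close>, so that from
        there on the ratios of \<open>Y n\<close> are eventually at least \<open>x\<close>.\<close>
      ultimately obtain t' where t': "ftr \<mu> a1 < t'" "t' < t" "0 \<le> t'" using dense by (meson less_imp_le order_le_less_trans)
      define k where "k n = nat \<lfloor>t' * real (Suc n)\<rfloor>" for n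
      have k: "(\<lambda>n. real (k n) / real (Suc n)) \<longlonglongrightarrow> t'" unfolding k_def by (rule floor_ratio_tendsto[OF t'(3)])
      have 1: "eventually (\<lambda>n. esym (k n) (Y n) \<ge> \<theta> * a1 * esym (Suc (k n)) (Y n)) sequentially"
        by (rule esym_ratio_eventually_ge[OF Y0(1) FY[OF a1(1)] t'(1) k a1(1) th(1,2)])
      have "(\<lambda>n. bmean c (R n) / real (Suc n) - real (k n) / real (Suc n)) \<longlonglongrightarrow> t - t'" by (intro tendsto_intros Hc k)
      hence 2: "eventually (\<lambda>n. bmean c (R n) / real (Suc n) - real (k n) / real (Suc n) > 0) sequentially"
        using t' by (intro order_tendstoD) auto
      have "(\<lambda>n. 1 / (1 + l * x) + real (Suc n) / (bmean c (R n) - real (k n))\<^sup>2) \<longlonglongrightarrow> 1 / (1 + l * x) + 0"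
        using t' by (intro tendsto_intros chebyshev_vanish[OF Hc k]) auto
      hence 3: "eventually (\<lambda>n. 1 / (1 + l * x) + real (Suc n) / (bmean c (R n) - real (k n))\<^sup>2 < L) sequentially"
        using x by (intro order_tendstoD) auto
      show ?thesis using 1 2 3
      proof eventually_elim
        case (elim n)
        have "bmean c (R n) / real (Suc n) > real (k n) / real (Suc n)" using elim(2) by simp
        hence mk: "bmean c (R n) > real (k n)" by (simp only: divide_less_cancel)
        have "(\<Sum>j\<le>Suc n. esym j (Y n) * v n j) \<le> 1 / (1 + l * x) * (\<Sum>j\<le>Suc n. esym j (l # Y n) * v n j)
            + (\<Sum>j\<in>{..Suc n} \<inter> {..k n}. esym j (l # Y n) * v n j)"
          using elim(1) l x v0 unfolding th(3) by (intro kernel_upper_finite[OF Y0(1)]) auto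
        hence "A c n * btot c (R n) \<le> 1 / (1 + l * x) * btot c (R n) + (\<Sum>j\<in>{..Suc n} \<inter> {..k n}. esym j (R n) * c ^ j)"
          by (simp only: AZ vR vZ')
        also have "(\<Sum>j\<in>{..Suc n} \<inter> {..k n}. esym j (R n) * c ^ j) \<le> btot c (R n) * (real (length (R n)) / (bmean c (R n) - real (k n))\<^sup>2)"
          using c mk R(1)[of n] by (intro esym_tail[OF R(2)]) auto
        finally have "A c n * btot c (R n) \<le> (1 / (1 + l * x) + real (Suc n) / (bmean c (R n) - real (k n))\<^sup>2) * btot c (R n)"
          using R(1)[of n] by (simp only: distrib_right) (simp add: mult.commute)
        hence "A c n \<le> 1 / (1 + l * x) + real (Suc n) / (bmean c (R n) - real (k n))\<^sup>2"
          using Z by (simp only: mult_le_cancel_right_pos)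
        thus ?case using elim(3) by simp
      qed
    qed
    have low: "eventually (\<lambda>n. A c n > L) sequentially" if L: "L < 1 / (1 + l * a)" for L
    proof -
      have "((\<lambda>x. 1 / (1 + l * x)) \<longlongrightarrow> 1 / (1 + l * a)) (at_right a)"
        using l ab by (intro tendsto_intros) (auto simp: add_pos_pos less_imp_neq[symmetric])
      hence "eventually (\<lambda>x. 1 / (1 + l * x) > L) (at_right a)" using L by (rule order_tendstoD)
      hence "eventually (\<lambda>x. 1 / (1 + l * x) > L \<and> x > a) (at_right a)"
        using eventually_at_right_less by (rule eventually_conj)
      then obtain x where x: "1 / (1 + l * x) > L" "a < x"
        using eventually_happens'[OF trivial_limit_at_right_real] by fastforce
      define a2 where "a2 = (x + a) / 2"
      define \<theta> where "\<theta> = a2 / x"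
      have a2: "a2 > 0" "a < a2" "a2 < x" "x > 0" using x ab by (auto simp: a2_def)
      have th: "0 < \<theta>" "\<theta> < 1" "a2 = \<theta> * x" using a2 by (auto simp: \<theta>_def)
      have "ftr \<mu> a2 > t" using ftr_strict_mono[OF mu, of a a2] a2 ab by simp
      \<comment> \<open>For the lower bound the cut lies on the other side of
        \<open>t\<close>.\<close>
      then obtain t' where t': "ftr \<mu> a2 > t'" "t' > t" using dense by blast
      have t'0: "0 \<le> t'" using t t' by simp
      define k where "k n = nat \<lfloor>t' * real (Suc n)\<rfloor>" for n
      have k: "(\<lambda>n. real (k n) / real (Suc n)) \<longlonglongrightarrow> t'" unfolding k_def by (rule floor_ratio_tendsto[OF t'0])
      have 1: "eventually (\<lambda>n. \<theta> * esym (k n) (Y n) < a2 * esym (Suc (k n)) (Y n)) sequentially"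
        by (rule esym_ratio_eventually_less[OF Y0(1) FY[OF a2(1)] t'(1) k a2(1) th(1,2)])
      have "(\<lambda>n. bmean c (R n) / real (Suc n) - real (k n) / real (Suc n)) \<longlonglongrightarrow> t - t'" by (intro tendsto_intros Hc k)
      hence 2: "eventually (\<lambda>n. bmean c (R n) / real (Suc n) - real (k n) / real (Suc n) < 0) sequentially"
        using t' by (intro order_tendstoD) auto
      have "(\<lambda>n. 1 / (1 + l * x) - real (Suc n) / (bmean c (R n) - real (k n))\<^sup>2) \<longlonglongrightarrow> 1 / (1 + l * x) - 0"
        using t' by (intro tendsto_intros chebyshev_vanish[OF Hc k]) auto
      hence 3: "eventually (\<lambda>n. 1 / (1 + l * x) - real (Suc n) / (bmean c (R n) - real (k n))\<^sup>2 > L) sequentially"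
        using x by (intro order_tendstoD) auto
      show ?thesis using 1 2 3
      proof eventually_elim
        case (elim n)
        have "bmean c (R n) / real (Suc n) < real (k n) / real (Suc n)" using elim(2) by simp
        hence mk: "bmean c (R n) < real (k n)" by (simp only: divide_less_cancel)
        have lt: "\<theta> * esym (k n) (Y n) < \<theta> * (x * esym (Suc (k n)) (Y n))" using elim(1) unfolding th(3) by (simp only: mult.assoc)
        hence e1: "esym (k n) (Y n) < x * esym (Suc (k n)) (Y n)" using th(1) by (simp only: mult_less_cancel_left_pos)
        hence "x * esym (Suc (k n)) (Y n) > 0" using esym_nonneg[OF Y0(1), of "k n" n] by linarith
        hence e2: "esym (Suc (k n)) (Y n) > 0" using a2 by (simp add: zero_less_mult_iff)
        have "btot c (R n) * (real (length (R n)) / (real (k n) - bmean c (R n))\<^sup>2) \<ge> (\<Sum>j\<in>{..Suc n} \<inter> {k n..}. esym j (R n) * c ^ j)"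
          using c mk R(1)[of n] by (intro esym_tail[OF R(2)]) auto
        moreover have "1 / (1 + l * x) * (\<Sum>j\<le>Suc n. esym j (l # Y n) * v n j)
            - (\<Sum>j\<in>{..Suc n} \<inter> {k n..}. esym j (l # Y n) * v n j) \<le> (\<Sum>j\<le>Suc n. esym j (Y n) * v n j)"
          using e1 e2 l a2 v0 by (intro kernel_lower_finite[OF Y0(1)]) auto
        hence "A c n * btot c (R n) \<ge> 1 / (1 + l * x) * btot c (R n) - (\<Sum>j\<in>{..Suc n} \<inter> {k n..}. esym j (R n) * c ^ j)"
          by (simp only: AZ vR vZ')
        ultimately have "A c n * btot c (R n) \<ge> 1 / (1 + l * x) * btot c (R n) - btot c (R n) * (real (Suc n) / (bmean c (R n) - real (k n))\<^sup>2)"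
          using R(1)[of n] by (simp add: power2_commute)
        hence "A c n * btot c (R n) \<ge> (1 / (1 + l * x) - real (Suc n) / (bmean c (R n) - real (k n))\<^sup>2) * btot c (R n)"
          by (simp only: left_diff_distrib) (simp only: mult.commute)
        hence "A c n \<ge> 1 / (1 + l * x) - real (Suc n) / (bmean c (R n) - real (k n))\<^sup>2"
          using Z by (simp only: mult_le_cancel_right_pos)
        thus ?case using elim(3) by simp
      qed
    qed
    show ?thesis unfolding c_def[symmetric] by (rule order_tendstoI) (use up low in auto)
  qed
  have lim: "(\<lambda>n. ftr (\<sigma> n) (a * b * (1 - t) / t)) \<longlonglongrightarrow> l * a / (1 + l * a)"
    if t: "0 < t" and ab: "a > 0" "b > 0" "ftr \<mu> a = t" "ftr \<nu> b = t" for t a b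
  proof -
    have t1: "t < 1" using T.less_tmax[of a b t] ab T.tmax by simp
    have c: "a * b * (1 - t) / t > 0" using t t1 ab by simp
    have "1 + l * a > 0" using l ab by (simp add: add_pos_pos)
    hence "1 - 1 / (1 + l * a) = l * a / (1 + l * a)" by (simp add: field_simps)
    thus ?thesis unfolding ftrA[OF c] using tendsto_diff[OF tendsto_const[of 1] key[OF t ab]] by simp
  qed
  have "tight \<sigma>"
  proof (rule pos_tight[OF sig(1)])
    fix \<epsilon> :: real assume eps: "\<epsilon> > 0"
    obtain a0 where a0: "a0 > 0" "ftr \<mu> a0 < T.tmax" using ftr_small[OF pos_distD[OF mu(1)] T.tmax(1)] by blast
    \<comment> \<open>Small \<open>a\<close> makes the limit \<open>l * a / (1 + l * a)\<close> less
      than \<open>\<epsilon>\<close>, and \<open>a \<le> a0\<close> keeps \<open>ftr \<mu> a\<close>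
      in the common range, so that a matching \<open>b\<close> exists.\<close>
    define a where "a = min a0 (\<epsilon> / (2 * l))"
    have a: "a > 0" "l * a < \<epsilon>" using a0 eps l by (auto simp: a_def min_def field_simps)
    define t where "t = ftr \<mu> a"
    have "ftr \<mu> a \<le> ftr \<mu> a0" using a by (intro ftr_mono pos_distD[OF mu(1)]) (auto simp: a_def)
    hence t: "0 < t" "t < T.tmax" using a0 ftr_pos[OF mu a(1)] by (auto simp: t_def)
    obtain b where b: "b > 0" "ftr \<nu> b = t" using T.preimages[OF t] by metis
    have "t < 1" using t T.tmax by simp
    hence c: "a * b * (1 - t) / t > 0" using t a b by simp
    have "l * a / (1 + l * a) \<le> l * a / 1" using l a by (intro divide_left_mono) (auto simp: add_pos_pos)
    hence "l * a / (1 + l * a) < \<epsilon>" using a by simp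
    hence "eventually (\<lambda>n. ftr (\<sigma> n) (a * b * (1 - t) / t) < \<epsilon>) sequentially"
      using lim[OF t(1) a(1) b(1) t_def[symmetric] b(2)] by (intro order_tendstoD) auto
    thus "\<exists>s>0. eventually (\<lambda>n. ftr (\<sigma> n) s \<le> \<epsilon>) sequentially"
      using c by (intro exI[of _ "a * b * (1 - t) / t"]) (auto elim: eventually_mono)
  qed
  then obtain r \<tau> where r: "strict_mono (r :: nat \<Rightarrow> nat)" "real_distribution \<tau>" "weak_conv_m (\<sigma> \<circ> id \<circ> r) \<tau>"
    using tight_imp_convergent_subsubsequence[of \<sigma> id] by (auto simp: strict_mono_id)
  have pr: "pos_dist ((\<sigma> \<circ> id \<circ> r) n)" for n using sig(1) by simp
  have "pos_dist \<tau>" by (rule weak_conv_pos_dist[OF pr r(2,3)])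
  moreover have "ftr \<tau> (a * b * (1 - t) / t) = l * a / (1 + l * a)"
    if t: "0 < t" and ab: "a > 0" "b > 0" "ftr \<mu> a = t" "ftr \<nu> b = t" for t a b
  proof -
    have t1: "t < 1" using T.less_tmax[of a b t] ab T.tmax by simp
    have c: "a * b * (1 - t) / t \<ge> 0" using t t1 ab by simp
    show ?thesis
    proof (rule LIMSEQ_unique)
      show "(\<lambda>n. ftr ((\<sigma> \<circ> id \<circ> r) n) (a * b * (1 - t) / t)) \<longlonglongrightarrow> ftr \<tau> (a * b * (1 - t) / t)"
        by (rule weak_conv_imp_ftr[OF pos_distD[OF pr] r(2,3) c])
      show "(\<lambda>n. ftr ((\<sigma> \<circ> id \<circ> r) n) (a * b * (1 - t) / t)) \<longlonglongrightarrow> l * a / (1 + l * a)"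
        using LIMSEQ_subseq_LIMSEQ[OF lim[OF t ab] r(1)] by (simp add: o_def)
    qed
  qed
  ultimately show ?thesis by blast
qed

subsection \<open>Analytic continuation to the slit plane\<close>

text \<open>This continues \<open>1 - ftr M\<close> from the positive axis to the plane slit along
  the nonpositive reals, with the same truncation at 0.\<close>

definition Ntr :: "real measure \<Rightarrow> complex \<Rightarrow> complex" where
  "Ntr M y = (\<integral>t. 1 / (1 + y * of_real (max 0 t)) \<partial>M)"

definition slit :: "complex set" where "slit = - \<real>\<^sub>\<le>\<^sub>0"

lemma open_slit: "open slit" by (simp add: slit_def open_Compl)

lemma connected_slit: "connected slit"
proof -
  have "slit = - (complex_of_real ` {..0})" by (auto simp: slit_def nonpos_Reals_def)
  thus ?thesis using starlike_slotted_complex_plane_left[of 0] starlike_imp_connected by metis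
qed

lemma slit_iff: "y \<in> slit \<longleftrightarrow> Im y \<noteq> 0 \<or> Re y > 0"
  by (auto simp: slit_def complex_nonpos_Reals_iff)

text \<open>\<open>1 + y * t\<close> stays away from 0 uniformly in \<open>t \<ge> 0\<close>: for
  positive \<open>y\<close> its real part is at least 1, and for nonreal \<open>y\<close>
  multiplication by \<open>cnj y\<close> exposes an imaginary part independent of \<open>t\<close>.
  Solving for \<open>t / (1 + y * t)\<close> gives the second bound.\<close>

lemma slit_kernel_bound:
  assumes "y \<in> slit"
  obtains K where "K > 0" "\<And>t. cmod (1 / (1 + y * of_real (max 0 t))) \<le> K"
    "\<And>t. 1 + y * of_real (max 0 t) \<noteq> 0" "\<And>t. cmod (of_real (max 0 t) / (1 + y * of_real (max 0 t))) \<le> K"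
proof -
  have y0: "y \<noteq> 0" using assms by (auto simp: slit_iff)
  have "\<exists>k>0. \<forall>t\<ge>0. cmod (1 + y * of_real t) \<ge> k"
  proof (cases "Im y = 0")
    case True
    hence "Re y > 0" using assms by (simp add: slit_iff)
    have "cmod (1 + y * of_real t) \<ge> 1" if "t \<ge> 0" for t
    proof -
      have "1 \<le> Re (1 + y * of_real t)" using \<open>Re y > 0\<close> that by simp
      also have "\<dots> \<le> cmod (1 + y * of_real t)" by (rule complex_Re_le_cmod)
      finally show ?thesis .
    qed
    thus ?thesis by (intro exI[of _ 1]) auto
  next
    case False
    have "cmod (1 + y * of_real t) \<ge> \<bar>Im y\<bar> / cmod y" for t
    proof -
      have "Im ((1 + y * of_real t) * cnj y) = - Im y" by (simp add: algebra_simps)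
      hence "\<bar>Im y\<bar> \<le> cmod ((1 + y * of_real t) * cnj y)" by (metis abs_Im_le_cmod abs_minus_cancel)
      hence "\<bar>Im y\<bar> \<le> cmod (1 + y * of_real t) * cmod y" by (simp only: norm_mult complex_mod_cnj)
      thus ?thesis using y0 by (simp add: pos_divide_le_eq)
    qed
    thus ?thesis using False y0 by (intro exI[of _ "\<bar>Im y\<bar> / cmod y"]) auto
  qed
  then obtain k where k: "k > 0" "\<And>t. t \<ge> 0 \<Longrightarrow> cmod (1 + y * of_real t) \<ge> k" by blast
  have nz: "1 + y * of_real (max 0 t) \<noteq> 0" for t using k(2)[of "max 0 t"] k(1) by auto
  have b1: "cmod (1 / (1 + y * of_real (max 0 t))) \<le> 1 / k" for t
    unfolding norm_divide using k(1) k(2)[of "max 0 t"] by (simp add: frac_le)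
  have b2: "cmod (of_real (max 0 t) / (1 + y * of_real (max 0 t))) \<le> (1 + 1 / k) / cmod y" for t
  proof -
    have "of_real (max 0 t) / (1 + y * of_real (max 0 t)) = (1 - 1 / (1 + y * of_real (max 0 t))) / y"
      using nz[of t] y0 by (simp add: divide_simps)
    hence "cmod (of_real (max 0 t) / (1 + y * of_real (max 0 t))) = cmod (1 - 1 / (1 + y * of_real (max 0 t))) / cmod y"
      by (simp only: norm_divide)
    also have "\<dots> \<le> (cmod 1 + cmod (1 / (1 + y * of_real (max 0 t)))) / cmod y"
      by (intro divide_right_mono norm_triangle_ineq4) auto
    also have "\<dots> \<le> (1 + 1 / k) / cmod y" using b1[of t] by (intro divide_right_mono) auto
    finally show ?thesis .
  qed
  show ?thesis
  proof (rule that[of "max (1 / k) ((1 + 1 / k) / cmod y)"])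
    show "0 < max (1 / k) ((1 + 1 / k) / cmod y)" using k(1) by (simp add: less_max_iff_disj)
  qed (use b1 b2 nz in \<open>auto intro: le_max_iff_disj[THEN iffD2]\<close>)
qed

lemma kernel_measurable [measurable]:
  "(\<lambda>t. 1 / (1 + y * complex_of_real (max 0 t))) \<in> borel_measurable borel"
  by measurable

lemma integrable_kernel:
  assumes "real_distribution M" "y \<in> slit" shows "integrable M (\<lambda>t. 1 / (1 + y * of_real (max 0 t)))"
proof -
  interpret real_distribution M by fact
  obtain K where "\<And>t. cmod (1 / (1 + y * of_real (max 0 t))) \<le> K" using slit_kernel_bound[OF assms(2)] by metis
  thus ?thesis by (intro integrable_const_bound[of _ K]) auto
qed

lemma Ntr_of_real:
  assumes "real_distribution M" "s > 0" shows "Ntr M (of_real s) = of_real (1 - ftr M s)"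
proof -
  interpret real_distribution M by fact
  have "1 / (1 + complex_of_real s * of_real (max 0 t)) = of_real (1 - gker s t)" for t
  proof -
    have "1 + s * max 0 t > 0" using assms(2) by (intro add_pos_nonneg) auto
    hence "1 - gker s t = 1 / (1 + s * max 0 t)" by (simp add: gker_def field_simps)
    thus ?thesis by simp
  qed
  hence "Ntr M (of_real s) = (\<integral>t. complex_of_real (1 - gker s t) \<partial>M)" by (simp only: Ntr_def)
  also have "\<dots> = of_real (\<integral>t. 1 - gker s t \<partial>M)" by (rule integral_complex_of_real)
  also have "(\<integral>t. 1 - gker s t \<partial>M) = 1 - ftr M s" using integrable_gker[of s] assms(2) by (simp add: ftr_def measure_UNIV_eq_1)
  finally show ?thesis .
qed

text \<open>The pointwise difference quotient misses its limit by
  \<open>h * q\<^sup>2 / (u * (1 + h * q))\<close> with \<open>q = m t / u\<close>. For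
  \<open>cmod h\<close> below \<open>1 / (2 * K)\<close> this is at most a constant times
  \<open>cmod h\<close>, uniformly in \<open>t\<close>, so the error survives integration.\<close>

lemma Ntr_has_derivative:
  assumes M: "real_distribution M" and y: "y \<in> slit"
  shows "\<exists>D. (Ntr M has_field_derivative D) (at y)"
proof -
  interpret real_distribution M by fact
  define m where "m t = complex_of_real (max 0 t)" for t
  obtain K where K: "K > 0" "\<And>t. cmod (1 / (1 + y * m t)) \<le> K" "\<And>t. 1 + y * m t \<noteq> 0" "\<And>t. cmod (m t / (1 + y * m t)) \<le> K"
    using slit_kernel_bound[OF y] unfolding m_def by metis
  obtain d where d: "d > 0" "\<And>z. dist z y < d \<Longrightarrow> z \<in> slit" using open_slit y by (auto simp: open_dist)
  have [measurable]: "m \<in> borel_measurable borel" unfolding m_def by measurable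
  define g where "g t = - m t / (1 + y * m t)\<^sup>2" for t
  have gi: "integrable M g"
  proof (rule integrable_const_bound[of _ "K * K"])
    have "cmod (g t) \<le> K * K" for t
    proof -
      have "g t = - (m t / (1 + y * m t)) * (1 / (1 + y * m t))" by (simp add: g_def power2_eq_square)
      hence "cmod (g t) = cmod (m t / (1 + y * m t)) * cmod (1 / (1 + y * m t))" by (simp only: norm_mult norm_minus_cancel)
      also have "\<dots> \<le> K * K" using K by (intro mult_mono) (auto simp: less_imp_le)
      finally show ?thesis .
    qed
    thus "AE t in M. cmod (g t) \<le> K * K" by simp
    show "g \<in> borel_measurable M" unfolding g_def by measurable
  qed
  define D where "D = (\<integral>t. g t \<partial>M)"
  have "((\<lambda>h. (Ntr M (y + h) - Ntr M y) / h) \<longlongrightarrow> D) (at 0)"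
  proof (rule LIM_zero_cancel, rule Lim_null_comparison)
    show "((\<lambda>h. (2 * K * K * K) * cmod h) \<longlongrightarrow> 0) (at 0)" by (auto intro!: tendsto_eq_intros)
    have "eventually (\<lambda>h. h \<noteq> 0 \<and> cmod h < d \<and> cmod h < 1 / (2 * K)) (at (0::complex))"
      unfolding eventually_at using d(1) K(1) by (intro exI[of _ "min d (1 / (2 * K))"]) auto
    thus "eventually (\<lambda>h. cmod ((Ntr M (y + h) - Ntr M y) / h - D) \<le> (2 * K * K * K) * cmod h) (at 0)"
    proof eventually_elim
      case (elim h)
      have yh: "y + h \<in> slit" using d(2)[of "y + h"] elim by (simp add: dist_norm)
      have i1: "integrable M (\<lambda>t. 1 / (1 + (y + h) * m t))" using integrable_kernel[OF M yh] by (simp add: m_def)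
      have i2: "integrable M (\<lambda>t. 1 / (1 + y * m t))" using integrable_kernel[OF M y] by (simp add: m_def)
      have pt: "cmod ((1 / (1 + (y + h) * m t) - 1 / (1 + y * m t)) / h - g t) \<le> (2 * K * K * K) * cmod h" for t
      proof -
        define u where "u = 1 + y * m t"
        define q where "q = m t / u"
        have u: "u \<noteq> 0" "cmod (1 / u) \<le> K" "cmod q \<le> K" using K(2-4)[of t] by (auto simp: u_def q_def)
        have "cmod (h * q) \<le> (1 / (2 * K)) * K" unfolding norm_mult using u elim K(1) by (intro mult_mono) auto
        hence hq: "cmod (h * q) \<le> 1 / 2" using K(1) by simp
        have "1 - cmod (h * q) \<le> cmod (1 + h * q)" using norm_triangle_ineq2[of 1 "- (h * q)"] by simp
        hence v: "cmod (1 + h * q) \<ge> 1 / 2" using hq by linarith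
        hence v0: "1 + h * q \<noteq> 0" by auto
        have m: "m t = q * u" using u by (simp add: q_def)
        have "1 + (y + h) * m t = u + h * m t" by (simp add: u_def algebra_simps)
        also have "\<dots> = u * (1 + h * q)" unfolding m by (simp add: algebra_simps)
        finally have e1: "1 + (y + h) * m t = u * (1 + h * q)" .
        have e2: "g t = - (q * u) / u\<^sup>2" unfolding g_def u_def[symmetric] by (simp only: m)
        have "(1 / (1 + (y + h) * m t) - 1 / (1 + y * m t)) / h - g t = (1 / (u * (1 + h * q)) - 1 / u) / h - - (q * u) / u\<^sup>2"
          unfolding e1 e2 u_def[symmetric] ..
        also have "\<dots> = h * q * q * (1 / u) * (1 / (1 + h * q))"
          using u(1) v0 elim by (simp add: divide_simps power2_eq_square) (simp add: algebra_simps)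
        also have "cmod \<dots> = cmod h * (cmod q * cmod q * cmod (1 / u) * (1 / cmod (1 + h * q)))"
          by (simp add: norm_mult norm_divide)
        also have "\<dots> \<le> cmod h * (K * K * K * 2)"
        proof (intro mult_left_mono mult_mono)
          show "1 / cmod (1 + h * q) \<le> 2" using v by (simp add: divide_le_eq)
        qed (use u K(1) in auto)
        finally show ?thesis by (simp add: mult_ac)
      qed
      define \<Delta> where "\<Delta> t = (1 / (1 + (y + h) * m t) - 1 / (1 + y * m t)) / h - g t" for t
      have "integrable M (\<lambda>t. 1 / (1 + (y + h) * m t) - 1 / (1 + y * m t))"
        using i1 i2 by (rule Bochner_Integration.integrable_diff)
      hence "integrable M (\<lambda>t. (1 / (1 + (y + h) * m t) - 1 / (1 + y * m t)) / h)" by simp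
      hence id: "integrable M \<Delta>" unfolding \<Delta>_def using gi by (rule Bochner_Integration.integrable_diff)
      have "(Ntr M (y + h) - Ntr M y) / h - D = (\<integral>t. \<Delta> t \<partial>M)"
        unfolding Ntr_def D_def m_def[symmetric] \<Delta>_def using i1 i2 gi by simp
      also have "cmod \<dots> \<le> (\<integral>t. cmod (\<Delta> t) \<partial>M)"
        by (rule integral_norm_bound)
      also have "\<dots> \<le> (\<integral>t. (2 * K * K * K) * cmod h \<partial>M)"
        by (rule integral_mono[OF integrable_norm[OF id]]) (simp, unfold \<Delta>_def, rule pt)
      finally show ?case by (simp add: measure_UNIV_eq_1)
    qed
  qed
  hence "(Ntr M has_field_derivative D) (at y)" by (simp add: DERIV_def)
  thus ?thesis by blast
qed

lemma Ntr_holomorphic: "real_distribution M \<Longrightarrow> Ntr M holomorphic_on slit"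
  unfolding holomorphic_on_open[OF open_slit] using Ntr_has_derivative by blast

lemma slit_identity:
  assumes f: "f holomorphic_on slit" "g holomorphic_on slit" and e: "e > 0"
    and eq: "\<And>s. 0 < s \<Longrightarrow> s < e \<Longrightarrow> f (complex_of_real s) = g (complex_of_real s)" and y: "y \<in> slit"
  shows "f y = g y"
proof -
  define U where "U = complex_of_real ` {0<..<e}"
  define \<xi> where "\<xi> = complex_of_real (e / 2)"
  have "\<xi> islimpt U" unfolding islimpt_approachable
  proof (intro allI impI)
    fix d :: real assume d: "d > 0"
    define s where "s = e / 2 + min (d / 2) (e / 4)"
    have "0 < s" "s < e" "s \<noteq> e / 2" "\<bar>s - e / 2\<bar> < d" using d e by (auto simp: s_def min_def)
    thus "\<exists>x'\<in>U. x' \<noteq> \<xi> \<and> dist x' \<xi> < d"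
      unfolding U_def \<xi>_def by (intro bexI[of _ "complex_of_real s"]) (auto simp: dist_norm simp del: of_real_divide simp flip: of_real_diff)
  qed
  moreover have "U \<subseteq> slit" "\<xi> \<in> slit" using e by (auto simp: U_def \<xi>_def slit_iff)
  ultimately have "f y - g y = 0"
    using f eq y open_slit connected_slit
    by (intro analytic_continuation[of "\<lambda>z. f z - g z" slit U \<xi> y]) (auto simp: U_def intro: holomorphic_intros)
  thus ?thesis by simp
qed

text \<open>Off the real axis \<open>Im (Ntr M y)\<close> is \<open>- Im y\<close> times a positive
  integral. Hence \<open>1 / Ntr M y - 1\<close> maps the slit plane to itself, which allows
  subordination functions to be inserted into transforms.\<close>

lemma Ntr_nonzero:
  assumes M: "pos_dist M" and nz: "M \<noteq> return borel 0" and y: "y \<in> slit"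
  shows "Ntr M y \<noteq> 0" "1 / Ntr M y - 1 \<in> slit"
proof -
  interpret real_distribution M using M by (rule pos_distD)
  have "Ntr M y \<noteq> 0 \<and> 1 / Ntr M y - 1 \<in> slit"
  proof (cases "Im y = 0")
    case True
    define s where "s = Re y"
    have s: "s > 0" "y = of_real s" using y True by (auto simp: slit_iff s_def complex_eq_iff)
    define v where "v = 1 - ftr M s"
    have "ftr M s < 1 - measure M {0}" using s(1) by (intro ftr_less_1[OF M _ nz]) auto
    hence v: "0 < v" "v < 1" using ftr_pos[OF M nz s(1)] measure_nonneg[of M "{0}"] unfolding v_def by linarith+
    have N: "Ntr M y = of_real v" unfolding s(2) v_def by (rule Ntr_of_real[OF real_distribution_axioms s(1)])
    have "1 / Ntr M y - 1 = of_real (1 / v - 1)" by (simp add: N)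
    moreover have "1 / v - 1 > 0" using v by simp
    ultimately show ?thesis using N v by (simp add: slit_iff del: of_real_diff of_real_divide)
  next
    case False
    obtain K where K: "K > 0" "\<And>t. cmod (1 / (1 + y * of_real (max 0 t))) \<le> K" "\<And>t. 1 + y * of_real (max 0 t) \<noteq> 0"
       "\<And>t. cmod (of_real (max 0 t) / (1 + y * of_real (max 0 t))) \<le> K"
      using slit_kernel_bound[OF y] by metis
    define h where "h t = max 0 t / (cmod (1 + y * of_real (max 0 t)))\<^sup>2" for t
    have h0: "h t \<ge> 0" for t by (simp add: h_def)
    have [measurable]: "h \<in> borel_measurable borel" unfolding h_def by measurable
    have Im: "Im (1 / (1 + y * of_real (max 0 t))) = - Im y * h t" for t
      by (simp add: h_def Im_divide cmod_power2)
    have hi: "integrable M h"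
    proof (rule integrable_const_bound[of _ "K * K"])
      have "\<bar>h t\<bar> \<le> K * K" for t
      proof -
        have "h t = cmod (of_real (max 0 t) / (1 + y * of_real (max 0 t))) * cmod (1 / (1 + y * of_real (max 0 t)))"
          by (simp add: h_def norm_divide power2_eq_square)
        also have "\<dots> \<le> K * K" using K by (intro mult_mono) (auto simp: less_imp_le)
        finally show ?thesis using h0[of t] by simp
      qed
      thus "AE t in M. norm (h t) \<le> K * K" by simp
    qed simp
    have "Im (Ntr M y) = (\<integral>t. Im (1 / (1 + y * of_real (max 0 t))) \<partial>M)"
      unfolding Ntr_def by (rule integral_Im[symmetric]) (rule integrable_kernel[OF real_distribution_axioms y])
    also have "\<dots> = - Im y * (\<integral>t. h t \<partial>M)" unfolding Im by simp
    finally have 1: "Im (Ntr M y) = - Im y * (\<integral>t. h t \<partial>M)" .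
    have "(\<integral>t. h t \<partial>M) \<noteq> 0"
    proof
      assume "(\<integral>t. h t \<partial>M) = 0"
      hence "AE t in M. h t = 0" using hi h0 by (subst (asm) integral_nonneg_eq_0_iff_AE) auto
      hence "AE t in M. t = 0" using pos_dist_AE[OF M]
      proof eventually_elim
        case (elim t)
        have "(cmod (1 + y * of_real (max 0 t)))\<^sup>2 \<noteq> 0" using K(3)[of t] by simp
        hence "max 0 t = 0" using elim(1) unfolding h_def by (simp only: divide_eq_0_iff) blast
        thus ?case using elim(2) by simp
      qed
      thus False using eq_return_0[OF real_distribution_axioms] nz by blast
    qed
    hence 2: "Im (Ntr M y) \<noteq> 0" using 1 False by simp
    hence 3: "Ntr M y \<noteq> 0" by auto
    have "Im (1 / Ntr M y - 1) = - Im (Ntr M y) / ((Re (Ntr M y))\<^sup>2 + (Im (Ntr M y))\<^sup>2)" by (simp add: Im_divide)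
    moreover have "(Re (Ntr M y))\<^sup>2 + (Im (Ntr M y))\<^sup>2 > 0" using 2 by (simp add: sum_power2_gt_zero_iff)
    ultimately have "Im (1 / Ntr M y - 1) \<noteq> 0" using 2 by simp
    thus ?thesis using 3 by (simp add: slit_iff)
  qed
  thus "Ntr M y \<noteq> 0" "1 / Ntr M y - 1 \<in> slit" by auto
qed

subsection \<open>Atoms of the limit\<close>

text \<open>The points \<open>y\<^sub>n\<close> approach \<open>-1/c\<close> vertically, with \<open>1 + c y\<^sub>n = u\<^sub>n\<close>.\<close>

definition useq :: "nat \<Rightarrow> complex" where "useq n = \<i> / of_nat (Suc n)"
definition yseq :: "real \<Rightarrow> nat \<Rightarrow> complex" where "yseq c n = (useq n - 1) / of_real c"

lemma useq: "useq \<longlonglongrightarrow> 0" "useq n \<noteq> 0" "cmod (useq n) = 1 / real (Suc n)"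
proof -
  show "useq n \<noteq> 0" by (simp add: useq_def del: of_nat_Suc)
  show c: "cmod (useq n) = 1 / real (Suc n)" for n by (simp add: useq_def norm_divide del: of_nat_Suc)
  have "(\<lambda>n. cmod (useq n)) \<longlonglongrightarrow> 0" unfolding c by real_asymp
  thus "useq \<longlonglongrightarrow> 0" by (rule tendsto_norm_zero_cancel)
qed

lemma yseq: "c > 0 \<Longrightarrow> yseq c n \<in> slit" "c > 0 \<Longrightarrow> 1 + of_real c * yseq c n = useq n"
  by (auto simp: slit_iff yseq_def useq_def Im_divide_of_real Im_divide_of_nat simp del: of_nat_Suc)

text \<open>The dominating constant for all limits at \<open>-1/c\<close>. With
  \<open>\<tau> = t / c\<close> the denominator is \<open>(1 - \<tau>) + i \<delta> \<tau>\<close>: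
  for \<open>\<tau> \<ge> 1/2\<close> its imaginary part is at least \<open>\<delta> / 2\<close>,
  otherwise its real part exceeds \<open>1/2\<close>, and \<open>\<delta> \<le> 1\<close>.\<close>

lemma useq_kernel_bound:
  assumes c: "c > 0" shows "cmod (useq n / (1 + yseq c n * of_real (max 0 t))) \<le> 2"
proof -
  define \<tau> where "\<tau> = max 0 t / c"
  define \<delta> where "\<delta> = 1 / real (Suc n)"
  have \<delta>: "0 < \<delta>" "\<delta> \<le> 1" by (simp_all add: \<delta>_def)
  have "1 + yseq c n * of_real (max 0 t) = Complex (1 - \<tau>) (\<delta> * \<tau>)"
    using c by (simp add: complex_eq_iff yseq_def useq_def \<tau>_def \<delta>_def Im_divide_of_real Re_divide_of_real Im_divide_of_nat Re_divide_of_nat del: of_nat_Suc)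
  hence n2: "(cmod (1 + yseq c n * of_real (max 0 t)))\<^sup>2 = (1 - \<tau>)\<^sup>2 + (\<delta> * \<tau>)\<^sup>2" by (simp add: cmod_power2)
  have "\<delta>\<^sup>2 \<le> 4 * ((1 - \<tau>)\<^sup>2 + (\<delta> * \<tau>)\<^sup>2)"
  proof (cases "\<tau> \<ge> 1 / 2")
    case True
    hence "\<delta> * 1 \<le> \<delta> * (2 * \<tau>)" using \<delta> by (intro mult_left_mono) auto
    hence "\<delta>\<^sup>2 \<le> (2 * (\<delta> * \<tau>))\<^sup>2" using \<delta> by (intro power_mono) auto
    thus ?thesis by (simp add: power_mult_distrib) (smt (verit) zero_le_power2)
  next
    case False
    have "\<delta>\<^sup>2 \<le> 1" using \<delta> by (simp add: power_le_one)
    moreover have "1\<^sup>2 \<le> (2 * (1 - \<tau>))\<^sup>2" using False by (intro power_mono) auto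
    hence "1 \<le> 4 * (1 - \<tau>)\<^sup>2" by (simp only: power_mult_distrib) simp
    ultimately show ?thesis by (smt (verit) zero_le_power2)
  qed
  hence "\<delta>\<^sup>2 \<le> (2 * cmod (1 + yseq c n * of_real (max 0 t)))\<^sup>2" unfolding power_mult_distrib n2 by simp
  hence le: "\<delta> \<le> 2 * cmod (1 + yseq c n * of_real (max 0 t))" by (rule power2_le_imp_le) simp
  hence "cmod (1 + yseq c n * of_real (max 0 t)) > 0" using \<delta> by linarith
  thus ?thesis using le unfolding norm_divide useq(3) \<delta>_def[symmetric] by (simp add: divide_le_eq)
qed

text \<open>The integrand equals 1 at \<open>t = c\<close> and tends to 0 elsewhere, so dominated
  convergence isolates the atom.\<close>

lemma atom_limit:
  assumes M: "pos_dist M" and c: "c > 0"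
  shows "(\<lambda>n. useq n * Ntr M (yseq c n)) \<longlonglongrightarrow> of_real (measure M {c})"
    and "cmod (useq n * Ntr M (yseq c n)) \<le> 2"
proof -
  interpret real_distribution M using M by (rule pos_distD)
  have eq: "useq n * Ntr M (yseq c n) = (\<integral>t. useq n / (1 + yseq c n * of_real (max 0 t)) \<partial>M)" for n
    unfolding Ntr_def using integral_mult_right_zero[of M "useq n" "\<lambda>t. 1 / (1 + yseq c n * of_real (max 0 t))"] by simp
  have meas: "(\<lambda>t. useq n / (1 + yseq c n * of_real (max 0 t))) \<in> borel_measurable borel" for n by measurable
  have int: "integrable M (\<lambda>t. useq n / (1 + yseq c n * of_real (max 0 t)))" for n
    using useq_kernel_bound[OF c] meas by (intro integrable_const_bound[of _ 2]) auto
  have "(\<lambda>n. \<integral>t. useq n / (1 + yseq c n * of_real (max 0 t)) \<partial>M) \<longlonglongrightarrow> (\<integral>t. complex_of_real (indicator {c} t) \<partial>M)"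
  proof (rule integral_dominated_convergence[where w = "\<lambda>_. 2"])
    show "AE t in M. (\<lambda>n. useq n / (1 + yseq c n * of_real (max 0 t))) \<longlonglongrightarrow> complex_of_real (indicator {c} t)"
    proof (intro AE_I2)
      fix t
      show "(\<lambda>n. useq n / (1 + yseq c n * of_real (max 0 t))) \<longlonglongrightarrow> complex_of_real (indicator {c} t)"
      proof (cases "t = c")
        case True
        have "useq n / (1 + yseq c n * of_real (max 0 t)) = 1" for n
          using True c yseq(2)[OF c, of n] useq(2)[of n] by (simp add: max_def mult.commute)
        thus ?thesis using True by simp
      next
        case False
        have "yseq c \<longlonglongrightarrow> (0 - 1) / of_real c" unfolding yseq_def using c by (intro tendsto_intros useq) auto
        moreover have nz: "1 + (0 - 1) / of_real c * complex_of_real (max 0 t) \<noteq> 0"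
        proof -
          have "1 + (0 - 1) / of_real c * complex_of_real (max 0 t) = of_real (1 - max 0 t / c)" by simp
          moreover have "1 - max 0 t / c \<noteq> 0" using False c by (auto simp: max_def)
          ultimately show ?thesis by (metis of_real_eq_0_iff)
        qed
        ultimately have "(\<lambda>n. useq n / (1 + yseq c n * of_real (max 0 t))) \<longlonglongrightarrow> 0 / (1 + (0 - 1) / of_real c * of_real (max 0 t))"
          by (intro tendsto_intros useq) auto
        thus ?thesis using False by simp
      qed
    qed
    show "AE t in M. norm (useq n / (1 + yseq c n * of_real (max 0 t))) \<le> 2" for n
      using useq_kernel_bound[OF c] by simp
  qed (use meas in auto)
  also have "(\<integral>t. complex_of_real (indicator {c} t) \<partial>M) = of_real (measure M {c})"
    by (subst integral_complex_of_real) simp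
  finally show "(\<lambda>n. useq n * Ntr M (yseq c n)) \<longlonglongrightarrow> of_real (measure M {c})" unfolding eq .
  have "cmod (\<integral>t. useq n / (1 + yseq c n * of_real (max 0 t)) \<partial>M) \<le> (\<integral>t. cmod (useq n / (1 + yseq c n * of_real (max 0 t))) \<partial>M)"
    by (rule integral_norm_bound)
  also have "\<dots> \<le> (\<integral>t. 2 \<partial>M)" using int useq_kernel_bound[OF c] by (intro integral_mono integrable_norm) auto
  finally show "cmod (useq n * Ntr M (yseq c n)) \<le> 2" unfolding eq by (simp add: measure_UNIV_eq_1)
qed

text \<open>The limits \<open>lim u\<^sub>n / (1 + x \<Omega>\<^sub>n)\<close> can be nonzero for one \<open>x\<close> only, namely \<open>x = a\<close> with \<open>\<Omega>\<^sub>n \<rightarrow> -1/a\<close>,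
  so the atom of \<open>\<rho>\<close> at \<open>c\<close> comes from a single atom of \<open>\<mu>\<close>.\<close>

lemma atom_one_side:
  fixes \<Omega> :: "nat \<Rightarrow> complex"
  assumes mu: "pos_dist \<mu>" and rho: "pos_dist \<rho>" and c: "c > 0" and w: "measure \<rho> {c} > 0"
    and K: "\<And>x. x > 0 \<Longrightarrow> \<exists>\<sigma>. pos_dist \<sigma> \<and> (\<forall>n. Ntr \<sigma> (yseq c n) * (1 + of_real x * \<Omega> n) = 1)"
    and sub: "\<And>n. Ntr \<rho> (yseq c n) = Ntr \<mu> (\<Omega> n)"
  obtains a \<alpha> where "a > 0" "\<alpha> > 0" "measure \<rho> {c} = \<alpha> * measure \<mu> {a}"
    "(\<lambda>n. useq n / (1 + of_real a * \<Omega> n)) \<longlonglongrightarrow> of_real \<alpha>"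
proof -
  interpret real_distribution \<mu> using mu by (rule pos_distD)
  \<comment> \<open>For each \<open>x\<close> the quotient equals
    \<open>useq n * Ntr \<sigma> (yseq c n)\<close> for a probability measure
    \<open>\<sigma>\<close>: its limit exists and is the mass of \<open>\<sigma>\<close> at
    \<open>c\<close>, and the bound 2 permits passing to the limit under the integral over
    \<open>\<mu>\<close>.\<close>
  have "\<exists>\<alpha>. (\<lambda>n. useq n / (1 + of_real x * \<Omega> n)) \<longlonglongrightarrow> complex_of_real \<alpha> \<and> \<alpha> \<ge> 0 \<and>
     (\<forall>n. cmod (useq n / (1 + of_real x * \<Omega> n)) \<le> 2)" if x: "x > 0" for x
  proof -
    obtain \<sigma> where s: "pos_dist \<sigma>" "\<And>n. Ntr \<sigma> (yseq c n) * (1 + of_real x * \<Omega> n) = 1" using K[OF x] by blast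
    have "useq n / (1 + of_real x * \<Omega> n) = useq n * Ntr \<sigma> (yseq c n)" for n
    proof -
      have "1 + of_real x * \<Omega> n \<noteq> 0" using s(2)[of n] by auto
      thus ?thesis using s(2)[of n] by (simp add: field_simps)
    qed
    thus ?thesis using atom_limit[OF s(1) c] by (intro exI[of _ "measure \<sigma> {c}"]) auto
  qed
  then obtain L where L: "\<And>x. x > 0 \<Longrightarrow> (\<lambda>n. useq n / (1 + of_real x * \<Omega> n)) \<longlonglongrightarrow> complex_of_real (L x)"
    "\<And>x. x > 0 \<Longrightarrow> L x \<ge> 0" "\<And>x n. x > 0 \<Longrightarrow> cmod (useq n / (1 + of_real x * \<Omega> n)) \<le> 2" by metis
  define k where "k n x = useq n / (1 + \<Omega> n * of_real (max 0 x))" for n x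
  define g where "g x = (if x > 0 then complex_of_real (L x) else 0)" for x
  have km: "k n \<in> borel_measurable borel" for n unfolding k_def by measurable
  have kg: "(\<lambda>n. k n x) \<longlonglongrightarrow> g x" for x
  proof (cases "x > 0")
    case True
    thus ?thesis using L(1)[OF True] by (simp add: k_def g_def max_def mult.commute)
  next
    case False
    thus ?thesis using useq(1) by (simp add: k_def g_def max_def)
  qed
  have kb: "cmod (k n x) \<le> 2" for n x
  proof (cases "x > 0")
    case True
    thus ?thesis using L(3)[OF True] by (simp add: k_def max_def mult.commute)
  next
    case False
    thus ?thesis by (simp add: k_def max_def useq(3) divide_le_eq)
  qed
  have gm: "g \<in> borel_measurable borel" using km kg by (rule borel_measurable_LIMSEQ_metric)
  have "(\<lambda>n. \<integral>x. k n x \<partial>\<mu>) \<longlonglongrightarrow> (\<integral>x. g x \<partial>\<mu>)"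
    using km kg kb gm by (intro integral_dominated_convergence[where w = "\<lambda>_. 2"]) auto
  moreover have "(\<integral>x. k n x \<partial>\<mu>) = useq n * Ntr \<rho> (yseq c n)" for n
    unfolding sub unfolding Ntr_def k_def using integral_mult_right_zero[of \<mu> "useq n" "\<lambda>t. 1 / (1 + \<Omega> n * of_real (max 0 t))"] by simp
  ultimately have "(\<lambda>n. useq n * Ntr \<rho> (yseq c n)) \<longlonglongrightarrow> (\<integral>x. g x \<partial>\<mu>)" by simp
  hence wg: "complex_of_real (measure \<rho> {c}) = (\<integral>x. g x \<partial>\<mu>)" using atom_limit(1)[OF rho c] by (rule LIMSEQ_unique[rotated])
  have "\<exists>a. g a \<noteq> 0"
  proof (rule ccontr)
    assume "\<not> (\<exists>a. g a \<noteq> 0)"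
    hence "g = (\<lambda>_. 0)" by auto
    thus False using wg w by simp
  qed
  then obtain a where "g a \<noteq> 0" by blast
  hence a: "a > 0" "L a \<noteq> 0" by (auto simp: g_def split: if_splits)
  have a\<alpha>: "L a > 0" using L(2)[OF a(1)] a(2) by simp
  have "(\<lambda>n. useq n / (useq n / (1 + of_real a * \<Omega> n))) \<longlonglongrightarrow> 0 / complex_of_real (L a)"
    using a by (intro tendsto_intros useq L(1)) auto
  hence "(\<lambda>n. 1 + of_real a * \<Omega> n) \<longlonglongrightarrow> 0" using useq(2) by simp
  hence "(\<lambda>n. ((1 + of_real a * \<Omega> n) - 1) / of_real a) \<longlonglongrightarrow> (0 - 1) / complex_of_real a" using a by (intro tendsto_intros) auto
  hence om: "\<Omega> \<longlonglongrightarrow> - 1 / complex_of_real a" using a by simp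
  have g0: "g x = (if x = a then complex_of_real (L a) else 0)" for x
  proof (cases "x > 0 \<and> x \<noteq> a")
    case True
    have "1 + of_real x * (- 1 / complex_of_real a) = of_real (1 - x / a)" by simp
    moreover have "1 - x / a \<noteq> 0" using True a by auto
    ultimately have "1 + of_real x * (- 1 / complex_of_real a) \<noteq> 0" by (metis of_real_eq_0_iff)
    hence "(\<lambda>n. useq n / (1 + of_real x * \<Omega> n)) \<longlonglongrightarrow> 0 / (1 + of_real x * (- 1 / complex_of_real a))"
      by (intro tendsto_intros useq om)
    hence "complex_of_real (L x) = 0" using L(1)[of x] True LIMSEQ_unique by fastforce
    thus ?thesis using True by (simp add: g_def)
  next
    case False
    thus ?thesis using a(1) unfolding g_def by (cases "x = a") simp_all
  qed
  have "(\<integral>x. g x \<partial>\<mu>) = (\<integral>x. complex_of_real (L a * indicator {a} x) \<partial>\<mu>)"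
    by (intro Bochner_Integration.integral_cong) (auto simp: g0)
  also have "\<dots> = complex_of_real (\<integral>x. L a * indicator {a} x \<partial>\<mu>)" by (rule integral_complex_of_real)
  also have "(\<integral>x. L a * indicator {a} x \<partial>\<mu>) = L a * measure \<mu> {a}" by simp
  finally have "measure \<rho> {c} = L a * measure \<mu> {a}" using wg by (simp only: of_real_eq_iff)
  thus ?thesis using that[OF a(1) a\<alpha> _ L(1)[OF a(1)]] by blast
qed

context two_pos_dists
begin

text \<open>Subordination: the kernels determine \<open>\<Omega>\<^sub>1, \<Omega>\<^sub>2\<close> with \<open>N\<^sub>\<rho> = N\<^sub>\<mu> \<circ> \<Omega>\<^sub>1 = N\<^sub>\<nu> \<circ> \<Omega>\<^sub>2\<close> and
  \<open>\<Omega>\<^sub>1 \<Omega>\<^sub>2 N\<^sub>\<rho> = y (1 - N\<^sub>\<rho>)\<close>.\<close>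

lemma atom_bound:
  assumes r: "S_mult_rel \<mu> \<nu> \<rho>" and c: "c > 0" and w: "measure \<rho> {c} > 0"
    and K1: "\<And>l. l > 0 \<Longrightarrow> \<exists>\<sigma>. pos_dist \<sigma> \<and> (\<forall>t a b. 0 < t \<longrightarrow> a > 0 \<longrightarrow> b > 0 \<longrightarrow> ftr \<mu> a = t \<longrightarrow> ftr \<nu> b = t \<longrightarrow>
       ftr \<sigma> (a * b * (1 - t) / t) = l * a / (1 + l * a))"
    and K2: "\<And>l. l > 0 \<Longrightarrow> \<exists>\<sigma>. pos_dist \<sigma> \<and> (\<forall>t a b. 0 < t \<longrightarrow> a > 0 \<longrightarrow> b > 0 \<longrightarrow> ftr \<mu> a = t \<longrightarrow> ftr \<nu> b = t \<longrightarrow>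
       ftr \<sigma> (a * b * (1 - t) / t) = l * b / (1 + l * b))"
  obtains a b where "a > 0" "b > 0" "a * b = c" "measure \<mu> {a} + measure \<nu> {b} = 1 + measure \<rho> {c}"
proof -
  have rho: "pos_dist \<rho>" using r by (simp add: S_mult_rel_def)
  have rho0: "\<rho> \<noteq> return borel 0" using r by (rule S_mult_rel_nontrivial)
  obtain e where e: "e > 0" "ftr \<rho> e < tmax" using ftr_small[OF pos_distD[OF rho] tmax(1)] by blast
  have pre: "\<exists>t a b. 0 < t \<and> t < 1 \<and> a > 0 \<and> b > 0 \<and> ftr \<mu> a = t \<and> ftr \<nu> b = t \<and> ftr \<rho> s = t \<and> s = a * b * (1 - t) / t"
    if s: "0 < s" "s < e" for s
  proof -
    have "ftr \<rho> s \<le> ftr \<rho> e" using s by (intro ftr_mono pos_distD[OF rho]) auto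
    hence lt: "ftr \<rho> s < tmax" using e(2) by linarith
    have "0 < ftr \<rho> s" by (rule ftr_pos[OF rho rho0 s(1)])
    moreover have "ftr \<rho> s < 1" using lt tmax by simp
    ultimately show ?thesis using S_mult_relE[OF r s(1) lt] by metis
  qed
  from K1 obtain \<sigma> where s: "\<And>l. l > 0 \<Longrightarrow> pos_dist (\<sigma> l)"
    "\<And>l t a b. l > 0 \<Longrightarrow> 0 < t \<Longrightarrow> a > 0 \<Longrightarrow> b > 0 \<Longrightarrow> ftr \<mu> a = t \<Longrightarrow> ftr \<nu> b = t \<Longrightarrow> ftr (\<sigma> l) (a * b * (1 - t) / t) = l * a / (1 + l * a)"
    by metis
  from K2 obtain \<sigma>' where s': "\<And>l. l > 0 \<Longrightarrow> pos_dist (\<sigma>' l)"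
    "\<And>l t a b. l > 0 \<Longrightarrow> 0 < t \<Longrightarrow> a > 0 \<Longrightarrow> b > 0 \<Longrightarrow> ftr \<mu> a = t \<Longrightarrow> ftr \<nu> b = t \<Longrightarrow> ftr (\<sigma>' l) (a * b * (1 - t) / t) = l * b / (1 + l * b)"
    by metis
  obtain t0 a0 b0 where p0: "0 < t0" "t0 < (1::real)" "a0 > 0" "b0 > 0" "ftr \<mu> a0 = t0" "ftr \<nu> b0 = t0" "e / 2 = a0 * b0 * (1 - t0) / t0"
    using pre[of "e / 2"] e by auto
  have z: "ftr (return borel 0) x = 0" for x unfolding ftr_def by (simp add: integral_return gker_def)
  have "ftr (\<sigma> 1) (a0 * b0 * (1 - t0) / t0) \<noteq> 0" "ftr (\<sigma>' 1) (a0 * b0 * (1 - t0) / t0) \<noteq> 0"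
    using s(2)[of 1 t0 a0 b0] s'(2)[of 1 t0 a0 b0] p0 by auto
  hence sn: "\<sigma> 1 \<noteq> return borel 0" "\<sigma>' 1 \<noteq> return borel 0" using z by metis+
  have s1: "pos_dist (\<sigma> 1)" "pos_dist (\<sigma>' 1)" using s(1) s'(1) by auto
  \<comment> \<open>The kernel for \<open>l = 1\<close> is \<open>1 / (1 + \<Omega>)\<close>.
    Solving for \<open>\<Omega>\<close> makes it holomorphic on the slit plane, and at real
    \<open>x\<close> in \<open>(0, e)\<close> it is the preimage \<open>a\<close> with
    \<open>ftr \<mu> a = ftr \<rho> x\<close>.\<close>
  define \<Omega> where "\<Omega> y = 1 / Ntr (\<sigma> 1) y - 1" for y
  define \<Omega>' where "\<Omega>' y = 1 / Ntr (\<sigma>' 1) y - 1" for y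
  have om: "\<Omega> y \<in> slit" "\<Omega>' y \<in> slit" if "y \<in> slit" for y
    unfolding \<Omega>_def \<Omega>'_def using Ntr_nonzero(2)[OF s1(1) sn(1) that] Ntr_nonzero(2)[OF s1(2) sn(2) that] .
  have omh: "\<Omega> holomorphic_on slit" "\<Omega>' holomorphic_on slit"
    unfolding \<Omega>_def \<Omega>'_def using Ntr_nonzero(1)[OF s1(1) sn(1)] Ntr_nonzero(1)[OF s1(2) sn(2)]
    by (auto intro!: holomorphic_intros Ntr_holomorphic pos_distD s1)
  have frac: "1 - l * x / (1 + l * x) = 1 / (1 + l * x)" if "l > 0" "x > 0" for l x :: real
  proof -
    have "1 + l * x > 0" using that by (simp add: add_pos_pos)
    thus ?thesis by (simp add: field_simps)
  qed
  have ax: "\<exists>t a b. 0 < t \<and> t < 1 \<and> a > 0 \<and> b > 0 \<and> ftr \<mu> a = t \<and> ftr \<nu> b = t \<and> ftr \<rho> x = t \<and> x = a * b * (1 - t) / t \<and>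
      \<Omega> (of_real x) = of_real a \<and> \<Omega>' (of_real x) = of_real b \<and>
      (\<forall>l>0. Ntr (\<sigma> l) (of_real x) = of_real (1 / (1 + l * a))) \<and> (\<forall>l>0. Ntr (\<sigma>' l) (of_real x) = of_real (1 / (1 + l * b)))"
    if x: "0 < x" "x < e" for x
  proof -
    obtain t a b where p: "0 < t" "t < 1" "a > 0" "b > 0" "ftr \<mu> a = t" "ftr \<nu> b = t" "ftr \<rho> x = t" "x = a * b * (1 - t) / t"
      using pre[OF x] by blast
    have N1: "Ntr (\<sigma> l) (of_real x) = of_real (1 / (1 + l * a))" if l: "l > 0" for l
      unfolding Ntr_of_real[OF pos_distD[OF s(1)[OF l]] x(1)] frac[OF l p(3), symmetric] using s(2)[OF l p(1,3-6)] p(8) by simp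
    have N2: "Ntr (\<sigma>' l) (of_real x) = of_real (1 / (1 + l * b))" if l: "l > 0" for l
      unfolding Ntr_of_real[OF pos_distD[OF s'(1)[OF l]] x(1)] frac[OF l p(4), symmetric] using s'(2)[OF l p(1,3-6)] p(8) by simp
    have "\<Omega> (of_real x) = of_real a" "\<Omega>' (of_real x) = of_real b" unfolding \<Omega>_def \<Omega>'_def using N1[of 1] N2[of 1] by simp_all
    thus ?thesis using p N1 N2 by blast
  qed
  have slit_ys: "yseq c n \<in> slit" for n using yseq(1)[OF c] .
  \<comment> \<open>Each identity is known on the real interval \<open>(0, e)\<close> and extended
    by \<open>slit_identity\<close>; this one ties the kernels for all \<open>l\<close> to the
    single function \<open>\<Omega>\<close>.\<close>
  have I1: "Ntr (\<sigma> l) y * (1 + of_real l * \<Omega> y) = 1" if l: "l > 0" and y: "y \<in> slit" for l y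
  proof (rule slit_identity[OF _ _ e(1) _ y])
    show "(\<lambda>y. Ntr (\<sigma> l) y * (1 + of_real l * \<Omega> y)) holomorphic_on slit"
      by (intro holomorphic_intros omh Ntr_holomorphic pos_distD s(1) l)
    fix x assume x: "0 < x" "x < e"
    obtain a where a: "a > 0" "\<Omega> (of_real x) = of_real a" "Ntr (\<sigma> l) (of_real x) = of_real (1 / (1 + l * a))" using ax[OF x] l by blast
    have "1 + l * a > 0" using l a by (simp add: add_pos_pos)
    hence "1 / (1 + l * a) * (1 + l * a) = 1" by simp
    thus "Ntr (\<sigma> l) (of_real x) * (1 + of_real l * \<Omega> (of_real x)) = 1"
      unfolding a(2,3) by (metis of_real_1 of_real_add of_real_mult)
  qed (rule holomorphic_on_const)
  have I1': "Ntr (\<sigma>' l) y * (1 + of_real l * \<Omega>' y) = 1" if l: "l > 0" and y: "y \<in> slit" for l y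
  proof (rule slit_identity[OF _ _ e(1) _ y])
    show "(\<lambda>y. Ntr (\<sigma>' l) y * (1 + of_real l * \<Omega>' y)) holomorphic_on slit"
      by (intro holomorphic_intros omh Ntr_holomorphic pos_distD s'(1) l)
    fix x assume x: "0 < x" "x < e"
    obtain a where a: "a > 0" "\<Omega>' (of_real x) = of_real a" "Ntr (\<sigma>' l) (of_real x) = of_real (1 / (1 + l * a))" using ax[OF x] l by blast
    have "1 + l * a > 0" using l a by (simp add: add_pos_pos)
    hence "1 / (1 + l * a) * (1 + l * a) = 1" by simp
    thus "Ntr (\<sigma>' l) (of_real x) * (1 + of_real l * \<Omega>' (of_real x)) = 1"
      unfolding a(2,3) by (metis of_real_1 of_real_add of_real_mult)
  qed (rule holomorphic_on_const)
  have comp: "(\<lambda>y. Ntr \<mu> (\<Omega> y)) holomorphic_on slit" "(\<lambda>y. Ntr \<nu> (\<Omega>' y)) holomorphic_on slit"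
    using holomorphic_on_compose_gen[OF omh(1) Ntr_holomorphic[OF pos_distD[OF mu]]]
      holomorphic_on_compose_gen[OF omh(2) Ntr_holomorphic[OF pos_distD[OF nu]]] om by (auto simp: o_def)
  have I2: "Ntr \<rho> y = Ntr \<mu> (\<Omega> y)" if y: "y \<in> slit" for y
  proof (rule slit_identity[OF Ntr_holomorphic[OF pos_distD[OF rho]] comp(1) e(1) _ y])
    fix x assume x: "0 < x" "x < e"
    obtain a where a: "a > 0" "\<Omega> (of_real x) = of_real a" "ftr \<rho> x = ftr \<mu> a" using ax[OF x] by metis
    show "Ntr \<rho> (of_real x) = Ntr \<mu> (\<Omega> (of_real x))"
      unfolding a(2) Ntr_of_real[OF pos_distD[OF rho] x(1)] Ntr_of_real[OF pos_distD[OF mu] a(1)] a(3) ..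
  qed
  have I2': "Ntr \<rho> y = Ntr \<nu> (\<Omega>' y)" if y: "y \<in> slit" for y
  proof (rule slit_identity[OF Ntr_holomorphic[OF pos_distD[OF rho]] comp(2) e(1) _ y])
    fix x assume x: "0 < x" "x < e"
    obtain a where a: "a > 0" "\<Omega>' (of_real x) = of_real a" "ftr \<rho> x = ftr \<nu> a" using ax[OF x] by metis
    show "Ntr \<rho> (of_real x) = Ntr \<nu> (\<Omega>' (of_real x))"
      unfolding a(2) Ntr_of_real[OF pos_distD[OF rho] x(1)] Ntr_of_real[OF pos_distD[OF nu] a(1)] a(3) ..
  qed
  have I3: "\<Omega> y * \<Omega>' y * Ntr \<rho> y = y * (1 - Ntr \<rho> y)" if y: "y \<in> slit" for y
  proof (rule slit_identity[OF _ _ e(1) _ y])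
    show "(\<lambda>y. \<Omega> y * \<Omega>' y * Ntr \<rho> y) holomorphic_on slit"
      by (intro holomorphic_intros omh Ntr_holomorphic pos_distD rho)
    show "(\<lambda>y. y * (1 - Ntr \<rho> y)) holomorphic_on slit"
      by (intro holomorphic_intros Ntr_holomorphic pos_distD rho)
    fix x assume x: "0 < x" "x < e"
    obtain t a b where p: "0 < t" "ftr \<rho> x = t" "x = a * b * (1 - t) / t" "\<Omega> (of_real x) = of_real a" "\<Omega>' (of_real x) = of_real b"
      using ax[OF x] by blast
    have "a * b * (1 - t) = x * (1 - (1 - t))" using p(1,3) by simp
    hence "complex_of_real (a * b * (1 - t)) = of_real (x * (1 - (1 - t)))" by (simp only:)
    thus "\<Omega> (of_real x) * \<Omega>' (of_real x) * Ntr \<rho> (of_real x) = of_real x * (1 - Ntr \<rho> (of_real x))"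
      unfolding p(4,5) Ntr_of_real[OF pos_distD[OF rho] x(1)] p(2) by (simp only: of_real_mult of_real_diff of_real_1)
  qed
  define W where "W = measure \<rho> {c}"
  obtain a \<alpha> where a: "a > 0" "\<alpha> > 0" "W = \<alpha> * measure \<mu> {a}" "(\<lambda>n. useq n / (1 + of_real a * \<Omega> (yseq c n))) \<longlonglongrightarrow> of_real \<alpha>"
    unfolding W_def
  proof (rule atom_one_side[OF mu rho c w, of "\<lambda>n. \<Omega> (yseq c n)"])
    show "\<exists>\<tau>. pos_dist \<tau> \<and> (\<forall>n. Ntr \<tau> (yseq c n) * (1 + of_real x * \<Omega> (yseq c n)) = 1)" if "x > 0" for x
      using s(1)[OF that] I1[OF that slit_ys] by blast
  qed (use I2[OF slit_ys] in auto)
  obtain b \<beta> where b: "b > 0" "\<beta> > 0" "W = \<beta> * measure \<nu> {b}" "(\<lambda>n. useq n / (1 + of_real b * \<Omega>' (yseq c n))) \<longlonglongrightarrow> of_real \<beta>"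
    unfolding W_def
  proof (rule atom_one_side[OF nu rho c w, of "\<lambda>n. \<Omega>' (yseq c n)"])
    show "\<exists>\<tau>. pos_dist \<tau> \<and> (\<forall>n. Ntr \<tau> (yseq c n) * (1 + of_real x * \<Omega>' (yseq c n)) = 1)" if "x > 0" for x
      using s'(1)[OF that] I1'[OF that slit_ys] by blast
  qed (use I2'[OF slit_ys] in auto)
  have W: "W > 0" using w by (simp add: W_def)
  \<comment> \<open>Reciprocals of the three convergent quotients. They turn the relation between
    \<open>\<Omega>\<close>, \<open>\<Omega>'\<close> and \<open>Ntr \<rho>\<close> into an
    expansion in \<open>useq n\<close>, whose orders 0 and 1 yield \<open>a * b = c\<close> and the
    mass formula.\<close>
  define P where "P n = 1 / (useq n / (1 + of_real a * \<Omega> (yseq c n)))" for n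
  define Q where "Q n = 1 / (useq n / (1 + of_real b * \<Omega>' (yseq c n)))" for n
  define R where "R n = 1 / (useq n * Ntr \<rho> (yseq c n))" for n
  have P: "P \<longlonglongrightarrow> 1 / of_real \<alpha>" unfolding P_def using a by (intro tendsto_intros) auto
  have Q: "Q \<longlonglongrightarrow> 1 / of_real \<beta>" unfolding Q_def using b by (intro tendsto_intros) auto
  have R: "R \<longlonglongrightarrow> 1 / of_real W" unfolding R_def W_def using atom_limit(1)[OF rho c] w by (intro tendsto_intros) auto
  have uP: "of_real a * \<Omega> (yseq c n) = useq n * P n - 1" for n using useq(2)[of n] by (simp add: P_def)
  have uQ: "of_real b * \<Omega>' (yseq c n) = useq n * Q n - 1" for n using useq(2)[of n] by (simp add: Q_def)
  have Nnz: "Ntr \<rho> (yseq c n) \<noteq> 0" for n by (rule Ntr_nonzero(1)[OF rho rho0 slit_ys])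
  have uR: "useq n * R n = 1 / Ntr \<rho> (yseq c n)" for n using useq(2)[of n] by (simp add: R_def)
  have main: "of_real c * ((useq n * P n - 1) * (useq n * Q n - 1)) = of_real (a * b) * ((useq n - 1) * (useq n * R n - 1))" for n
  proof -
    define y where "y = yseq c n"
    have "\<Omega> y * \<Omega>' y = y * (1 - Ntr \<rho> y) / Ntr \<rho> y" using I3[OF slit_ys, of n] Nnz[of n] by (simp add: y_def field_simps)
    also have "\<dots> = y * (useq n * R n - 1)" using Nnz[of n] unfolding uR y_def by (simp add: field_simps)
    finally have 1: "\<Omega> y * \<Omega>' y = y * (useq n * R n - 1)" .
    have 2: "of_real c * y = useq n - 1" using yseq(2)[OF c, of n] by (simp add: y_def algebra_simps)
    have "of_real c * ((of_real a * \<Omega> y) * (of_real b * \<Omega>' y)) = of_real (a * b) * ((of_real c * y) * (useq n * R n - 1))"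
    proof -
      have "of_real c * ((of_real a * \<Omega> y) * (of_real b * \<Omega>' y)) = of_real (a * b) * (of_real c * (\<Omega> y * \<Omega>' y))" by (simp add: mult_ac)
      thus ?thesis unfolding 1 by (simp only: mult.assoc)
    qed
    thus ?thesis unfolding 2 uP[of n, folded y_def] uQ[of n, folded y_def] .
  qed
  have "(\<lambda>n. of_real c * ((useq n * P n - 1) * (useq n * Q n - 1))) \<longlonglongrightarrow> of_real c * ((0 * (1 / of_real \<alpha>) - 1) * (0 * (1 / of_real \<beta>) - 1))"
    by (intro tendsto_intros useq P Q)
  moreover have "(\<lambda>n. of_real (a * b) * ((useq n - 1) * (useq n * R n - 1))) \<longlonglongrightarrow> of_real (a * b) * ((0 - 1) * (0 * (1 / of_real W) - 1))"
    by (intro tendsto_intros useq R)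
  ultimately have "complex_of_real c = of_real (a * b)" unfolding main using LIMSEQ_unique by fastforce
  hence abc: "a * b = c" by (simp only: of_real_eq_iff)
  \<comment> \<open>The terms of order 0 cancel because \<open>a * b = c\<close>; division by
    \<open>useq n\<close> leaves the relation of first order.\<close>
  have main2: "useq n * P n * Q n - (P n + Q n) = useq n * R n - 1 - R n" for n
  proof -
    have "of_real c \<noteq> (0::complex)" using c by simp
    hence "(useq n * P n - 1) * (useq n * Q n - 1) = (useq n - 1) * (useq n * R n - 1)" using main[of n] unfolding abc by simp
    hence "useq n * (useq n * P n * Q n - (P n + Q n)) = useq n * (useq n * R n - 1 - R n)" by (simp add: algebra_simps)
    thus ?thesis using useq(2)[of n] by simp
  qed
  have "(\<lambda>n. useq n * P n * Q n - (P n + Q n)) \<longlonglongrightarrow> 0 * (1 / of_real \<alpha>) * (1 / of_real \<beta>) - (1 / of_real \<alpha> + 1 / of_real \<beta>)"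
    by (intro tendsto_intros useq P Q)
  moreover have "(\<lambda>n. useq n * R n - 1 - R n) \<longlonglongrightarrow> 0 * (1 / of_real W) - 1 - 1 / of_real W"
    by (intro tendsto_intros useq R)
  ultimately have "- (1 / complex_of_real \<alpha> + 1 / of_real \<beta>) = - 1 - 1 / of_real W" unfolding main2 using LIMSEQ_unique by fastforce
  hence "complex_of_real (1 / \<alpha> + 1 / \<beta>) = of_real (1 + 1 / W)" by (simp add: algebra_simps)
  hence "1 / \<alpha> + 1 / \<beta> = 1 + 1 / W" by (simp only: of_real_eq_iff)
  moreover have "1 / \<alpha> = measure \<mu> {a} / W" "1 / \<beta> = measure \<nu> {b} / W" using a b W by (auto simp: field_simps)
  ultimately have "(measure \<mu> {a} + measure \<nu> {b}) / W = (W + 1) / W" using W by (simp add: add_divide_distrib)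
  hence "measure \<mu> {a} + measure \<nu> {b} = 1 + W" using W by simp
  thus ?thesis using that[OF a(1) b(1) abc] by (simp add: W_def)
qed

end

subsection \<open>Kolmogorov distance\<close>

lemma bdd_cdf_diff:
  assumes "real_distribution M" "real_distribution N"
  shows "bdd_above (range (\<lambda>x. \<bar>cdf M x - cdf N x\<bar>))"
proof (rule bdd_aboveI2)
  interpret M: real_distribution M by fact
  interpret N: real_distribution N by fact
  fix x
  show "\<bar>cdf M x - cdf N x\<bar> \<le> 1"
    using M.cdf_nonneg[of x] N.cdf_nonneg[of x] M.cdf_bounded_prob[of x] N.cdf_bounded_prob[of x] by linarith
qed

lemma cdf_diff_le_kolmogorov:
  assumes "real_distribution M" "real_distribution N"
  shows "\<bar>cdf M x - cdf N x\<bar> \<le> kolmogorov_dist M N"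
  unfolding kolmogorov_dist_def by (rule cSUP_upper[OF UNIV_I bdd_cdf_diff[OF assms]])

lemma kolmogorov_dist_le: "(\<And>x. \<bar>cdf M x - cdf N x\<bar> \<le> e) \<Longrightarrow> kolmogorov_dist M N \<le> e"
  unfolding kolmogorov_dist_def by (rule cSUP_least) auto

lemma (in real_distribution) cdf_eq_left_plus_atom: "cdf M c = measure M {..<c} + measure M {c}"
proof -
  have "{..c} = {..<c} \<union> {c}" by auto
  thus ?thesis unfolding cdf_def2 using finite_measure_Union[of "{..<c}" "{c}"] by simp
qed

text \<open>An atom is the difference between the distribution function and its left limit, and each
  of the two moves by at most the Kolmogorov distance, whence the factor 2.\<close>

lemma atom_kolmogorov:
  assumes M: "real_distribution M" and N: "real_distribution N"
  shows "measure M {a} \<ge> measure N {a} - 2 * kolmogorov_dist M N"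
proof -
  interpret M: real_distribution M by fact
  interpret N: real_distribution N by fact
  define D where "D = kolmogorov_dist M N"
  have D: "\<bar>cdf M x - cdf N x\<bar> \<le> D" for x unfolding D_def by (rule cdf_diff_le_kolmogorov[OF M N])
  have "measure M {..<a} \<le> measure N {..<a} + D"
  proof (rule tendsto_le[OF _ _ M.cdf_at_left[of a]])
    show "((\<lambda>x. cdf N x + D) \<longlongrightarrow> measure N {..<a} + D) (at_left a)"
      by (intro tendsto_intros N.cdf_at_left)
    have "cdf M x \<le> cdf N x + D" for x using D[of x] by linarith
    thus "eventually (\<lambda>x. cdf M x \<le> cdf N x + D) (at_left a)" by simp
  qed simp
  moreover have "cdf N a \<le> cdf M a + D" using D[of a] by linarith
  ultimately show ?thesis using M.cdf_eq_left_plus_atom[of a] N.cdf_eq_left_plus_atom[of a] by (simp add: D_def)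
qed

text \<open>A monotone function has countably many discontinuities, so a continuity point slightly
  to the right of \<open>x\<close> is available, and right-continuity controls the loss. The next
  lemma argues in the same way from the left.\<close>

lemma weak_conv_cdf_le:
  assumes X: "\<And>n. real_distribution (X n)" and M: "real_distribution M" and wc: "weak_conv_m X M" and e: "e > 0"
  shows "eventually (\<lambda>n. cdf (X n) x \<le> cdf M x + e) sequentially"
proof -
  interpret M: real_distribution M by fact
  have mono: "mono (cdf M)" using M.cdf_nondecreasing by (rule monoI)
  have "(cdf M \<longlongrightarrow> cdf M x) (at_right x)" using M.cdf_is_right_cont[of x] by (simp add: continuous_within)
  hence "eventually (\<lambda>y. cdf M y < cdf M x + e) (at_right x)" using e by (intro order_tendstoD) auto
  then obtain b where b: "b > x" "\<And>y. x < y \<Longrightarrow> y < b \<Longrightarrow> cdf M y < cdf M x + e"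
    unfolding eventually_at_right_field by auto
  obtain y where y: "x < y" "y < b" "isCont (cdf M) y"
    using open_minus_countable[OF mono_ctble_discont[OF mono], of "{x<..<b}"] b(1) by auto
  have "(\<lambda>n. cdf (X n) y) \<longlonglongrightarrow> cdf M y" using wc y(3) by (simp add: weak_conv_m_def weak_conv_def)
  hence "eventually (\<lambda>n. cdf (X n) y < cdf M x + e) sequentially" using b(2)[OF y(1,2)] by (rule order_tendstoD)
  thus ?thesis
  proof eventually_elim
    case (elim n)
    interpret real_distribution "X n" by (rule X)
    show ?case using elim cdf_nondecreasing[of x y] y(1) by simp
  qed
qed

lemma weak_conv_left_ge:
  assumes X: "\<And>n. real_distribution (X n)" and M: "real_distribution M" and wc: "weak_conv_m X M" and e: "e > 0"
  shows "eventually (\<lambda>n. measure (X n) {..<x} \<ge> measure M {..<x} - e) sequentially"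
proof -
  interpret M: real_distribution M by fact
  have mono: "mono (cdf M)" using M.cdf_nondecreasing by (rule monoI)
  have "eventually (\<lambda>y. cdf M y > measure M {..<x} - e) (at_left x)"
    using M.cdf_at_left[of x] e by (intro order_tendstoD) auto
  then obtain b where b: "b < x" "\<And>y. b < y \<Longrightarrow> y < x \<Longrightarrow> cdf M y > measure M {..<x} - e"
    unfolding eventually_at_left_field by auto
  obtain y where y: "b < y" "y < x" "isCont (cdf M) y"
    using open_minus_countable[OF mono_ctble_discont[OF mono], of "{b<..<x}"] b(1) by auto
  have "(\<lambda>n. cdf (X n) y) \<longlonglongrightarrow> cdf M y" using wc y(3) by (simp add: weak_conv_m_def weak_conv_def)
  hence "eventually (\<lambda>n. cdf (X n) y > measure M {..<x} - e) sequentially" using b(2)[OF y(1,2)] by (rule order_tendstoD)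
  thus ?thesis
  proof eventually_elim
    case (elim n)
    interpret real_distribution "X n" by (rule X)
    have "cdf (X n) y \<le> measure (X n) {..<x}" unfolding cdf_def2 using y(2) by (intro finite_measure_mono) auto
    thus ?case using elim by simp
  qed
qed

text \<open>Polya's theorem for limits with atoms.\<close>

lemma kolmogorov_of_weak_conv:
  assumes X: "\<And>n. real_distribution (X n)" and M: "real_distribution M" and wc: "weak_conv_m X M"
    and atoms: "\<And>c e. e > 0 \<Longrightarrow> eventually (\<lambda>n. measure (X n) {c} \<ge> measure M {c} - e) sequentially"
  shows "(\<lambda>n. kolmogorov_dist (X n) M) \<longlonglongrightarrow> 0"
proof (rule LIMSEQ_I)
  fix e0 :: real assume e0: "e0 > 0"
  define e where "e = e0 / 4"
  have e: "e > 0" using e0 by (simp add: e_def)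
  interpret cdf_distribution M using M by (simp add: cdf_distribution_def)
  obtain m where m: "m > 0" "1 / real m < e" using e by (metis nat_approx_posE zero_less_Suc)
  \<comment> \<open>\<open>I' k\<close> is the quantile of \<open>M\<close> at level
    \<open>k / m\<close>; the equivalence below is established for levels strictly between 0 and
    1.\<close>
  define I' where "I' k = Inf {x. real k / real m \<le> cdf M x}" for k
  have I': "real k / real m \<le> cdf M x \<longleftrightarrow> I' k \<le> x" if "0 < k" "k < m" for k x
    unfolding I'_def using that m by (intro pseudoinverse) auto
  have left: "measure M {..<I' k} \<le> real k / real m" if k: "0 < k" "k < m" for k
  proof (rule tendsto_upperbound[OF cdf_at_left])
    have "cdf M y \<le> real k / real m" if "y < I' k" for y using I'[OF k, of y] that by linarith
    thus "eventually (\<lambda>y. cdf M y \<le> real k / real m) (at_left (I' k))"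
      unfolding eventually_at_left_field by (intro exI[of _ "I' k - 1"]) auto
  qed simp
  have e2: "e / 2 > 0" using e by simp
  \<comment> \<open>Weak convergence alone bounds closed half-lines from above and open ones from
    below. Adding or subtracting the atom at \<open>c\<close> gives the two opposite bounds, each
    estimate costing \<open>e / 2\<close>.\<close>
  have ev: "eventually (\<lambda>n. cdf (X n) c \<ge> cdf M c - e \<and> measure (X n) {..<c} \<le> measure M {..<c} + e) sequentially" for c
    using weak_conv_cdf_le[OF X M wc e2, of c] weak_conv_left_ge[OF X M wc e2, of c] atoms[OF e2, of c]
  proof eventually_elim
    case (elim n)
    interpret Xn: real_distribution "X n" by (rule X)
    show ?case using elim Xn.cdf_eq_left_plus_atom[of c] cdf_eq_left_plus_atom[of c] by linarith
  qed
  have "eventually (\<lambda>n. \<forall>k\<in>{..<m}. cdf (X n) (I' k) \<ge> cdf M (I' k) - e \<and> measure (X n) {..<I' k} \<le> measure M {..<I' k} + e) sequentially"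
    by (rule eventually_ball_finite) (use ev in auto)
  hence "eventually (\<lambda>n. norm (kolmogorov_dist (X n) M - 0) < e0) sequentially"
  proof eventually_elim
    case (elim n)
    interpret Xn: real_distribution "X n" by (rule X)
    have "\<bar>cdf (X n) x - cdf M x\<bar> \<le> 2 * e" for x
    proof -
      define k where "k = nat \<lfloor>cdf M x * real m\<rfloor>"
      have fx: "0 \<le> cdf M x * real m" using cdf_nonneg[of x] m by simp
      have "real k \<le> cdf M x * real m" "cdf M x * real m < real k + 1" using fx unfolding k_def by linarith+
      hence k: "real k / real m \<le> cdf M x" "cdf M x < real (Suc k) / real m" using m by (simp_all add: field_simps)
      have step: "real (Suc k) / real m = real k / real m + 1 / real m" by (simp add: add_divide_distrib)
      have "cdf M x - 2 * e \<le> cdf (X n) x"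
      proof (cases "0 < k \<and> k < m")
        case True
        hence "I' k \<le> x" using I'[of k x] k by blast
        hence "cdf (X n) (I' k) \<le> cdf (X n) x" by (rule Xn.cdf_nondecreasing)
        moreover have "real k / real m \<le> cdf M (I' k)" using I'[of k "I' k"] True by simp
        moreover have "cdf (X n) (I' k) \<ge> cdf M (I' k) - e" using elim True by simp
        ultimately show ?thesis using k(2) step m(2) by linarith
      next
        case False
        show ?thesis
        proof (cases "k = 0")
          case True
          thus ?thesis using k(2) m(2) e Xn.cdf_nonneg[of x] by simp
        next
          case F2: False
          hence km: "k \<ge> m" using False by auto
          hence "1 \<le> real k / real m" using m by simp
          hence one: "cdf M x \<ge> 1" using k(1) by linarith
          show ?thesis
          \<comment> \<open>No quantile at level 1 need exist, so level \<open>m - 1\<close> takes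
            its place. For \<open>m = 1\<close> the choice of \<open>m\<close> means
            \<open>e > 1\<close>, and the bound is trivial.\<close>
          proof (cases "m = 1")
            case True
            thus ?thesis using m(2) Xn.cdf_nonneg[of x] cdf_bounded_prob[of x] e by simp
          next
            case False
            hence j: "0 < m - 1" "m - 1 < m" using m by auto
            have "real (m - 1) / real m = 1 - 1 / real m" using m by (simp add: of_nat_diff diff_divide_distrib)
            hence jj: "real (m - 1) / real m \<ge> 1 - e" using m(2) by linarith
            have "real (m - 1) / real m \<le> 1" using m by simp
            hence "I' (m - 1) \<le> x" using I'[OF j, of x] one by linarith
            hence "cdf (X n) (I' (m - 1)) \<le> cdf (X n) x" by (rule Xn.cdf_nondecreasing)
            moreover have "real (m - 1) / real m \<le> cdf M (I' (m - 1))" using I'[OF j, of "I' (m - 1)"] by simp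
            moreover have "cdf (X n) (I' (m - 1)) \<ge> cdf M (I' (m - 1)) - e" using elim j by simp
            ultimately show ?thesis using jj cdf_bounded_prob[of x] by linarith
          qed
        qed
      qed
      moreover have "cdf (X n) x \<le> cdf M x + 2 * e"
      proof (cases "Suc k < m")
        case True
        have "x < I' (Suc k)" using I'[of "Suc k" x] True k(2) by linarith
        hence "cdf (X n) x \<le> measure (X n) {..<I' (Suc k)}" unfolding cdf_def2 by (intro Xn.finite_measure_mono) auto
        also have "\<dots> \<le> measure M {..<I' (Suc k)} + e" using elim True by simp
        also have "\<dots> \<le> real (Suc k) / real m + e" using left[of "Suc k"] True by simp
        finally show ?thesis using k(1) step m(2) by linarith
      next
        case False
        hence "real m \<le> real (Suc k)" by simp
        hence "1 \<le> real (Suc k) / real m" using m by simp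
        hence "1 - e \<le> cdf M x" using k(1) step m(2) by linarith
        thus ?thesis using Xn.cdf_bounded_prob[of x] e by linarith
      qed
      ultimately show ?thesis by linarith
    qed
    hence "kolmogorov_dist (X n) M \<le> 2 * e" by (rule kolmogorov_dist_le)
    moreover have "kolmogorov_dist (X n) M \<ge> 0" using cdf_diff_le_kolmogorov[OF X M, of n 0] by linarith
    ultimately show ?case using e0 by (simp add: e_def)
  qed
  thus "\<exists>N. \<forall>n\<ge>N. norm (kolmogorov_dist (X n) M - 0) < e0" by (simp add: eventually_sequentially)
qed

subsection \<open>Atoms along the sequence\<close>

lemma count_lfactors_ge:
  fixes c :: real
  assumes "[:- c, 1:] ^ k dvd (\<Prod>a\<leftarrow>rs. [:- a, 1:])" shows "k \<le> count_list rs c"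
proof -
  have "k \<le> order c (\<Prod>a\<leftarrow>rs. [:- a, 1:])" using assms by (simp add: order_divides)
  also have "\<dots> = count (proots (\<Prod>a\<leftarrow>rs. [:- a, 1:])) c" by simp
  also have "\<dots> = count_list rs c" unfolding proots_lfactors by (simp add: count_mset)
  finally show ?thesis .
qed

lemma szego_op_count_mult:
  fixes a b :: real
  assumes len: "length bs = length xs" and r: "szego_op bs (\<Prod>a\<leftarrow>xs. [:- a, 1:]) = (\<Prod>a\<leftarrow>rs. [:- a, 1:])" and a: "a \<noteq> 0"
  shows "count_list xs a + count_list bs b - length xs \<le> count_list rs (a * b)"
proof (rule count_lfactors_ge)
  define m where "m = count_list xs a"
  define p where "p = (\<Prod>a\<leftarrow>xs. [:- a, 1:])"
  have "order a p = m"
  proof -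
    have "order a p = count (proots p) a" by (simp add: p_def)
    thus ?thesis unfolding p_def proots_lfactors by (simp add: count_mset m_def)
  qed
  then obtain g where g: "p = [:- a, 1:] ^ m * g" using order_1[of a p] by (auto elim: dvdE)
  have "g \<noteq> 0" using g by (auto simp: p_def)
  hence "degree p = m + degree g" unfolding g by (simp add: degree_mult_eq degree_power_eq)
  moreover have "degree p = length xs" by (simp add: p_def degree_linear_factors)
  ultimately have "degree g \<le> length xs - m" "m \<le> length xs" by auto
  from szego_op_multiplicity[OF a len g this refl, of b]
  show "[:- (a * b), 1:] ^ (count_list xs a + count_list bs b - length xs) dvd (\<Prod>a\<leftarrow>rs. [:- a, 1:])"
    by (simp add: m_def p_def r)
qed

text \<open>A zero of order \<open>k\<close> at 0 means that the lowest \<open>k\<close>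
  coefficients vanish, and a diagonal operator preserves this.\<close>

lemma szego_op_count_zero:
  assumes r: "szego_op bs (\<Prod>a\<leftarrow>xs. [:- a, 1:]) = (\<Prod>a\<leftarrow>rs. [:- a, 1:])"
  shows "count_list xs (0::real) \<le> count_list rs 0"
proof (rule count_lfactors_ge)
  have iff: "[:- 0, 1:] ^ k dvd f \<longleftrightarrow> (\<forall>j<k. coeff f j = 0)" for k and f :: "real poly"
    using monom_1_dvd_iff'[of k f] by (simp add: monom_altdef)
  have "[:- 0, 1:] ^ count_list xs 0 dvd (\<Prod>a\<leftarrow>xs. [:- a, 1:])"
    by (induction xs) (auto intro: mult_dvd_mono dvd_mult simp del: mult_pCons_left)
  thus "[:- 0, 1:] ^ count_list xs 0 dvd (\<Prod>a\<leftarrow>rs. [:- a, 1:])"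
    unfolding iff r[symmetric] by (simp add: coeff_szego_op)
qed

lemma fin_free_mult_commute: "fin_free_mult d p q = fin_free_mult d q p"
  unfolding fin_free_mult_def by (simp add: mult_ac)

lemma weak_conv_m_Suc: "weak_conv_m (\<lambda>n. X (Suc n)) M \<longleftrightarrow> weak_conv_m X M"
  unfolding weak_conv_m_def weak_conv_def using filterlim_sequentially_Suc[of "\<lambda>n. cdf (X n) x" for x] by simp

theorem mainTheorem10:
  fixes p q :: "nat \<Rightarrow> real poly" and \<mu> \<nu> :: "real measure"
  assumes p: "\<And>d. d \<ge> 1 \<Longrightarrow> p d \<in> polys_roots_in d {0..}"
    and q: "\<And>d. d \<ge> 1 \<Longrightarrow> q d \<in> polys_roots_in d {0..}"
    and mu: "real_distribution \<mu>" "measure \<mu> {..<0} = 0"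
    and nu: "real_distribution \<nu>" "measure \<nu> {..<0} = 0"
    and conv_p: "weak_conv_m (\<lambda>d. root_measure (p d)) \<mu>"
    and conv_q: "weak_conv_m (\<lambda>d. root_measure (q d)) \<nu>"
  shows "weak_conv_m (\<lambda>d. root_measure (fin_free_mult d (p d) (q d))) (free_mult_conv \<mu> \<nu>) \<and>
         ((\<lambda>d. kolmogorov_dist (root_measure (p d)) \<mu>) \<longlonglongrightarrow> 0 \<and>
         (\<lambda>d. kolmogorov_dist (root_measure (q d)) \<nu>) \<longlonglongrightarrow> 0 \<longrightarrow>
         (\<lambda>d. kolmogorov_dist (root_measure (fin_free_mult d (p d) (q d))) (free_mult_conv \<mu> \<nu>))
            \<longlonglongrightarrow> 0)"
proof -
  have pm: "pos_dist \<mu>" "pos_dist \<nu>" using mu nu by (auto simp: pos_dist_def)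
  \<comment> \<open>The lists are indexed by \<open>d = Suc n\<close>: a limit ignores the term
    \<open>d = 0\<close>, and the root distributions are computed from nonempty lists.\<close>
  have "\<exists>xs. length xs = Suc n \<and> set xs \<subseteq> {0..} \<and> p (Suc n) = (\<Prod>a\<leftarrow>xs. [:- a, 1:])" for n
    using polys_roots_inE[OF p[of "Suc n"]] by (metis One_nat_def Suc_le_mono zero_le)
  then obtain X where X: "\<And>n. length (X n) = Suc n" "\<And>n. set (X n) \<subseteq> {0..}" "\<And>n. p (Suc n) = (\<Prod>a\<leftarrow>X n. [:- a, 1:])" by metis
  have "\<exists>xs. length xs = Suc n \<and> set xs \<subseteq> {0..} \<and> q (Suc n) = (\<Prod>a\<leftarrow>xs. [:- a, 1:])" for n
    using polys_roots_inE[OF q[of "Suc n"]] by (metis One_nat_def Suc_le_mono zero_le)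
  then obtain B where B: "\<And>n. length (B n) = Suc n" "\<And>n. set (B n) \<subseteq> {0..}" "\<And>n. q (Suc n) = (\<Prod>a\<leftarrow>B n. [:- a, 1:])" by metis
  have "\<exists>rs. length rs = Suc n \<and> set rs \<subseteq> {0..} \<and> szego_op (B n) (\<Prod>a\<leftarrow>X n. [:- a, 1:]) = (\<Prod>a\<leftarrow>rs. [:- a, 1:]) \<and>
     (\<forall>k. esym k rs = esym k (X n) * esym k (B n) / real (Suc n choose k))" for n
    using szego_op_real_rooted[OF X(2) B(2), of n n] X(1)[of n] B(1)[of n] by metis
  then obtain R where R: "\<And>n. length (R n) = Suc n" "\<And>n. set (R n) \<subseteq> {0..}"
    "\<And>n. szego_op (B n) (\<Prod>a\<leftarrow>X n. [:- a, 1:]) = (\<Prod>a\<leftarrow>R n. [:- a, 1:])"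
    "\<And>n k. esym k (R n) = esym k (X n) * esym k (B n) / real (Suc n choose k)" by metis
  have rX: "root_measure (p (Suc n)) = rmeas (X n)" and rB: "root_measure (q (Suc n)) = rmeas (B n)" for n
    by (simp_all add: rmeas_def X(3) B(3))
  have fR: "fin_free_mult (Suc n) (p (Suc n)) (q (Suc n)) = (\<Prod>a\<leftarrow>R n. [:- a, 1:])" for n
    unfolding X(3) B(3) R(3)[symmetric] by (rule fin_free_mult_eq_szego_op[OF X(1) B(1)])
  have rR: "root_measure (fin_free_mult (Suc n) (p (Suc n)) (q (Suc n))) = rmeas (R n)" for n
    unfolding fR rmeas_def ..
  \<comment> \<open>Composition is symmetric, so multiplicities at 0 of either factor pass to the
    product.\<close>
  have R': "szego_op (X n) (\<Prod>a\<leftarrow>B n. [:- a, 1:]) = (\<Prod>a\<leftarrow>R n. [:- a, 1:])" for n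
    unfolding fR[symmetric] X(3) B(3) fin_free_mult_commute[of _ "\<Prod>a\<leftarrow>X n. [:- a, 1:]"]
    by (rule fin_free_mult_eq_szego_op[OF B(1) X(1), symmetric])
  have ne: "X n \<noteq> []" "B n \<noteq> []" "R n \<noteq> []" for n using X(1)[of n] B(1)[of n] R(1)[of n] by auto
  have wX: "weak_conv_m (\<lambda>n. rmeas (X n)) \<mu>" using conv_p unfolding rX[symmetric] by (rule weak_conv_m_Suc[of "\<lambda>d. root_measure (p d)", THEN iffD2])
  have wB: "weak_conv_m (\<lambda>n. rmeas (B n)) \<nu>" using conv_q unfolding rB[symmetric] by (rule weak_conv_m_Suc[of "\<lambda>d. root_measure (q d)", THEN iffD2])
  have pX: "pos_dist (rmeas (X n))" for n using ne(1) X(2) by (rule pos_dist_rmeas)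
  have pB: "pos_dist (rmeas (B n))" for n using ne(2) B(2) by (rule pos_dist_rmeas)
  have F: "(\<lambda>n. bmean s (X n) / real (Suc n)) \<longlonglongrightarrow> ftr \<mu> s" if "s > 0" for s
    using weak_conv_imp_ftr[OF pos_distD[OF pX] mu(1) wX, of s] that by (simp add: ftr_rmeas ne X)
  have G: "(\<lambda>n. bmean s (B n) / real (Suc n)) \<longlonglongrightarrow> ftr \<nu> s" if "s > 0" for s
    using weak_conv_imp_ftr[OF pos_distD[OF pB] nu(1) wB, of s] that by (simp add: ftr_rmeas ne B)
  interpret C: dist_convolution X B R \<mu> \<nu>
    by unfold_locales (use X B R F G pm in auto)
  define \<rho> where "\<rho> = free_mult_conv \<mu> \<nu>"
  have rho: "pos_dist \<rho>" unfolding \<rho>_def by (rule C.weak_conv_R(3))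
  have wR: "weak_conv_m (\<lambda>n. rmeas (R n)) \<rho>" unfolding \<rho>_def by (rule C.weak_conv_R(1))
  have 1: "weak_conv_m (\<lambda>d. root_measure (fin_free_mult d (p d) (q d))) \<rho>"
    using wR unfolding rR[symmetric]
    by (rule weak_conv_m_Suc[of "\<lambda>d. root_measure (fin_free_mult d (p d) (q d))", THEN iffD1])
  \<comment> \<open>The points \<open>a\<close> and \<open>b\<close> do not depend on
    \<open>n\<close>: the loss of mass at \<open>c\<close> is bounded by the losses at two fixed
    points, which the Kolmogorov distances control.\<close>
  have atoms: "\<exists>a b. \<forall>n. measure (rmeas (R n)) {c} \<ge> measure \<rho> {c}
      - max 0 (measure \<mu> {a} - measure (rmeas (X n)) {a}) - max 0 (measure \<nu> {b} - measure (rmeas (B n)) {b})" for c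
  proof -
    have mX: "measure (rmeas (X n)) {a} = real (count_list (X n) a) / real (Suc n)"
      and mB: "measure (rmeas (B n)) {a} = real (count_list (B n) a) / real (Suc n)"
      and mR: "measure (rmeas (R n)) {a} = real (count_list (R n) a) / real (Suc n)" for n a
      using measure_rmeas_singleton[OF ne(1)] measure_rmeas_singleton[OF ne(2)] measure_rmeas_singleton[OF ne(3)] X(1) B(1) R(1) by auto
    consider "measure \<rho> {c} = 0" | "c = 0" | "c > 0" "measure \<rho> {c} > 0"
    proof -
      interpret rho: real_distribution \<rho> using rho by (rule pos_distD)
      have neg: "measure \<rho> {c} = 0" if "c < 0"
      proof -
        have "measure \<rho> {c} \<le> measure \<rho> {..<0}" using that by (intro rho.finite_measure_mono) auto
        moreover have "measure \<rho> {..<0} = 0" using rho by (simp add: pos_dist_def)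
        ultimately show ?thesis using measure_nonneg[of \<rho> "{c}"] by linarith
      qed
      show ?thesis
      proof (cases "measure \<rho> {c} = 0")
        case False
        hence "measure \<rho> {c} > 0" using measure_nonneg[of \<rho> "{c}"] by linarith
        moreover have "c \<ge> 0" using neg False by force
        ultimately show ?thesis using that(2,3) by (cases "c = 0") auto
      qed (rule that(1))
    qed
    thus ?thesis
    proof cases
      case 1
      have "measure (rmeas (R n)) {c} \<ge> 0" for n by simp
      thus ?thesis unfolding 1 by (intro exI[of _ 0] allI) (smt (verit) max.cobounded1)
    next
      case 2
      have "measure (rmeas (R n)) {0} \<ge> measure (rmeas (X n)) {0}" "measure (rmeas (R n)) {0} \<ge> measure (rmeas (B n)) {0}" for n
        unfolding mX mB mR using szego_op_count_zero[OF R(3)[of n]] szego_op_count_zero[OF R'[of n]] by (auto intro: divide_right_mono)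
      \<comment> \<open>In the nondegenerate case the transform of \<open>\<rho>\<close> takes every
        value in \<open>(0, tmax)\<close> and never exceeds
        \<open>1 - measure \<rho> {0}\<close>.\<close>
      moreover have "measure \<rho> {0} \<le> max (measure \<mu> {0}) (measure \<nu> {0})"
      proof (cases "\<mu> = return borel 0 \<or> \<nu> = return borel 0")
        case True
        hence "\<rho> = return borel 0" by (simp add: \<rho>_def free_mult_conv_def)
        thus ?thesis using True by (auto simp: measure_return)
      next
        case False
        interpret T: two_pos_dists \<mu> \<nu> using pm False by unfold_locales auto
        have S: "S_mult_rel \<mu> \<nu> \<rho>" unfolding \<rho>_def using C.weak_conv_R(2) False by blast
        have "t \<le> 1 - measure \<rho> {0}" if t: "0 < t" "t < T.tmax" for t
        proof -
          obtain a b where ab: "a > 0" "b > 0" "ftr \<mu> a = t" "ftr \<nu> b = t" using T.preimages[OF t] by blast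
          have "a * b * (1 - t) / t \<ge> 0" using ab t T.tmax by simp
          hence "ftr \<rho> (a * b * (1 - t) / t) \<le> 1 - measure \<rho> {0}" by (rule ftr_le_atom[OF rho])
          thus ?thesis using S_mult_relD[OF S t(1) ab] by simp
        qed
        hence "T.tmax \<le> 1 - measure \<rho> {0}" using T.tmax(1) by (intro dense_le_bounded[of 0 T.tmax]) auto
        thus ?thesis by (simp add: T.tmax_def)
      qed
      ultimately have "measure (rmeas (R n)) {0} \<ge> measure \<rho> {0} - max 0 (measure \<mu> {0} - measure (rmeas (X n)) {0})
         - max 0 (measure \<nu> {0} - measure (rmeas (B n)) {0})" for n
        by (smt (verit) max_def)
      thus ?thesis unfolding 2 by (intro exI[of _ 0]) simp
    next
      case 3
      have "\<not> (\<mu> = return borel 0 \<or> \<nu> = return borel 0)"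
      proof
        assume "\<mu> = return borel 0 \<or> \<nu> = return borel 0"
        hence "\<rho> = return borel 0" by (simp add: \<rho>_def free_mult_conv_def)
        thus False using 3 by (simp add: measure_return)
      qed
      hence nz: "\<mu> \<noteq> return borel 0" "\<nu> \<noteq> return borel 0" by auto
      interpret T: two_pos_dists \<mu> \<nu> using pm nz by unfold_locales auto
      have S: "S_mult_rel \<mu> \<nu> \<rho>" unfolding \<rho>_def using C.weak_conv_R(2) nz by blast
      have K1: "\<exists>\<sigma>. pos_dist \<sigma> \<and> (\<forall>t a b. 0 < t \<longrightarrow> a > 0 \<longrightarrow> b > 0 \<longrightarrow> ftr \<mu> a = t \<longrightarrow> ftr \<nu> b = t \<longrightarrow>
         ftr \<sigma> (a * b * (1 - t) / t) = l * a / (1 + l * a))" if "l > 0" for l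
        by (rule kernel_exists[OF X(2,1) B(2,1) F G pm(1) nz(1) pm(2) nz(2) that])
      \<comment> \<open>The kernel with respect to the other factor, obtained by exchanging
        \<open>\<mu>\<close> and \<open>\<nu>\<close>.\<close>
      have K2: "\<exists>\<sigma>. pos_dist \<sigma> \<and> (\<forall>t a b. 0 < t \<longrightarrow> a > 0 \<longrightarrow> b > 0 \<longrightarrow> ftr \<mu> a = t \<longrightarrow> ftr \<nu> b = t \<longrightarrow>
         ftr \<sigma> (a * b * (1 - t) / t) = l * b / (1 + l * b))" if l: "l > 0" for l
      proof -
        obtain \<sigma> where s: "pos_dist \<sigma>" "\<forall>t b a. 0 < t \<longrightarrow> b > 0 \<longrightarrow> a > 0 \<longrightarrow> ftr \<nu> b = t \<longrightarrow> ftr \<mu> a = t \<longrightarrow>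
         ftr \<sigma> (b * a * (1 - t) / t) = l * b / (1 + l * b)"
          using kernel_exists[OF B(2,1) X(2,1) G F pm(2) nz(2) pm(1) nz(1) l] by blast
        have "ftr \<sigma> (a * b * (1 - t) / t) = l * b / (1 + l * b)"
          if "0 < t" "a > 0" "b > 0" "ftr \<mu> a = t" "ftr \<nu> b = t" for t a b
          using s(2)[rule_format, of t b a] that by (simp only: mult.commute[of a b])
        thus ?thesis using s(1) by blast
      qed
      obtain a b where ab: "a > 0" "b > 0" "a * b = c" "measure \<mu> {a} + measure \<nu> {b} = 1 + measure \<rho> {c}"
        using T.atom_bound[OF S 3 K1 K2] by blast
      have "measure (rmeas (R n)) {c} \<ge> measure (rmeas (X n)) {a} + measure (rmeas (B n)) {b} - 1" for n
      proof -
        have "count_list (X n) a + count_list (B n) b - length (X n) \<le> count_list (R n) (a * b)"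
          using szego_op_count_mult[OF _ R(3), of n a b] X(1)[of n] B(1)[of n] ab(1) by simp
        hence "real (count_list (X n) a) + real (count_list (B n) b) - real (Suc n) \<le> real (count_list (R n) c)"
          using ab(3) X(1)[of n] by simp
        hence "(real (count_list (X n) a) + real (count_list (B n) b) - real (Suc n)) / real (Suc n) \<le> real (count_list (R n) c) / real (Suc n)"
          by (rule divide_right_mono) simp
        moreover have "(real (count_list (X n) a) + real (count_list (B n) b) - real (Suc n)) / real (Suc n) =
            real (count_list (X n) a) / real (Suc n) + real (count_list (B n) b) / real (Suc n) - 1"
          by (simp only: diff_divide_distrib add_divide_distrib) simp
        ultimately show ?thesis unfolding mX mB mR by linarith
      qed
      hence "measure (rmeas (R n)) {c} \<ge> measure \<rho> {c} - max 0 (measure \<mu> {a} - measure (rmeas (X n)) {a})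
         - max 0 (measure \<nu> {b} - measure (rmeas (B n)) {b})" for n
        using ab(4) by (smt (verit) max_def)
      thus ?thesis by (intro exI[of _ a] exI[of _ b]) simp
    qed
  qed
  have 2: "(\<lambda>d. kolmogorov_dist (root_measure (fin_free_mult d (p d) (q d))) \<rho>) \<longlonglongrightarrow> 0"
    if k: "(\<lambda>d. kolmogorov_dist (root_measure (p d)) \<mu>) \<longlonglongrightarrow> 0" "(\<lambda>d. kolmogorov_dist (root_measure (q d)) \<nu>) \<longlonglongrightarrow> 0"
  proof -
    have kX: "(\<lambda>n. kolmogorov_dist (rmeas (X n)) \<mu>) \<longlonglongrightarrow> 0" using LIMSEQ_Suc[OF k(1)] by (simp add: rX)
    have kB: "(\<lambda>n. kolmogorov_dist (rmeas (B n)) \<nu>) \<longlonglongrightarrow> 0" using LIMSEQ_Suc[OF k(2)] by (simp add: rB)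
    have "(\<lambda>n. kolmogorov_dist (rmeas (R n)) \<rho>) \<longlonglongrightarrow> 0"
    proof (rule kolmogorov_of_weak_conv[OF pos_distD[OF C.pos_R] pos_distD[OF rho] wR])
      fix c e :: real assume e: "e > 0"
      obtain a b where ab: "\<And>n. measure (rmeas (R n)) {c} \<ge> measure \<rho> {c} - max 0 (measure \<mu> {a} - measure (rmeas (X n)) {a})
         - max 0 (measure \<nu> {b} - measure (rmeas (B n)) {b})" using atoms[of c] by auto
      have "eventually (\<lambda>n. kolmogorov_dist (rmeas (X n)) \<mu> < e / 4) sequentially"
        "eventually (\<lambda>n. kolmogorov_dist (rmeas (B n)) \<nu> < e / 4) sequentially"
        using kX kB e by (auto intro!: order_tendstoD(2))
      thus "eventually (\<lambda>n. measure (rmeas (R n)) {c} \<ge> measure \<rho> {c} - e) sequentially"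
      proof eventually_elim
        case (elim n)
        have "measure \<mu> {a} - measure (rmeas (X n)) {a} \<le> 2 * kolmogorov_dist (rmeas (X n)) \<mu>"
          using atom_kolmogorov[OF pos_distD[OF pX] mu(1), of a n] by linarith
        moreover have "measure \<nu> {b} - measure (rmeas (B n)) {b} \<le> 2 * kolmogorov_dist (rmeas (B n)) \<nu>"
          using atom_kolmogorov[OF pos_distD[OF pB] nu(1), of b n] by linarith
        ultimately have "measure \<mu> {a} - measure (rmeas (X n)) {a} \<le> e / 2" "measure \<nu> {b} - measure (rmeas (B n)) {b} \<le> e / 2" "0 \<le> e / 2"
          using elim e by linarith+
        hence "max 0 (measure \<mu> {a} - measure (rmeas (X n)) {a}) \<le> e / 2" "max 0 (measure \<nu> {b} - measure (rmeas (B n)) {b}) \<le> e / 2"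
          by (simp_all only: max.bounded_iff)
        thus ?case using ab[of n] by linarith
      qed
    qed
    thus ?thesis unfolding rR[symmetric]
      by (rule LIMSEQ_imp_Suc[of "\<lambda>d. kolmogorov_dist (root_measure (fin_free_mult d (p d) (q d))) \<rho>"])
  qed
  show ?thesis using 1 2 unfolding \<rho>_def by blast
qed

end
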